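(* Every valuation on $R[y;\delta]$ with residue field $\mathbb{R}$ can be extended to a valuation on $\tilde R[y;\delta]$ with the same residue field.
   Context: A valuation on a division ring $D$ is a map $v:D\to\Gamma\cup\{\infty\}$, with $\Gamma$ an additively written totally ordered group and $\infty>\gamma$ for all $\gamma\in\Gamma$, such that $v(a)=\infty\iff a=0$, $v(ab)=v(a)+v(b)$ and $v(a+b)\ge\min\{v(a),v(b)\}$. Valuations are trivial on $\mathbb{R}$, and "residue field $\mathbb{R}$" means that the natural map from $\mathbb{R}$ to the residue division ring $\{v\ge0\}/\{v>0\}$ is an isomorphism. A valuation on an Ore domain extends uniquely to its quotient division ring and is identified with this extension. An extension of $v$ may have a larger value group. $R=\{\sum_{k\ge m}a_kx^{-k/n}\mid a_k\in\mathbb{R},m\in\mathbb{Z},n\in\mathbb{N}\}$ (Puiseux series), and $\tilde R=\{\sum_{q\in A}a_qx^{-q}\mid a_q\in\mathbb{R},\ A\subset\mathbb{Q}\text{ well-ordered}\}$ (generalized power series); $\delta(p(x))=p'(x)$ is termwise differentiation $d/dx$. $R[y;\delta]\subseteq\tilde R[y;\delta]$ are the skew polynomial rings with $yp=py+\delta(p)$. *)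

theory Defs
  imports
    "HOL-Computational_Algebra.Polynomial"
    "HOL-Algebra.Algebraic_Closure_Type"
    "HOL-Algebra.Generated_Groups"
begin

section \<open>Well-ordered sets of rationals\<close>

abbreviation wo :: "rat set \<Rightarrow> bool" where
  "wo A \<equiv> wfp_on A (<)"

lemma wo_iff: "wo A \<longleftrightarrow> (\<forall>B\<subseteq>A. B \<noteq> {} \<longrightarrow> (\<exists>m\<in>B. \<forall>b\<in>B. m \<le> b))"
  unfolding wfp_on_iff_ex_minimal by (meson not_less)

lemma wo_minE:
  assumes "wo A" "B \<subseteq> A" "B \<noteq> {}"
  obtains m where "m \<in> B" "\<And>b. b \<in> B \<Longrightarrow> m \<le> b"
proof -
  have "\<exists>m\<in>B. \<forall>b\<in>B. m \<le> b"
    using assms(1)[unfolded wo_iff, rule_format, OF assms(2,3)] .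
  then show thesis using that by blast
qed

lemma wo_subset: "wo A \<Longrightarrow> B \<subseteq> A \<Longrightarrow> wo B"
  by (rule wfp_on_subset)

lemma wo_Un:
  assumes "wo A" "wo B" shows "wo (A \<union> B)"
  unfolding wo_iff
proof (intro allI impI)
  fix C assume C: "C \<subseteq> A \<union> B" "C \<noteq> {}"
  show "\<exists>m\<in>C. \<forall>b\<in>C. m \<le> b"
  proof (cases "C \<inter> A = {} \<or> C \<inter> B = {}")
    case True
    then have "C \<subseteq> A \<or> C \<subseteq> B" using C by blast
    then show ?thesis using C assms by (metis wo_minE)
  next
    case False
    obtain m where m: "m \<in> C \<inter> A" "\<And>b. b \<in> C \<inter> A \<Longrightarrow> m \<le> b"
      using wo_minE[OF assms(1), of "C \<inter> A"] False by blast
    obtain n where n: "n \<in> C \<inter> B" "\<And>b. b \<in> C \<inter> B \<Longrightarrow> n \<le> b"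
      using wo_minE[OF assms(2), of "C \<inter> B"] False by blast
    have "min m n \<in> C" using m n by (auto simp: min_def)
    moreover have "\<forall>b\<in>C. min m n \<le> b" using m n C by (auto simp: min_le_iff_disj)
    ultimately show ?thesis by blast
  qed
qed

lemma wo_finite: "finite A \<Longrightarrow> wo A"
  unfolding wo_iff by (metis Min_in Min_le finite_subset)

lemma wo_mono_subseq:
  fixes s :: "nat \<Rightarrow> rat"
  assumes "wo A" "\<And>n. s n \<in> A"
  obtains r :: "nat \<Rightarrow> nat" where "strict_mono r" "\<And>m n. m \<le> n \<Longrightarrow> s (r m) \<le> s (r n)"
proof -
  obtain f :: "nat \<Rightarrow> nat" where f: "strict_mono f" "monoseq (\<lambda>n. s (f n))"
    using seq_monosub[of s] by blast
  from f(2) consider "\<And>m n. m \<le> n \<Longrightarrow> s (f m) \<le> s (f n)" | "\<And>m n. m \<le> n \<Longrightarrow> s (f n) \<le> s (f m)"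
    unfolding monoseq_def by blast
  then show thesis
  proof cases
    case 1
    then show ?thesis using f(1) that by blast
  next
    case 2
    obtain m where m: "m \<in> range (\<lambda>n. s (f n))" "\<And>b. b \<in> range (\<lambda>n. s (f n)) \<Longrightarrow> m \<le> b"
      using wo_minE[OF assms(1), of "range (\<lambda>n. s (f n))"] assms(2) by blast
    then obtain k where k: "m = s (f k)" by blast
    have c: "s (f (n + k)) = m" for n
      using 2[of k "n + k"] m(2)[of "s (f (n + k))"] k by auto
    have "strict_mono (\<lambda>n. f (n + k))" using f(1) by (auto simp: strict_mono_def)
    then show ?thesis using that[of "\<lambda>n. f (n + k)"] c by auto
  qed
qed

lemma wo_no_decr:
  assumes "wo A" "\<And>n. s n \<in> A" "\<And>m n :: nat. m < n \<Longrightarrow> s n < s m"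
  shows False
proof -
  obtain m where "m \<in> range s" "\<And>b. b \<in> range s \<Longrightarrow> m \<le> b"
    using wo_minE[OF assms(1), of "range s"] assms(2) by blast
  then obtain k where "\<And>n. s k \<le> s n" by blast
  with assms(3)[of k "Suc k"] show False by (metis lessI not_less)
qed

lemma woI_no_decr:
  assumes "\<And>s :: nat \<Rightarrow> rat. (\<And>n. s n \<in> A) \<Longrightarrow> (\<And>m n. m < n \<Longrightarrow> s n < s m) \<Longrightarrow> False"
  shows "wo A"
  unfolding wo_iff
proof (intro allI impI, rule ccontr)
  fix B assume B: "B \<subseteq> A" "B \<noteq> {}" and "\<not> (\<exists>m\<in>B. \<forall>b\<in>B. m \<le> b)"
  then have ex: "\<forall>m\<in>B. \<exists>b\<in>B. b < m" by (meson not_less)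
  then obtain g where g: "\<And>m. m \<in> B \<Longrightarrow> g m \<in> B \<and> g m < m" by metis
  obtain b where b: "b \<in> B" using B by blast
  define s where "s n = (g ^^ n) b" for n
  have sB: "s n \<in> B" for n by (induction n) (use b g in \<open>auto simp: s_def\<close>)
  have "s (Suc n) < s n" for n using g[OF sB[of n]] by (simp add: s_def)
  then have "m < n \<Longrightarrow> s n < s m" for m n
    by (induction n) (auto simp: less_Suc_eq intro: less_trans)
  then show False using assms[of s] sB B by blast
qed

lemma wo_plus:
  assumes "wo A" "wo B" shows "wo {a + b | a b. a \<in> A \<and> b \<in> B}"
proof (rule woI_no_decr)
  fix s :: "nat \<Rightarrow> rat"
  assume s: "\<And>n. s n \<in> {a + b | a b. a \<in> A \<and> b \<in> B}" and d: "\<And>m n. m < n \<Longrightarrow> s n < s m"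
  have "\<forall>n. \<exists>a b. a \<in> A \<and> b \<in> B \<and> s n = a + b" using s by blast
  then obtain a b where ab: "\<And>n. a n \<in> A" "\<And>n. b n \<in> B" "\<And>n. s n = a n + b n" by metis
  obtain r :: "nat \<Rightarrow> nat" where r: "strict_mono r" "\<And>m n. m \<le> n \<Longrightarrow> a (r m) \<le> a (r n)"
    using wo_mono_subseq[OF assms(1), of a] ab by blast
  show False
  proof (rule wo_no_decr[OF assms(2), of "\<lambda>n. b (r n)"])
    show "b (r n) \<in> B" for n using ab by blast
    fix m n :: nat assume "m < n"
    then have "r m < r n" using r(1) by (simp add: strict_mono_def)
    then have "s (r n) < s (r m)" by (rule d)
    moreover have "a (r m) \<le> a (r n)" using r(2) \<open>m < n\<close> by simp
    ultimately show "b (r n) < b (r m)" using ab(3) by simp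
  qed
qed

lemma wo_finite_split:
  assumes "wo A" "wo B" shows "finite {a \<in> A. q - a \<in> B}"
proof (rule ccontr)
  assume "infinite {a \<in> A. q - a \<in> B}"
  then obtain s :: "nat \<Rightarrow> rat" where s: "inj s" "range s \<subseteq> {a \<in> A. q - a \<in> B}"
    using infinite_countable_subset by blast
  obtain r :: "nat \<Rightarrow> nat" where r: "strict_mono r" "\<And>m n. m \<le> n \<Longrightarrow> s (r m) \<le> s (r n)"
    using wo_mono_subseq[OF assms(1), of s] s by blast
  show False
  proof (rule wo_no_decr[OF assms(2), of "\<lambda>n. q - s (r n)"])
    show "q - s (r n) \<in> B" for n using s by blast
    fix m n :: nat assume "m < n"
    then have "s (r m) \<noteq> s (r n)"
      using s(1) r(1) by (metis injD less_irrefl strict_mono_def)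
    with r(2)[of m n] \<open>m < n\<close> show "q - s (r n) < q - s (r m)" by simp
  qed
qed


section \<open>Generalized power series\<close>

text \<open>The series \<open>\<Sum>q. a q x\<^sup>-\<^sup>q\<close> is represented by its coefficient function \<open>a\<close>: exponents are
  negated, so that the support is well-ordered.\<close>

typedef gseries = "{a :: rat \<Rightarrow> real. wo {q. a q \<noteq> 0}}"
  morphisms gcoeff Abs_gseries
  by (rule exI[of _ "\<lambda>_. 0"]) (simp add: wo_iff)

abbreviation supp :: "gseries \<Rightarrow> rat set" where
  "supp f \<equiv> {q. gcoeff f q \<noteq> 0}"

lemma wo_supp: "wo (supp f)"
  using gcoeff[of f] by simp

lemma gseries_eqI: "(\<And>q. gcoeff f q = gcoeff g q) \<Longrightarrow> f = g"
  by (metis ext gcoeff_inject)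

lemma gcoeff_Abs: "wo {q. a q \<noteq> 0} \<Longrightarrow> gcoeff (Abs_gseries a) = a"
  by (simp add: Abs_gseries_inverse)

lemma finite_supp_split: "finite {a. gcoeff f a \<noteq> 0 \<and> gcoeff g (q - a) \<noteq> 0}"
  using wo_finite_split[OF wo_supp[of f] wo_supp[of g], of q] by simp

lemma supp_split_mem:
  assumes "gcoeff f a \<noteq> 0 \<and> gcoeff g (q - a) \<noteq> 0"
  shows "q \<in> {a + b | a b. a \<in> supp f \<and> b \<in> supp g}"
proof -
  have "q = a + (q - a) \<and> a \<in> supp f \<and> q - a \<in> supp g" using assms by simp
  then show ?thesis by blast
qed

instantiation gseries :: "{zero, one, plus, minus, uminus, times, scaleR}"
begin

definition "0 = Abs_gseries (\<lambda>_. 0)"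
definition "1 = Abs_gseries (\<lambda>q. if q = 0 then 1 else 0)"
definition "f + g = Abs_gseries (\<lambda>q. gcoeff f q + gcoeff g q)"
definition "f - g = Abs_gseries (\<lambda>q. gcoeff f q - gcoeff g q)"
definition "- f = Abs_gseries (\<lambda>q. - gcoeff f q)"
definition "r *\<^sub>R f = Abs_gseries (\<lambda>q. r * gcoeff f q)"
definition "f * g = Abs_gseries (\<lambda>q.
  \<Sum>a | gcoeff f a \<noteq> 0 \<and> gcoeff g (q - a) \<noteq> 0. gcoeff f a * gcoeff g (q - a))"

instance ..

end

lemma gcoeff_zero [simp]: "gcoeff 0 q = 0"
  unfolding zero_gseries_def by (subst gcoeff_Abs) (simp_all add: wo_iff)

lemma gcoeff_one: "gcoeff 1 q = (if q = 0 then 1 else 0)"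
  unfolding one_gseries_def by (subst gcoeff_Abs) (auto intro: wo_finite)

lemma gcoeff_add [simp]: "gcoeff (f + g) q = gcoeff f q + gcoeff g q"
  unfolding plus_gseries_def
  by (subst gcoeff_Abs) (auto intro: wo_subset[OF wo_Un[OF wo_supp[of f] wo_supp[of g]]])

lemma gcoeff_diff [simp]: "gcoeff (f - g) q = gcoeff f q - gcoeff g q"
  unfolding minus_gseries_def
  by (subst gcoeff_Abs) (auto intro: wo_subset[OF wo_Un[OF wo_supp[of f] wo_supp[of g]]])

lemma gcoeff_uminus [simp]: "gcoeff (- f) q = - gcoeff f q"
  unfolding uminus_gseries_def by (subst gcoeff_Abs) (auto intro: wo_supp)

lemma gcoeff_scaleR [simp]: "gcoeff (r *\<^sub>R f) q = r * gcoeff f q"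
  unfolding scaleR_gseries_def
  by (subst gcoeff_Abs) (auto intro: wo_subset[OF wo_supp[of f]])

lemma gcoeff_mult:
  "gcoeff (f * g) q = (\<Sum>a | gcoeff f a \<noteq> 0 \<and> gcoeff g (q - a) \<noteq> 0. gcoeff f a * gcoeff g (q - a))"
  unfolding times_gseries_def
proof (subst gcoeff_Abs)
  let ?c = "\<lambda>q. \<Sum>a | gcoeff f a \<noteq> 0 \<and> gcoeff g (q - a) \<noteq> 0. gcoeff f a * gcoeff g (q - a)"
  have "{q. ?c q \<noteq> 0} \<subseteq> {a + b | a b. a \<in> supp f \<and> b \<in> supp g}"
  proof
    fix q assume "q \<in> {q. ?c q \<noteq> 0}"
    then have "?c q \<noteq> 0" by blast
    then obtain a where "gcoeff f a \<noteq> 0 \<and> gcoeff g (q - a) \<noteq> 0"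
      by (rule sum.not_neutral_contains_not_neutral) blast
    then show "q \<in> {a + b | a b. a \<in> supp f \<and> b \<in> supp g}"
      using supp_split_mem by blast
  qed
  then show "wo {q. ?c q \<noteq> 0}"
    by (rule wo_subset[OF wo_plus[OF wo_supp wo_supp]])
qed simp

lemma gcoeff_mult_superset:
  assumes "finite S" "{a. gcoeff f a \<noteq> 0 \<and> gcoeff g (q - a) \<noteq> 0} \<subseteq> S"
  shows "gcoeff (f * g) q = (\<Sum>a\<in>S. gcoeff f a * gcoeff g (q - a))"
  unfolding gcoeff_mult using assms by (intro sum.mono_neutral_left) auto

lemma supp_mult: "supp (f * g) \<subseteq> {a + b | a b. a \<in> supp f \<and> b \<in> supp g}"
proof
  fix q assume "q \<in> supp (f * g)"
  then have "gcoeff (f * g) q \<noteq> 0" by blast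
  then obtain a where "gcoeff f a \<noteq> 0 \<and> gcoeff g (q - a) \<noteq> 0"
    unfolding gcoeff_mult by (rule sum.not_neutral_contains_not_neutral) blast
  then show "q \<in> {a + b | a b. a \<in> supp f \<and> b \<in> supp g}"
    using supp_split_mem by blast
qed

lemma gseries_mult_commute: "f * g = g * (f :: gseries)"
proof (rule gseries_eqI)
  fix q
  show "gcoeff (f * g) q = gcoeff (g * f) q"
    unfolding gcoeff_mult
    by (rule sum.reindex_bij_witness[of _ "\<lambda>a. q - a" "\<lambda>a. q - a"]) (auto simp: mult.commute)
qed

lemma gseries_mult_assoc: "(f * g) * h = f * (g * (h :: gseries))"
proof (rule gseries_eqI)
  fix q
  define P where "P = {u. u \<in> {a + b | a b. a \<in> supp f \<and> b \<in> supp g} \<and> q - u \<in> supp h}"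
  define A where "A u = {a. gcoeff f a \<noteq> 0 \<and> gcoeff g (u - a) \<noteq> 0}" for u
  define Q where "Q = {a. a \<in> supp f \<and> q - a \<in> {a + b | a b. a \<in> supp g \<and> b \<in> supp h}}"
  define B where "B a = {b. gcoeff g b \<noteq> 0 \<and> gcoeff h ((q - a) - b) \<noteq> 0}" for a
  have fP: "finite P"
    unfolding P_def using wo_finite_split[OF wo_plus[OF wo_supp wo_supp] wo_supp] by simp
  have fQ: "finite Q"
    unfolding Q_def using wo_finite_split[OF wo_supp wo_plus[OF wo_supp wo_supp]] by simp
  have fA: "finite (A u)" and fB: "finite (B u)" for u
    unfolding A_def B_def by (rule finite_supp_split)+
  have "gcoeff ((f * g) * h) q = (\<Sum>u\<in>P. gcoeff (f * g) u * gcoeff h (q - u))"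
    by (rule gcoeff_mult_superset[OF fP]) (use supp_mult[of f g] in \<open>auto simp: P_def\<close>)
  also have "\<dots> = (\<Sum>u\<in>P. \<Sum>a\<in>A u. gcoeff f a * gcoeff g (u - a) * gcoeff h (q - u))"
    by (simp add: gcoeff_mult A_def sum_distrib_right)
  also have "\<dots> = (\<Sum>(u,a)\<in>Sigma P A. gcoeff f a * gcoeff g (u - a) * gcoeff h (q - u))"
    using fP fA by (simp add: sum.Sigma)
  also have "\<dots> = (\<Sum>(a,b)\<in>Sigma Q B. gcoeff f a * (gcoeff g b * gcoeff h ((q - a) - b)))"
  proof (rule sum.reindex_bij_witness[of _ "\<lambda>(a,b). (a + b, a)" "\<lambda>(u,a). (a, u - a)"])
    fix x assume "x \<in> Sigma P A"
    then obtain u a where x: "x = (u, a)" "gcoeff h (q - u) \<noteq> 0" "gcoeff f a \<noteq> 0" "gcoeff g (u - a) \<noteq> 0"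
      by (auto simp: P_def A_def)
    have "\<exists>b c. q - a = b + c \<and> gcoeff g b \<noteq> 0 \<and> gcoeff h c \<noteq> 0"
      using x by (intro exI[of _ "u - a"] exI[of _ "q - u"]) simp
    then show "(case x of (u, a) \<Rightarrow> (a, u - a)) \<in> Sigma Q B"
      using x by (simp add: Q_def B_def)
  next
    fix y assume "y \<in> Sigma Q B"
    then obtain a b where y: "y = (a, b)" "gcoeff f a \<noteq> 0" "gcoeff g b \<noteq> 0" "gcoeff h (q - a - b) \<noteq> 0"
      by (auto simp: Q_def B_def)
    then show "(case y of (a, b) \<Rightarrow> (a + b, a)) \<in> Sigma P A"
      by (auto simp: P_def A_def diff_diff_eq)
  qed auto
  also have "\<dots> = (\<Sum>a\<in>Q. \<Sum>b\<in>B a. gcoeff f a * (gcoeff g b * gcoeff h ((q - a) - b)))"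
    using fQ fB by (simp add: sum.Sigma)
  also have "\<dots> = (\<Sum>a\<in>Q. gcoeff f a * gcoeff (g * h) (q - a))"
    by (simp add: gcoeff_mult B_def sum_distrib_left)
  also have "\<dots> = gcoeff (f * (g * h)) q"
    by (rule gcoeff_mult_superset[OF fQ, symmetric]) (use supp_mult[of g h] in \<open>auto simp: Q_def\<close>)
  finally show "gcoeff ((f * g) * h) q = gcoeff (f * (g * h)) q" .
qed

instance gseries :: comm_ring_1
proof
  fix f g h :: gseries
  show "f * g * h = f * (g * h)" by (rule gseries_mult_assoc)
  show "f * g = g * f" by (rule gseries_mult_commute)
  show "1 * f = f"
  proof (rule gseries_eqI)
    fix q
    have "gcoeff (1 * f) q = (\<Sum>a\<in>{0}. gcoeff 1 a * gcoeff f (q - a))"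
      by (rule gcoeff_mult_superset) (auto simp: gcoeff_one split: if_splits)
    then show "gcoeff (1 * f) q = gcoeff f q" by (simp add: gcoeff_one)
  qed
  show "(f + g) * h = f * h + g * h"
  proof (rule gseries_eqI)
    fix q
    let ?S = "{a. gcoeff f a \<noteq> 0 \<and> gcoeff h (q - a) \<noteq> 0} \<union> {a. gcoeff g a \<noteq> 0 \<and> gcoeff h (q - a) \<noteq> 0}"
    have fin: "finite ?S" using finite_supp_split by blast
    have "gcoeff ((f + g) * h) q = (\<Sum>a\<in>?S. gcoeff (f + g) a * gcoeff h (q - a))"
      by (rule gcoeff_mult_superset[OF fin]) auto
    moreover have "gcoeff (f * h) q = (\<Sum>a\<in>?S. gcoeff f a * gcoeff h (q - a))"
      by (rule gcoeff_mult_superset[OF fin]) auto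
    moreover have "gcoeff (g * h) q = (\<Sum>a\<in>?S. gcoeff g a * gcoeff h (q - a))"
      by (rule gcoeff_mult_superset[OF fin]) auto
    ultimately show "gcoeff ((f + g) * h) q = gcoeff (f * h + g * h) q"
      by (simp add: sum.distrib distrib_right)
  qed
  show "(0 :: gseries) \<noteq> 1"
    by (metis gcoeff_one gcoeff_zero zero_neq_one)
qed (rule gseries_eqI, simp add: algebra_simps)+

lemma gseries_scaleR_mult: "(r *\<^sub>R f) * g = r *\<^sub>R (f * (g :: gseries))"
proof (rule gseries_eqI)
  fix q
  have "gcoeff (r *\<^sub>R f * g) q
      = (\<Sum>a | gcoeff f a \<noteq> 0 \<and> gcoeff g (q - a) \<noteq> 0. gcoeff (r *\<^sub>R f) a * gcoeff g (q - a))"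
    by (rule gcoeff_mult_superset[OF finite_supp_split]) auto
  then show "gcoeff (r *\<^sub>R f * g) q = gcoeff (r *\<^sub>R (f * g)) q"
    by (simp add: gcoeff_mult sum_distrib_left mult.assoc)
qed

instance gseries :: real_algebra_1
proof
  fix f g :: gseries and r s :: real
  show "(r *\<^sub>R f) * g = r *\<^sub>R (f * g)" by (rule gseries_scaleR_mult)
  then show "f * (r *\<^sub>R g) = r *\<^sub>R (f * g)"
    by (metis gseries_scaleR_mult mult.commute)
qed (rule gseries_eqI, simp add: algebra_simps)+

lemma gcoeff_sum: "gcoeff (\<Sum>i\<in>I. f i) q = (\<Sum>i\<in>I. gcoeff (f i) q)"
  by (induction I rule: infinite_finite_induct) auto

lemma gcoeff_mult_cong:
  assumes "\<And>a. a < 0 \<Longrightarrow> gcoeff f a = 0"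
    and "\<And>a. a \<le> q \<Longrightarrow> gcoeff g a = gcoeff g' a"
  shows "gcoeff (f * g) q = gcoeff (f * g') q"
proof -
  have eq: "gcoeff g (q - a) = gcoeff g' (q - a)" if "gcoeff f a \<noteq> 0" for a
    using assms that by (metis diff_le_eq le_add_same_cancel1 not_less)
  show ?thesis
    unfolding gcoeff_mult by (rule sum.cong) (use eq in \<open>auto\<close>)
qed

lemma gseries_geometric:
  assumes d: "d > 0" and e: "\<And>a. gcoeff e a \<noteq> 0 \<Longrightarrow> d \<le> a"
  shows "\<exists>g. (1 - e) * g = 1"
proof -
  have pw: "of_nat n * d \<le> a" if "gcoeff (e ^ n) a \<noteq> 0" for n a
    using that
  proof (induction n arbitrary: a)
    case 0
    then show ?case by (auto simp: gcoeff_one split: if_splits)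
  next
    case (Suc n)
    then have "a \<in> {b + c | b c. b \<in> supp e \<and> c \<in> supp (e ^ n)}"
      using supp_mult[of e "e ^ n"] by auto
    then obtain b c where "a = b + c" "gcoeff e b \<noteq> 0" "gcoeff (e ^ n) c \<noteq> 0" by auto
    then show ?case using Suc.IH[of c] e[of b] by (simp add: algebra_simps)
  qed
  define N where "N a = (LEAST n :: nat. a < of_nat n * d)" for a
  have N: "a < of_nat (N a) * d" for a
    unfolding N_def by (rule LeastI_ex) (use d ex_less_of_nat_mult in blast)
  define G where "G n = (\<Sum>i<n. e ^ i)" for n
  have stab: "gcoeff (G n) a = gcoeff (G (N a)) a" if "a < of_nat n * d" for n a
  proof -
    have le: "N a \<le> n" unfolding N_def using that by (rule Least_le)
    have "gcoeff (e ^ i) a = 0" if "i \<in> {..<n} - {..<N a}" for i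
    proof (rule ccontr)
      assume "gcoeff (e ^ i) a \<noteq> 0"
      from pw[OF this] have "of_nat i * d \<le> a" .
      moreover have "of_nat (N a) * d \<le> of_nat i * d" using that d by simp
      ultimately show False using N[of a] by simp
    qed
    then show ?thesis
      unfolding G_def gcoeff_sum using le
      by (intro sum.mono_neutral_right) auto
  qed
  let ?c = "\<lambda>a. gcoeff (G (N a)) a"
  have "wo {a. ?c a \<noteq> 0}"
    unfolding wo_iff
  proof (intro allI impI)
    fix B assume B: "B \<subseteq> {a. ?c a \<noteq> 0}" "B \<noteq> {}"
    then obtain b where b: "b \<in> B" by blast
    have "{a \<in> B. a \<le> b} \<subseteq> supp (G (N b))"
    proof
      fix a assume a: "a \<in> {a \<in> B. a \<le> b}"
      then have "a < of_nat (N b) * d" using N[of b] by simp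
      from stab[OF this] a B show "a \<in> supp (G (N b))" by auto
    qed
    then obtain m where m: "m \<in> {a \<in> B. a \<le> b}" "\<And>a. a \<in> {a \<in> B. a \<le> b} \<Longrightarrow> m \<le> a"
      using wo_minE[OF wo_supp, of "{a \<in> B. a \<le> b}"] b by blast
    then have "\<forall>a\<in>B. m \<le> a" by (metis (mono_tags, lifting) linear mem_Collect_eq order_trans)
    then show "\<exists>m\<in>B. \<forall>a\<in>B. m \<le> a" using m by blast
  qed
  then have g: "gcoeff (Abs_gseries ?c) = ?c" by (rule gcoeff_Abs)
  have "(1 - e) * Abs_gseries ?c = 1"
  proof (rule gseries_eqI)
    fix q
    define n where "n = N q"
    have "gcoeff ((1 - e) * Abs_gseries ?c) q = gcoeff ((1 - e) * G n) q"
    proof (rule gcoeff_mult_cong)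
      show "gcoeff (1 - e) a = 0" if "a < 0" for a
        using that e[of a] d by (force simp: gcoeff_one)
      show "gcoeff (Abs_gseries ?c) a = gcoeff (G n) a" if "a \<le> q" for a
        using stab[of a n] N[of q] that by (simp add: g n_def)
    qed
    also have "(1 - e) * G n = 1 - e ^ n"
      unfolding G_def using one_diff_power_eq[of e n] by simp
    also have "gcoeff (1 - e ^ n) q = gcoeff 1 q"
      using pw[of n q] N[of q] by (force simp: n_def)
    finally show "gcoeff ((1 - e) * Abs_gseries ?c) q = gcoeff 1 q" .
  qed
  then show ?thesis by blast
qed

definition gmonom :: "real \<Rightarrow> rat \<Rightarrow> gseries" where
  "gmonom c p = Abs_gseries (\<lambda>q. if q = p then c else 0)"

lemma gcoeff_gmonom: "gcoeff (gmonom c p) q = (if q = p then c else 0)"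
  unfolding gmonom_def
  by (subst gcoeff_Abs) (auto intro: wo_subset[OF wo_finite[of "{p}"]])

lemma gcoeff_gmonom_mult: "gcoeff (gmonom c p * f) q = c * gcoeff f (q - p)"
proof -
  have "gcoeff (gmonom c p * f) q = (\<Sum>a\<in>{p}. gcoeff (gmonom c p) a * gcoeff f (q - a))"
    by (rule gcoeff_mult_superset) (auto simp: gcoeff_gmonom split: if_splits)
  then show ?thesis by (simp add: gcoeff_gmonom)
qed

lemma gseries_ex_inverse:
  assumes "f \<noteq> (0 :: gseries)" shows "\<exists>g. f * g = 1"
proof -
  have "supp f \<noteq> {}" using assms gseries_eqI[of f 0] by auto
  then obtain p where p: "gcoeff f p \<noteq> 0" "\<And>b. gcoeff f b \<noteq> 0 \<Longrightarrow> p \<le> b"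
    using wo_minE[OF wo_supp[of f], of "supp f"] by auto
  define m where "m = gmonom (1 / gcoeff f p) (- p)"
  define e where "e = 1 - m * f"
  have e: "gcoeff e a = (if a = 0 then 0 else - gcoeff f (a + p) / gcoeff f p)" for a
    using p by (simp add: e_def m_def gcoeff_gmonom_mult gcoeff_one)
  have pos: "0 < a" if "gcoeff e a \<noteq> 0" for a
  proof -
    have "a \<noteq> 0" "gcoeff f (a + p) \<noteq> 0" using that e[of a] by (auto split: if_splits)
    then show ?thesis using p(2)[of "a + p"] by simp
  qed
  have "\<exists>d>0. \<forall>a. gcoeff e a \<noteq> 0 \<longrightarrow> d \<le> a"
  proof (cases "supp e = {}")
    case True
    then show ?thesis by (auto intro!: exI[of _ 1])
  next
    case False
    then obtain d where "gcoeff e d \<noteq> 0" "\<And>b. gcoeff e b \<noteq> 0 \<Longrightarrow> d \<le> b"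
      using wo_minE[OF wo_supp[of e], of "supp e"] by auto
    then show ?thesis using pos by blast
  qed
  then obtain g where "(1 - e) * g = 1" using gseries_geometric by blast
  then have "f * (m * g) = 1" by (simp add: e_def algebra_simps)
  then show ?thesis by blast
qed

instantiation gseries :: real_field
begin

definition "inverse f = (if f = 0 then 0 else (THE g :: gseries. f * g = 1))"
definition "f div (g :: gseries) = f * inverse g"

instance
proof
  fix f g :: gseries
  show "inverse f * f = 1" if "f \<noteq> 0"
  proof -
    obtain g where g: "f * g = 1" using gseries_ex_inverse[OF \<open>f \<noteq> 0\<close>] by blast
    have "(THE g. f * g = 1) = g"
    proof (rule the_equality)
      show "f * g = 1" by (rule g)
      fix h assume "f * h = 1"
      then show "h = g" using g by (metis mult.assoc mult.commute mult.right_neutral)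
    qed
    then show ?thesis using g that by (simp add: inverse_gseries_def mult.commute)
  qed
  then show "f * inverse f = 1" if "f \<noteq> 0" using that by (simp add: mult.commute)
  show "f div g = f * inverse g" by (simp add: divide_gseries_def)
  show "inverse (0 :: gseries) = 0" by (simp add: inverse_gseries_def)
qed

end

definition puiseux :: "gseries set" where
  "puiseux = {f. \<exists>(n::nat) (m::int). n \<ge> 1 \<and>
     (\<forall>q. gcoeff f q \<noteq> 0 \<longrightarrow> (\<exists>k\<ge>m. q = of_int k / of_nat n))}"

class real_diff_field = real_field +
  fixes der :: "'a \<Rightarrow> 'a"
  assumes der_add: "der (a + b) = der a + der b"
    and der_mult: "der (a * b) = der a * b + a * der b"
    and der_scaleR: "der (r *\<^sub>R a) = r *\<^sub>R der a"

instantiation gseries :: real_diff_field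
begin

text \<open>Termwise \<open>d/dx\<close>: the term \<open>a x\<^sup>-\<^sup>q\<close> becomes \<open>-q a x\<^sup>-\<^sup>(\<^sup>q\<^sup>+\<^sup>1\<^sup>)\<close>.\<close>

definition "der f = Abs_gseries (\<lambda>q. - of_rat (q - 1) * gcoeff f (q - 1))"

lemma gcoeff_der: "gcoeff (der f) q = - of_rat (q - 1) * gcoeff f (q - 1)"
  unfolding der_gseries_def
proof (subst gcoeff_Abs)
  have "{q. - of_rat (q - 1) * gcoeff f (q - 1) \<noteq> 0} \<subseteq> {a + b | a b. a \<in> supp f \<and> b \<in> {1}}"
  proof
    fix q assume "q \<in> {q. - of_rat (q - 1) * gcoeff f (q - 1) \<noteq> 0}"
    then have "q = (q - 1) + 1 \<and> q - 1 \<in> supp f \<and> (1::rat) \<in> {1}" by simp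
    then show "q \<in> {a + b | a b. a \<in> supp f \<and> b \<in> {1}}" by blast
  qed
  then show "wo {q. - of_rat (q - 1) * gcoeff f (q - 1) \<noteq> 0}"
    using wo_subset[OF wo_plus[OF wo_supp[of f] wo_finite[of "{1}"]]] by blast
qed simp

instance
proof
  fix f g :: gseries and r :: real
  show "der (f + g) = der f + der g"
    by (rule gseries_eqI) (simp add: gcoeff_der distrib_left)
  show "der (r *\<^sub>R f) = r *\<^sub>R der f"
    by (rule gseries_eqI) (simp add: gcoeff_der)
  show "der (f * g) = der f * g + f * der g"
  proof (rule gseries_eqI)
    fix q
    let ?S = "{a. gcoeff f a \<noteq> 0 \<and> gcoeff g (q - 1 - a) \<noteq> 0}"
    have fin: "finite ?S" by (rule finite_supp_split)
    have "gcoeff (der f * g) q = (\<Sum>a\<in>(+) 1 ` ?S. gcoeff (der f) a * gcoeff g (q - a))"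
    proof (rule gcoeff_mult_superset)
      show "{a. gcoeff (der f) a \<noteq> 0 \<and> gcoeff g (q - a) \<noteq> 0} \<subseteq> (+) 1 ` ?S"
      proof
        fix a assume a: "a \<in> {a. gcoeff (der f) a \<noteq> 0 \<and> gcoeff g (q - a) \<noteq> 0}"
        have "a = 1 + (a - 1)" by simp
        moreover have "a - 1 \<in> ?S" using a by (auto simp: gcoeff_der)
        ultimately show "a \<in> (+) 1 ` ?S" by blast
      qed
    qed (use fin in simp)
    also have "\<dots> = (\<Sum>a\<in>?S. - of_rat a * gcoeff f a * gcoeff g (q - 1 - a))"
      by (subst sum.reindex) (auto simp: gcoeff_der diff_diff_eq)
    finally have 1: "gcoeff (der f * g) q = (\<Sum>a\<in>?S. - of_rat a * gcoeff f a * gcoeff g (q - 1 - a))" .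
    have sw: "q - a - 1 = q - 1 - a" for a by simp
    have "gcoeff (f * der g) q = (\<Sum>a\<in>?S. gcoeff f a * gcoeff (der g) (q - a))"
      by (rule gcoeff_mult_superset[OF fin]) (auto simp: gcoeff_der sw)
    then have 2: "gcoeff (f * der g) q
        = (\<Sum>a\<in>?S. gcoeff f a * (- of_rat (q - 1 - a) * gcoeff g (q - 1 - a)))"
      by (simp only: gcoeff_der sw)
    have 3: "gcoeff (der (f * g)) q = (\<Sum>a\<in>?S. - of_rat (q - 1) * (gcoeff f a * gcoeff g (q - 1 - a)))"
      by (simp add: gcoeff_der gcoeff_mult sum_distrib_left)
    show "gcoeff (der (f * g)) q = gcoeff (der f * g + f * der g) q"
    proof -
      have r: "- of_rat (q - 1) * (u * v) = - of_rat a * u * v + u * (- of_rat (q - 1 - a) * v)"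
        for a and u v :: real
      proof -
        have "real_of_rat (q - 1) = of_rat a + of_rat (q - 1 - a)"
          by (simp add: of_rat_add[symmetric])
        then show ?thesis by (simp only:) (simp add: algebra_simps)
      qed
      show ?thesis
        unfolding gcoeff_add 1 2 3 sum.distrib[symmetric] by (intro sum.cong refl r)
    qed
  qed
qed

end


section \<open>Skew polynomials\<close>

text \<open>A skew polynomial \<open>\<Sum>i. p\<^sub>i y\<^sup>i\<close> is stored as the ordinary polynomial with the left
  coefficients \<open>p\<^sub>i\<close>; \<open>y_mult\<close> is left multiplication by \<open>y\<close>, that is
  \<open>y p\<^sub>i y\<^sup>i = p\<^sub>i y\<^sup>i\<^sup>+\<^sup>1 + \<delta>(p\<^sub>i) y\<^sup>i\<close>.\<close>

definition y_mult :: "'a::real_diff_field poly \<Rightarrow> 'a poly" where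
  "y_mult q = pCons 0 q + map_poly der q"

definition skew_mult :: "'a::real_diff_field poly \<Rightarrow> 'a poly \<Rightarrow> 'a poly" where
  "skew_mult p q = (\<Sum>i\<le>degree p. smult (coeff p i) ((y_mult ^^ i) q))"

typedef (overloaded) 'a skew_poly = "UNIV :: 'a::real_diff_field poly set"
  morphisms left_poly Abs_skew_poly ..

instantiation skew_poly :: (real_diff_field) "{zero, one, plus, minus, uminus, times, scaleR}"
begin

definition "0 = Abs_skew_poly 0"
definition "1 = Abs_skew_poly 1"
definition "p + q = Abs_skew_poly (left_poly p + left_poly q)"
definition "p - q = Abs_skew_poly (left_poly p - left_poly q)"
definition "- p = Abs_skew_poly (- left_poly p)"
definition "r *\<^sub>R p = Abs_skew_poly (smult (of_real r) (left_poly p))"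
definition "p * q = Abs_skew_poly (skew_mult (left_poly p) (left_poly q))"

instance ..

end

lemma der_0 [simp]: "der 0 = (0 :: 'a::real_diff_field)"
  using der_add[of 0 "0 :: 'a"] by simp

lemma der_1 [simp]: "der 1 = (0 :: 'a::real_diff_field)"
  using der_mult[of 1 "1 :: 'a"] by simp

lemma der_of_real [simp]: "der (of_real r) = (0 :: 'a::real_diff_field)"
  by (simp add: of_real_def der_scaleR)

lemma coeff_y_mult:
  "coeff (y_mult q) i = (case i of 0 \<Rightarrow> 0 | Suc j \<Rightarrow> coeff q j) + der (coeff q i)"
  by (simp add: y_mult_def coeff_map_poly coeff_pCons)

lemma y_mult_add: "y_mult (p + q) = y_mult p + y_mult q"
  by (rule poly_eqI) (simp add: coeff_y_mult der_add split: nat.split)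

lemma y_mult_0 [simp]: "y_mult 0 = 0"
  by (rule poly_eqI) (simp add: coeff_y_mult split: nat.split)

lemma y_mult_smult: "y_mult (smult b q) = smult b (y_mult q) + smult (der b) q"
  by (rule poly_eqI) (simp add: coeff_y_mult der_mult algebra_simps split: nat.split)

lemma y_mult_sum: "y_mult (\<Sum>i\<in>I. f i) = (\<Sum>i\<in>I. y_mult (f i))"
  by (induction I rule: infinite_finite_induct) (auto simp: y_mult_add)

lemma y_mult_pow_add: "(y_mult ^^ i) (p + q) = (y_mult ^^ i) p + (y_mult ^^ i) q"
  by (induction i) (auto simp: y_mult_add)

lemma y_mult_pow_0 [simp]: "(y_mult ^^ i) 0 = 0"
  by (induction i) auto

lemma y_mult_pow_real:
  "(y_mult ^^ i) (smult (of_real r) q) = smult (of_real r) ((y_mult ^^ i) q)"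
  by (induction i) (auto simp: y_mult_smult)

lemma y_mult_pow_1: "(y_mult ^^ i) 1 = monom 1 i"
proof (induction i)
  case (Suc i)
  have "y_mult (monom 1 i) = (monom 1 (Suc i) :: 'a poly)"
    by (rule poly_eqI) (auto simp: coeff_y_mult split: nat.split)
  then show ?case using Suc by simp
qed (simp add: monom_0 one_pCons)

lemma skew_mult_le:
  assumes "degree p \<le> n"
  shows "skew_mult p q = (\<Sum>i\<le>n. smult (coeff p i) ((y_mult ^^ i) q))"
  unfolding skew_mult_def using assms
  by (intro sum.mono_neutral_left) (auto simp: coeff_eq_0)

lemma skew_mult_add_left: "skew_mult (p + p') q = skew_mult p q + skew_mult p' q"
proof -
  define n where "n = max (degree p) (degree p')"
  have "degree (p + p') \<le> n" "degree p \<le> n" "degree p' \<le> n"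
    by (auto simp: n_def degree_add_le)
  then show ?thesis by (simp add: skew_mult_le smult_add_left sum.distrib)
qed

lemma skew_mult_add_right: "skew_mult p (q + q') = skew_mult p q + skew_mult p q'"
  by (simp add: skew_mult_def y_mult_pow_add smult_add_right sum.distrib)

lemma skew_mult_0_left [simp]: "skew_mult 0 q = 0"
  by (simp add: skew_mult_def)

lemma skew_mult_0_right [simp]: "skew_mult p 0 = 0"
  by (simp add: skew_mult_def)

lemma smult_sum_right: "smult b (\<Sum>i\<in>I. f i) = (\<Sum>i\<in>I. smult b (f i))"
  by (induction I rule: infinite_finite_induct) (auto simp: smult_add_right)

lemma skew_mult_smult_left: "skew_mult (smult b p) q = smult b (skew_mult p q)"
proof -
  have "skew_mult (smult b p) q = (\<Sum>i\<le>degree p. smult (coeff (smult b p) i) ((y_mult ^^ i) q))"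
    by (rule skew_mult_le) simp
  then show ?thesis by (simp add: skew_mult_def smult_sum_right)
qed

lemma skew_mult_real_right: "skew_mult p (smult (of_real r) q) = smult (of_real r) (skew_mult p q)"
  by (simp add: skew_mult_def y_mult_pow_real smult_sum_right mult.commute)

lemma skew_mult_sum_left: "skew_mult (\<Sum>i\<in>I. f i) q = (\<Sum>i\<in>I. skew_mult (f i) q)"
  by (induction I rule: infinite_finite_induct) (auto simp: skew_mult_add_left)

lemma skew_mult_y_mult: "skew_mult (y_mult p) r = y_mult (skew_mult p r)"
proof -
  let ?n = "degree p"
  have 1: "skew_mult (pCons 0 p) r = (\<Sum>i\<le>?n. smult (coeff p i) ((y_mult ^^ Suc i) r))"
  proof -
    have "skew_mult (pCons 0 p) r
        = (\<Sum>i\<le>Suc ?n. smult (coeff (pCons 0 p) i) ((y_mult ^^ i) r))"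
      by (rule skew_mult_le) (rule degree_pCons_le)
    also have "\<dots> = (\<Sum>i\<le>?n. smult (coeff p i) ((y_mult ^^ Suc i) r))"
      by (subst sum.atMost_Suc_shift) simp
    finally show ?thesis .
  qed
  have 2: "skew_mult (map_poly der p) r = (\<Sum>i\<le>?n. smult (der (coeff p i)) ((y_mult ^^ i) r))"
    proof -
    have "degree (map_poly der p) \<le> ?n"
      by (rule degree_le) (simp add: coeff_map_poly coeff_eq_0)
    then show ?thesis by (simp add: skew_mult_le coeff_map_poly)
  qed
  have "y_mult (skew_mult p r) = (\<Sum>i\<le>?n. smult (coeff p i) ((y_mult ^^ Suc i) r)
      + smult (der (coeff p i)) ((y_mult ^^ i) r))"
    by (simp add: skew_mult_def y_mult_sum y_mult_smult)
  then show ?thesis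
    unfolding y_mult_def[of p] skew_mult_add_left 1 2 by (simp add: sum.distrib)
qed

lemma skew_mult_y_mult_pow: "skew_mult ((y_mult ^^ i) p) r = (y_mult ^^ i) (skew_mult p r)"
  by (induction i) (auto simp: skew_mult_y_mult)

lemma skew_mult_assoc: "skew_mult (skew_mult p q) r = skew_mult p (skew_mult q r)"
  by (simp add: skew_mult_def[of p] skew_mult_sum_left skew_mult_smult_left skew_mult_y_mult_pow)

lemma skew_mult_1_left: "skew_mult 1 q = q"
  by (simp add: skew_mult_def)

lemma skew_mult_1_right: "skew_mult p 1 = p"
  by (simp add: skew_mult_def y_mult_pow_1 smult_monom poly_as_sum_of_monoms)

lemma y_mult_lead:
  assumes "q \<noteq> 0"
  shows "degree (y_mult q) = Suc (degree q)" "coeff (y_mult q) (Suc (degree q)) = lead_coeff q"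
proof -
  show c: "coeff (y_mult q) (Suc (degree q)) = lead_coeff q"
    by (simp add: coeff_y_mult coeff_eq_0)
  have "degree (y_mult q) \<le> Suc (degree q)"
    by (rule degree_le) (auto simp: coeff_y_mult coeff_eq_0 split: nat.split)
  moreover have "Suc (degree q) \<le> degree (y_mult q)"
    using c assms by (intro le_degree) simp
  ultimately show "degree (y_mult q) = Suc (degree q)" by simp
qed

lemma y_mult_pow_lead:
  assumes "q \<noteq> 0"
  shows "(y_mult ^^ i) q \<noteq> 0 \<and> degree ((y_mult ^^ i) q) = i + degree q
    \<and> coeff ((y_mult ^^ i) q) (i + degree q) = lead_coeff q"
proof (induction i)
  case 0
  then show ?case using assms by simp
next
  case (Suc i)
  let ?r = "(y_mult ^^ i) q"
  have r: "?r \<noteq> 0" "degree ?r = i + degree q" "lead_coeff ?r = lead_coeff q" using Suc by auto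
  have "coeff (y_mult ?r) (Suc (i + degree q)) = lead_coeff q" "degree (y_mult ?r) = Suc (i + degree q)"
    using y_mult_lead[OF r(1)] r by simp_all
  moreover from this have "y_mult ?r \<noteq> 0" by auto
  ultimately show ?case by simp
qed

lemma skew_mult_lead:
  assumes "p \<noteq> 0" "q \<noteq> 0"
  shows "degree (skew_mult p q) = degree p + degree q"
    "coeff (skew_mult p q) (degree p + degree q) = lead_coeff p * lead_coeff q"
proof -
  have dg: "degree ((y_mult ^^ i) q) = i + degree q" for i
    using y_mult_pow_lead[OF assms(2)] by blast
  have "coeff (skew_mult p q) (degree p + degree q)
      = (\<Sum>i\<le>degree p. coeff p i * coeff ((y_mult ^^ i) q) (degree p + degree q))"
    by (simp add: skew_mult_def coeff_sum)
  also have "\<dots> = (\<Sum>i\<in>{degree p}. coeff p i * coeff ((y_mult ^^ i) q) (degree p + degree q))"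
    by (rule sum.mono_neutral_right) (auto simp: coeff_eq_0 dg)
  also have "\<dots> = lead_coeff p * lead_coeff q"
    using y_mult_pow_lead[OF assms(2)] by simp
  finally show c: "coeff (skew_mult p q) (degree p + degree q) = lead_coeff p * lead_coeff q" .
  have "degree (skew_mult p q) \<le> degree p + degree q"
    unfolding skew_mult_def
    by (rule degree_sum_le) (auto intro: order_trans[OF degree_smult_le] simp: dg)
  moreover have "degree p + degree q \<le> degree (skew_mult p q)"
    using c assms by (intro le_degree) simp
  ultimately show "degree (skew_mult p q) = degree p + degree q" by simp
qed

lemma skew_mult_nonzero: "p \<noteq> 0 \<Longrightarrow> q \<noteq> 0 \<Longrightarrow> skew_mult p q \<noteq> 0"
  using skew_mult_lead(2)[of p q] by auto

lemma skew_mult_uminus_right: "skew_mult p (- q) = - skew_mult p q"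
  using skew_mult_add_right[of p q "- q"] by (simp add: add_eq_0_iff)

lemma skew_division:
  assumes "b \<noteq> 0"
  shows "\<exists>q r. a = skew_mult b q + r \<and> (r = 0 \<or> degree r < degree b)"
proof (induction "degree a" arbitrary: a rule: less_induct)
  case less
  show ?case
  proof (cases "a = 0 \<or> degree a < degree b")
    case True
    then show ?thesis by (intro exI[of _ 0] exI[of _ a]) auto
  next
    case False
    define c where "c = lead_coeff a / lead_coeff b"
    define q where "q = monom c (degree a - degree b)"
    have "c \<noteq> 0" using False assms by (simp add: c_def)
    then have q: "q \<noteq> 0" "degree q = degree a - degree b" "lead_coeff q = c"
      by (simp_all add: q_def degree_monom_eq)
    define a' where "a' = a - skew_mult b q"
    have "degree (skew_mult b q) = degree a" "coeff (skew_mult b q) (degree a) = lead_coeff a"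
      using skew_mult_lead[OF assms q(1)] q False assms by (auto simp: c_def)
    then have "degree a' \<le> degree a" "coeff a' (degree a) = 0"
      unfolding a'_def by (auto intro: degree_diff_le)
    then have "a' = 0 \<or> degree a' < degree a" by (rule eq_zero_or_degree_less)
    then obtain q' r where r: "a' = skew_mult b q' + r" "r = 0 \<or> degree r < degree b"
    proof
      assume "a' = 0"
      then show ?thesis using that[of 0 0] by simp
    next
      assume "degree a' < degree a"
      then show ?thesis using less that by blast
    qed
    have "a = skew_mult b (q + q') + r"
      using r(1) by (simp add: a'_def skew_mult_add_right algebra_simps)
    then show ?thesis using r(2) by blast
  qed
qed

lemma skew_ore:
  assumes "b \<noteq> 0"
  shows "\<exists>c d. c \<noteq> 0 \<and> skew_mult a c = skew_mult b d"
  using assms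
proof (induction "degree b" arbitrary: a b rule: less_induct)
  case less
  obtain q r where r: "a = skew_mult b q + r" "r = 0 \<or> degree r < degree b"
    using skew_division[OF less.prems] by blast
  show ?case
  proof (cases "r = 0")
    case True
    then show ?thesis using r by (intro exI[of _ 1] exI[of _ q]) (simp add: skew_mult_1_right)
  next
    case False
    then obtain c d where cd: "c \<noteq> 0" "skew_mult b c = skew_mult r d" using less r by blast
    have "d \<noteq> 0"
    proof
      assume "d = 0"
      then show False using cd skew_mult_nonzero[OF less.prems cd(1)] by simp
    qed
    moreover have "skew_mult a d = skew_mult b (skew_mult q d + c)"
      by (simp add: r(1) skew_mult_add_left skew_mult_add_right skew_mult_assoc cd(2))
    ultimately show ?thesis by blast
  qed
qed

class ore_domain = ring_1_no_zero_divisors +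
  assumes ore: "a \<noteq> 0 \<Longrightarrow> b \<noteq> 0 \<Longrightarrow> \<exists>c d. c \<noteq> 0 \<and> d \<noteq> 0 \<and> a * c = b * d"

lemmas skew_poly_defs = zero_skew_poly_def one_skew_poly_def plus_skew_poly_def minus_skew_poly_def
  uminus_skew_poly_def scaleR_skew_poly_def times_skew_poly_def

lemma left_poly_Abs [simp]: "left_poly (Abs_skew_poly p) = p"
  by (simp add: Abs_skew_poly_inverse)

lemma skew_poly_eq_iff: "p = q \<longleftrightarrow> left_poly p = left_poly q"
  by (simp add: left_poly_inject)

instance skew_poly :: (real_diff_field) "{real_algebra_1, ore_domain}"
proof
  fix p q r :: "'a skew_poly" and a b :: real
  show "p + q + r = p + (q + r)" "p + q = q + p" "0 + p = p" "- p + p = 0" "p - q = p + - q"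
    by (simp_all add: skew_poly_eq_iff skew_poly_defs)
  show "a *\<^sub>R (p + q) = a *\<^sub>R p + a *\<^sub>R q" "(a + b) *\<^sub>R p = a *\<^sub>R p + b *\<^sub>R p"
    "a *\<^sub>R b *\<^sub>R p = (a * b) *\<^sub>R p" "1 *\<^sub>R p = p"
    by (simp_all add: skew_poly_eq_iff skew_poly_defs smult_add_right smult_add_left)
  show "p * q * r = p * (q * r)" "(p + q) * r = p * r + q * r" "p * (q + r) = p * q + p * r"
    "1 * p = p" "p * 1 = p" "(0 :: 'a skew_poly) \<noteq> 1"
    by (simp_all add: skew_poly_eq_iff skew_poly_defs skew_mult_assoc skew_mult_add_left
        skew_mult_add_right skew_mult_1_left skew_mult_1_right)
  show "a *\<^sub>R p * q = a *\<^sub>R (p * q)" "p * a *\<^sub>R q = a *\<^sub>R (p * q)"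
    by (simp_all add: skew_poly_eq_iff skew_poly_defs skew_mult_smult_left skew_mult_real_right)
  show "0 * p = 0" "p * 0 = 0"
    by (simp_all add: skew_poly_eq_iff skew_poly_defs)
  show nz: "p * q \<noteq> 0" if "p \<noteq> 0" "q \<noteq> 0" for p q :: "'a skew_poly"
    using that by (simp add: skew_poly_eq_iff skew_poly_defs skew_mult_nonzero)
  show "\<exists>c d. c \<noteq> 0 \<and> d \<noteq> 0 \<and> p * c = q * d" if pq: "p \<noteq> 0" "q \<noteq> 0"
  proof -
    have "left_poly q \<noteq> 0" using pq by (simp add: skew_poly_eq_iff skew_poly_defs)
    then obtain c d where cd: "c \<noteq> 0" "skew_mult (left_poly p) c = skew_mult (left_poly q) d"
      using skew_ore by blast
    let ?c = "Abs_skew_poly c" and ?d = "Abs_skew_poly d"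
    have c: "?c \<noteq> 0" "p * ?c = q * ?d"
      using cd by (simp_all add: skew_poly_eq_iff skew_poly_defs)
    have "?d \<noteq> 0"
    proof
      assume "?d = 0"
      then have "q * ?d = 0" by (simp add: skew_poly_eq_iff skew_poly_defs)
      then show False using c nz[OF pq(1) c(1)] by simp
    qed
    then show ?thesis using c by blast
  qed
qed

lemma skew_commutation:
  fixes p :: "'a::real_diff_field"
  defines "y \<equiv> Abs_skew_poly [:0, 1:]" and "C \<equiv> (\<lambda>p. Abs_skew_poly [:p:])"
  shows "y * C p = C p * y + C (der p)"
proof -
  have "y_mult [:p:] = [:der p, p:]"
    by (rule poly_eqI) (auto simp: coeff_y_mult coeff_pCons split: nat.split)
  then show ?thesis
    by (simp add: y_def C_def skew_poly_eq_iff skew_poly_defs skew_mult_def)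
qed


section \<open>The quotient division ring of an Ore domain\<close>

text \<open>The pair \<open>(a, s)\<close> stands for \<open>a s\<^sup>-\<^sup>1\<close>.\<close>

definition ore_rel :: "'a::ore_domain \<times> 'a \<Rightarrow> 'a \<times> 'a \<Rightarrow> bool" where
  "ore_rel = (\<lambda>(a, s) (b, t). s \<noteq> 0 \<and> t \<noteq> 0 \<and>
     (\<exists>c d. c \<noteq> 0 \<and> d \<noteq> 0 \<and> a * c = b * d \<and> s * c = t * d))"

quotient_type (overloaded) 'a ore_quot = "'a::ore_domain \<times> 'a" / partial: ore_rel
proof (rule part_equivpI)
  show "\<exists>x :: 'a \<times> 'a. ore_rel x x"
    by (rule exI[of _ "(0, 1)"]) (auto simp: ore_rel_def intro!: exI[of _ 1])
  show "symp (ore_rel :: 'a \<times> 'a \<Rightarrow> _)"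
    by (rule sympI) (fastforce simp: ore_rel_def)
  show "transp (ore_rel :: 'a \<times> 'a \<Rightarrow> _)"
  proof (rule transpI)
    fix x y z :: "'a \<times> 'a"
    assume xy: "ore_rel x y" and yz: "ore_rel y z"
    obtain a s b t e u where x: "x = (a, s)" "y = (b, t)" "z = (e, u)" by (metis surj_pair)
    obtain c d where 1: "c \<noteq> 0" "d \<noteq> 0" "a * c = b * d" "s * c = t * d"
      using xy x by (auto simp: ore_rel_def)
    obtain c' d' where 2: "c' \<noteq> 0" "d' \<noteq> 0" "b * c' = e * d'" "t * c' = u * d'"
      using yz x by (auto simp: ore_rel_def)
    obtain k l where kl: "k \<noteq> 0" "l \<noteq> 0" "d * k = c' * l" using ore 1 2 by blast
    have "a * (c * k) = e * (d' * l)" "s * (c * k) = u * (d' * l)"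
      using 1 2 kl(3) by (metis mult.assoc)+
    moreover have "c * k \<noteq> 0" "d' * l \<noteq> 0" using 1 2 kl by auto
    moreover have "s \<noteq> 0" "u \<noteq> 0" using xy yz x by (auto simp: ore_rel_def)
    ultimately show "ore_rel x z" unfolding x ore_rel_def by blast
  qed
qed

definition ore_frac :: "'a::ore_domain \<Rightarrow> 'a \<Rightarrow> 'a ore_quot" where
  "ore_frac a s = abs_ore_quot (a, s)"

abbreviation to_quot :: "'a::ore_domain \<Rightarrow> 'a ore_quot" where
  "to_quot a \<equiv> ore_frac a 1"

text \<open>Multiplication is \<open>a s\<^sup>-\<^sup>1 b t\<^sup>-\<^sup>1 = (a c) (t d)\<^sup>-\<^sup>1\<close> where \<open>s c = b d\<close>, that is \<open>s\<^sup>-\<^sup>1 b = c d\<^sup>-\<^sup>1\<close>;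
  sums are formed over a common denominator.\<close>

instantiation ore_quot :: (ore_domain) "{zero, one, plus, minus, uminus, times, inverse}"
begin

definition "0 = to_quot 0"
definition "1 = to_quot 1"
definition "q + r = (THE z. \<exists>a b s. s \<noteq> 0 \<and> q = ore_frac a s \<and> r = ore_frac b s \<and> z = ore_frac (a + b) s)"
definition "q * r = (THE z. \<exists>a s b t c d. s \<noteq> 0 \<and> t \<noteq> 0 \<and> d \<noteq> 0 \<and>
  q = ore_frac a s \<and> r = ore_frac b t \<and> s * c = b * d \<and> z = ore_frac (a * c) (t * d))"
definition "- q = to_quot (- 1) * (q :: 'a ore_quot)"
definition "q - r = q + - (r :: 'a ore_quot)"
definition "inverse q = (if q = 0 then 0 else
  THE z. \<exists>a s. a \<noteq> 0 \<and> s \<noteq> 0 \<and> q = ore_frac a s \<and> z = ore_frac s a)"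
definition "q div r = q * inverse (r :: 'a ore_quot)"

instance ..

end

instantiation ore_quot :: ("{ore_domain, real_algebra_1}") scaleR
begin

definition "r *\<^sub>R q = to_quot (of_real r) * (q :: 'a ore_quot)"

instance ..

end

lemma ore_rel_refl: "s \<noteq> 0 \<Longrightarrow> ore_rel (a, s) (a, s)"
  by (auto simp: ore_rel_def intro!: exI[of _ 1])

lemma frac_eq_iff:
  assumes "s \<noteq> 0" "t \<noteq> 0"
  shows "ore_frac a s = ore_frac b t \<longleftrightarrow> (\<exists>c d. c \<noteq> 0 \<and> d \<noteq> 0 \<and> a * c = b * d \<and> s * c = t * d)"
proof -
  have "ore_frac a s = ore_frac b t \<longleftrightarrow> ore_rel (a, s) (b, t)"
    unfolding ore_frac_def
    using Quotient_rel[OF Quotient_ore_quot, of "(a, s)" "(b, t)"] ore_rel_refl assms by blast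
  then show ?thesis using assms by (simp add: ore_rel_def)
qed

lemma frac_scale:
  assumes "c \<noteq> 0" "s \<noteq> 0" shows "ore_frac (a * c) (s * c) = ore_frac a s"
proof -
  have "s * c \<noteq> 0" using assms by simp
  moreover have "a * c * 1 = a * c" "s * c * 1 = s * c" "(1 :: 'a) \<noteq> 0" by simp_all
  ultimately show ?thesis using assms frac_eq_iff by blast
qed

lemma frac_cases:
  obtains a s where "s \<noteq> 0" "q = ore_frac a s"
proof -
  obtain x where x: "ore_rel x x" "q = abs_ore_quot x"
    using Quotient_abs_rep[OF Quotient_ore_quot] Quotient_rep_reflp[OF Quotient_ore_quot] by metis
  obtain a s where "x = (a, s)" by (cases x)
  then have "s \<noteq> 0" "q = ore_frac a s" using x by (auto simp: ore_rel_def ore_frac_def)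
  then show thesis by (rule that)
qed

lemma frac_eqD:
  assumes eq: "ore_frac a s = ore_frac b t" and nz: "s \<noteq> 0" "t \<noteq> 0" and sc: "s * c = t * d"
  shows "a * c = b * d"
proof (cases "c = 0")
  case True
  then have "d = 0" using sc nz by simp
  then show ?thesis using True by simp
next
  case False
  obtain c' d' where cd: "c' \<noteq> 0" "d' \<noteq> 0" "a * c' = b * d'" "s * c' = t * d'"
    using eq frac_eq_iff[OF nz] by blast
  obtain x y where xy: "x \<noteq> 0" "y \<noteq> 0" "c' * x = c * y" using ore cd(1) False by blast
  have "t * (d' * x) = t * (d * y)" using cd(4) sc xy(3) by (metis mult.assoc)
  then have "d' * x = d * y" using nz by simp
  then have "(a * c) * y = (b * d) * y" using cd(3) xy(3) by (metis mult.assoc)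
  then show ?thesis using xy by simp
qed

lemma frac_inj: "s \<noteq> 0 \<Longrightarrow> ore_frac a s = ore_frac b s \<longleftrightarrow> a = b"
  using frac_eqD[of a s b s 1 1] by auto

lemma frac_common:
  obtains a b s where "s \<noteq> 0" "q = ore_frac a s" "r = ore_frac b s"
proof -
  obtain a s where q: "s \<noteq> 0" "q = ore_frac a s" by (rule frac_cases)
  obtain b t where r: "t \<noteq> 0" "r = ore_frac b t" by (rule frac_cases)
  obtain c d where cd: "c \<noteq> 0" "d \<noteq> 0" "s * c = t * d" using ore q r by blast
  show thesis
  proof (rule that)
    show "s * c \<noteq> 0" using q(1) cd(1) by simp
    show "q = ore_frac (a * c) (s * c)" using q(2) frac_scale[OF cd(1) q(1)] by simp
    show "r = ore_frac (b * d) (s * c)" unfolding cd(3) using r(2) frac_scale[OF cd(2) r(1)] by simp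
  qed
qed

lemma frac_common3:
  obtains a b c s where "s \<noteq> 0" "p = ore_frac a s" "q = ore_frac b s" "r = ore_frac c s"
proof -
  obtain a b s where q: "s \<noteq> 0" "p = ore_frac a s" "q = ore_frac b s" by (rule frac_common)
  obtain e t where r: "t \<noteq> 0" "r = ore_frac e t" by (rule frac_cases)
  obtain c d where cd: "c \<noteq> 0" "d \<noteq> 0" "s * c = t * d" using ore q r by blast
  show thesis
  proof (rule that)
    show "s * c \<noteq> 0" using q(1) cd(1) by simp
    show "p = ore_frac (a * c) (s * c)" "q = ore_frac (b * c) (s * c)"
      using q(2,3) frac_scale[OF cd(1) q(1)] by simp_all
    show "r = ore_frac (e * d) (s * c)" unfolding cd(3) using r(2) frac_scale[OF cd(2) r(1)] by simp
  qed
qed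

lemma frac_add:
  assumes "s \<noteq> 0" shows "ore_frac a s + ore_frac b s = ore_frac (a + b) s"
  unfolding plus_ore_quot_def
proof (rule the_equality)
  show "\<exists>a' b' t. t \<noteq> 0 \<and> ore_frac a s = ore_frac a' t \<and> ore_frac b s = ore_frac b' t \<and> ore_frac (a + b) s = ore_frac (a' + b') t"
    using assms by blast
next
  fix z
  assume "\<exists>a' b' t. t \<noteq> 0 \<and> ore_frac a s = ore_frac a' t \<and> ore_frac b s = ore_frac b' t \<and> z = ore_frac (a' + b') t"
  then obtain a' b' t where t: "t \<noteq> 0" "ore_frac a s = ore_frac a' t" "ore_frac b s = ore_frac b' t" "z = ore_frac (a' + b') t"
    by blast
  obtain c d where cd: "c \<noteq> 0" "d \<noteq> 0" "s * c = t * d" using ore assms t by blast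
  have "a * c = a' * d" "b * c = b' * d" using frac_eqD[OF _ assms t(1) cd(3)] t by auto
  then have "(a' + b') * d = (a + b) * c" by (simp add: distrib_right)
  then show "z = ore_frac (a + b) s" using t(4) frac_eq_iff[OF t(1) assms] cd by metis
qed

lemma frac_0: "s \<noteq> 0 \<Longrightarrow> ore_frac 0 s = 0"
  using frac_scale[of s 1 0] by (simp add: zero_ore_quot_def)

lemma frac_eq_0_iff: "s \<noteq> 0 \<Longrightarrow> ore_frac a s = 0 \<longleftrightarrow> a = 0"
  using frac_inj[of s a 0] by (simp add: frac_0)

lemma frac_mult_aux:
  assumes nz: "s \<noteq> 0" "t \<noteq> 0" "d \<noteq> 0" "s' \<noteq> 0" "t' \<noteq> 0" "d' \<noteq> 0"
    and q: "ore_frac a s = ore_frac a' s'" and r: "ore_frac b t = ore_frac b' t'"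
    and cd: "s * c = b * d" and cd': "s' * c' = b' * d'"
  shows "ore_frac (a * c) (t * d) = ore_frac (a' * c') (t' * d')"
proof -
  have td: "t * d \<noteq> 0" "t' * d' \<noteq> 0" using nz by auto
  obtain k l where kl: "k \<noteq> 0" "l \<noteq> 0" "(t * d) * k = (t' * d') * l" using ore td by blast
  have "b * (d * k) = b' * (d' * l)"
    using frac_eqD[OF r nz(2,5), of "d * k" "d' * l"] kl(3) by (simp add: mult.assoc)
  then have "s * (c * k) = s' * (c' * l)" using cd cd' by (metis mult.assoc)
  then have "a * (c * k) = a' * (c' * l)" using frac_eqD[OF q nz(1,4)] by blast
  then show ?thesis using frac_eq_iff[OF td] kl by (metis mult.assoc)
qed

lemma frac_mult:
  assumes nz: "s \<noteq> 0" "t \<noteq> 0" "d \<noteq> 0" and cd: "s * c = b * d"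
  shows "ore_frac a s * ore_frac b t = ore_frac (a * c) (t * d)"
  unfolding times_ore_quot_def
proof (rule the_equality, goal_cases)
  case 1
  then show ?case using assms by blast
next
  case (2 z)
  then obtain a' s' b' t' c' d' where *: "s' \<noteq> 0" "t' \<noteq> 0" "d' \<noteq> 0" "ore_frac a s = ore_frac a' s'"
    "ore_frac b t = ore_frac b' t'" "s' * c' = b' * d'" "z = ore_frac (a' * c') (t' * d')"
    by blast
  show ?case
    unfolding *(7) using frac_mult_aux[OF nz *(1-5) cd *(6)] by (rule sym)
qed

lemma frac_mult_chain: "s \<noteq> 0 \<Longrightarrow> t \<noteq> 0 \<Longrightarrow> ore_frac a s * ore_frac s t = ore_frac a t"
  using frac_mult[of s t 1 1 s a] by simp

lemma frac_chain:
  assumes "r \<noteq> 0"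
  obtains a s t where "s \<noteq> 0" "t \<noteq> 0" "q = ore_frac a s" "r = ore_frac s t"
proof -
  obtain a s where q: "s \<noteq> 0" "q = ore_frac a s" by (rule frac_cases)
  obtain b t where r: "t \<noteq> 0" "r = ore_frac b t" by (rule frac_cases)
  have "b \<noteq> 0" using assms r by (auto simp: frac_0)
  obtain c d where cd: "c \<noteq> 0" "d \<noteq> 0" "s * c = b * d" using ore q \<open>b \<noteq> 0\<close> by blast
  show thesis
  proof (rule that)
    show "s * c \<noteq> 0" "t * d \<noteq> 0" using q(1) r(1) cd(1,2) by simp_all
    show "q = ore_frac (a * c) (s * c)" using q(2) frac_scale[OF cd(1) q(1)] by simp
    show "r = ore_frac (s * c) (t * d)" unfolding cd(3) using r(2) frac_scale[OF cd(2) r(1)] by simp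
  qed
qed

lemma ore_quot_mult_0_right: "q * 0 = (0 :: 'a::ore_domain ore_quot)"
proof -
  obtain a s where q: "s \<noteq> 0" "q = ore_frac a s" by (rule frac_cases)
  have "ore_frac a s * ore_frac 0 1 = ore_frac (a * 0) (1 * 1)" using q by (intro frac_mult) auto
  then show ?thesis using q by (simp add: zero_ore_quot_def)
qed

lemma ore_quot_mult_0_left: "0 * q = (0 :: 'a::ore_domain ore_quot)"
proof (cases "q = 0")
  case True
  then show ?thesis by (simp add: ore_quot_mult_0_right)
next
  case False
  then obtain a s t where "s \<noteq> 0" "t \<noteq> 0" "0 = ore_frac a s" "q = ore_frac s t" by (rule frac_chain)
  then show ?thesis by (metis frac_0 frac_eq_0_iff frac_mult_chain)
qed

lemma to_frac_mult:
  assumes "s \<noteq> 0" shows "to_quot b * ore_frac a s = ore_frac (b * a) s"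
  using frac_mult[of 1 s 1 a a b] assms by simp

lemma frac_one: "s \<noteq> 0 \<Longrightarrow> ore_frac s s = 1"
  using frac_scale[of s 1 1] by (simp add: one_ore_quot_def)

lemma frac_inverse:
  assumes "a \<noteq> 0" "s \<noteq> 0" shows "inverse (ore_frac a s) = ore_frac s a"
proof -
  have "(THE z. \<exists>b t. b \<noteq> 0 \<and> t \<noteq> 0 \<and> ore_frac a s = ore_frac b t \<and> z = ore_frac t b) = ore_frac s a"
  proof (rule the_equality)
    show "\<exists>b t. b \<noteq> 0 \<and> t \<noteq> 0 \<and> ore_frac a s = ore_frac b t \<and> ore_frac s a = ore_frac t b"
      using assms by blast
    fix z assume "\<exists>b t. b \<noteq> 0 \<and> t \<noteq> 0 \<and> ore_frac a s = ore_frac b t \<and> z = ore_frac t b"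
    then obtain b t where bt: "b \<noteq> 0" "t \<noteq> 0" "ore_frac a s = ore_frac b t" "z = ore_frac t b" by blast
    then obtain c d where "c \<noteq> 0" "d \<noteq> 0" "a * c = b * d" "s * c = t * d"
      using frac_eq_iff[OF assms(2) bt(2)] by blast
    then have "ore_frac s a = ore_frac t b" using frac_eq_iff[OF assms(1) bt(1)] by blast
    then show "z = ore_frac s a" using bt(4) by simp
  qed
  then show ?thesis using assms by (simp add: inverse_ore_quot_def frac_eq_0_iff)
qed

instance ore_quot :: (ore_domain) division_ring
proof
  fix p q r :: "'a ore_quot"
  show "p + q + r = p + (q + r)"
  proof -
    obtain a b c s where "s \<noteq> 0" "p = ore_frac a s" "q = ore_frac b s" "r = ore_frac c s" by (rule frac_common3)
    then show ?thesis by (simp add: frac_add add.assoc)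
  qed
  show "p + q = q + p"
  proof -
    obtain a b s where "s \<noteq> 0" "p = ore_frac a s" "q = ore_frac b s" by (rule frac_common)
    then show ?thesis by (simp add: frac_add add.commute)
  qed
  show "0 + p = p"
  proof -
    obtain a s where "s \<noteq> 0" "p = ore_frac a s" by (rule frac_cases)
    then show ?thesis using frac_add[of s 0 a] by (simp add: frac_0)
  qed
  show "- p + p = 0"
  proof -
    obtain a s where "s \<noteq> 0" "p = ore_frac a s" by (rule frac_cases)
    then show ?thesis by (simp add: uminus_ore_quot_def to_frac_mult frac_add frac_0)
  qed
  show "p - q = p + - q" by (simp add: minus_ore_quot_def)
  show "1 * p = p"
  proof -
    obtain a s where "s \<noteq> 0" "p = ore_frac a s" by (rule frac_cases)
    then show ?thesis by (simp add: one_ore_quot_def to_frac_mult)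
  qed
  show "p * 1 = p"
  proof -
    obtain a s where "s \<noteq> 0" "p = ore_frac a s" by (rule frac_cases)
    then show ?thesis using frac_mult_chain[of s s a] by (simp add: frac_one)
  qed
  show "(0 :: 'a ore_quot) \<noteq> 1"
    by (simp add: zero_ore_quot_def one_ore_quot_def frac_inj)
  show "p * q * r = p * (q * r)"
  proof (cases "q = 0 \<or> r = 0")
    case True
    then show ?thesis by (auto simp: ore_quot_mult_0_right ore_quot_mult_0_left)
  next
    case False
    then obtain b c d where qr: "c \<noteq> 0" "d \<noteq> 0" "q = ore_frac b c" "r = ore_frac c d"
      using frac_chain[of r q] by metis
    obtain a s t where pq: "s \<noteq> 0" "t \<noteq> 0" "p = ore_frac a s" "q = ore_frac s t"
      using frac_chain[of q p] False by metis
    have "ore_frac b c = ore_frac s t" using qr(3) pq(4) by simp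
    then obtain k l where kl: "k \<noteq> 0" "l \<noteq> 0" "b * k = s * l" "c * k = t * l"
      using frac_eq_iff[OF qr(1) pq(2)] by blast
    have nz: "s * l \<noteq> 0" "c * k \<noteq> 0" "d * k \<noteq> 0" using kl pq qr by auto
    have p: "p = ore_frac (a * l) (s * l)" using pq kl by (simp add: frac_scale)
    have q: "q = ore_frac (s * l) (c * k)" using pq kl by (simp add: frac_scale)
    have r: "r = ore_frac (c * k) (d * k)" using qr(4) frac_scale[OF kl(1) qr(2)] by simp
    show ?thesis unfolding p q r using nz by (simp add: frac_mult_chain)
  qed
  show "(p + q) * r = p * r + q * r"
  proof (cases "r = 0")
    case True
    have "(0 :: 'a ore_quot) + 0 = 0" by (simp add: zero_ore_quot_def frac_add)
    then show ?thesis using True by (simp add: ore_quot_mult_0_right)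
  next
    case False
    obtain a b s where pq: "s \<noteq> 0" "p = ore_frac a s" "q = ore_frac b s" by (rule frac_common)
    obtain e u t where r: "u \<noteq> 0" "t \<noteq> 0" "ore_frac 1 s = ore_frac e u" "r = ore_frac u t"
      using frac_chain[OF False, of "ore_frac 1 s"] by metis
    obtain k l where kl: "k \<noteq> 0" "l \<noteq> 0" "s * k = u * l" using ore pq r by blast
    have nz: "u * l \<noteq> 0" "t * l \<noteq> 0" using kl r by auto
    have p: "p = ore_frac (a * k) (u * l)" "q = ore_frac (b * k) (u * l)"
      unfolding kl(3)[symmetric] using pq(2,3) frac_scale[OF kl(1) pq(1)] by simp_all
    have r': "r = ore_frac (u * l) (t * l)" using r kl by (simp add: frac_scale)
    show ?thesis unfolding p r' using nz by (simp add: frac_add frac_mult_chain)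
  qed
  show "p * (q + r) = p * q + p * r"
  proof -
    obtain a s where p: "s \<noteq> 0" "p = ore_frac a s" by (rule frac_cases)
    obtain b c t where qr: "t \<noteq> 0" "q = ore_frac b t" "r = ore_frac c t" by (rule frac_common)
    have ex: "\<exists>e k. k \<noteq> 0 \<and> s * e = b * k" for b
    proof (cases "b = 0")
      case True
      then show ?thesis by (intro exI[of _ 0] exI[of _ 1]) simp
    next
      case False
      then show ?thesis using ore[OF p(1) False] by blast
    qed
    obtain e k where ek: "k \<noteq> 0" "s * e = b * k" using ex by blast
    obtain f l where fl: "l \<noteq> 0" "s * f = (c * k) * l" using ex by blast
    have nz: "k * l \<noteq> 0" "t * (k * l) \<noteq> 0" using ek fl qr by auto
    have b: "s * (e * l) = b * (k * l)" and c: "s * f = c * (k * l)"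
      using ek fl by (metis mult.assoc)+
    then have bc: "s * (e * l + f) = (b + c) * (k * l)"
      by (simp add: distrib_left distrib_right)
    have "p * (q + r) = ore_frac (a * (e * l + f)) (t * (k * l))"
      using frac_mult[OF p(1) qr(1) nz(1) bc, of a] p qr by (simp add: frac_add)
    moreover have "p * q = ore_frac (a * (e * l)) (t * (k * l))"
      using frac_mult[OF p(1) qr(1) nz(1) b, of a] p qr by simp
    moreover have "p * r = ore_frac (a * f) (t * (k * l))"
      using frac_mult[OF p(1) qr(1) nz(1) c, of a] p qr by simp
    ultimately show ?thesis using nz by (simp add: frac_add distrib_left)
  qed
  show inv: "inverse p * p = 1" "p * inverse p = 1" if "p \<noteq> 0"
  proof -
    obtain a s where p: "s \<noteq> 0" "p = ore_frac a s" by (rule frac_cases)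
    then have "a \<noteq> 0" using that by (auto simp: frac_0)
    then show "inverse p * p = 1" "p * inverse p = 1"
      using p by (simp_all add: frac_inverse frac_mult_chain frac_one)
  qed
  show "p div q = p * inverse q" by (simp add: divide_ore_quot_def)
  show "inverse (0 :: 'a ore_quot) = 0" by (simp add: inverse_ore_quot_def)
qed

lemma frac_eq_divide: "s \<noteq> 0 \<Longrightarrow> ore_frac a s = to_quot a / to_quot s"
  by (simp add: divide_inverse frac_inverse frac_mult_chain)

instance ore_quot :: ("{ore_domain, real_algebra_1}") real_div_algebra
proof
  fix p q :: "'a ore_quot" and r s :: real
  show "r *\<^sub>R (p + q) = r *\<^sub>R p + r *\<^sub>R q"
    by (simp add: scaleR_ore_quot_def distrib_left)
  show "(r + s) *\<^sub>R p = r *\<^sub>R p + s *\<^sub>R p"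
    by (simp add: scaleR_ore_quot_def frac_add[symmetric] distrib_right)
  show "r *\<^sub>R s *\<^sub>R p = (r * s) *\<^sub>R p"
    by (simp add: scaleR_ore_quot_def to_frac_mult mult.assoc[symmetric])
  show "1 *\<^sub>R p = p"
    by (simp add: scaleR_ore_quot_def one_ore_quot_def[symmetric])
  show "r *\<^sub>R p * q = r *\<^sub>R (p * q)"
    by (simp add: scaleR_ore_quot_def mult.assoc)
  have central: "x * to_quot (of_real r) = to_quot (of_real r) * x" for x :: "'a ore_quot"
  proof -
    obtain a s where x: "s \<noteq> 0" "x = ore_frac a s" by (rule frac_cases)
    have comm: "s * of_real r = of_real r * s" for s :: 'a
      by (simp add: of_real_def)
    have "x * to_quot (of_real r) = ore_frac (a * of_real r) (1 * s)"
      unfolding x(2) by (rule frac_mult) (use x comm in auto)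
    then show ?thesis using x comm by (simp add: to_frac_mult)
  qed
  show "p * r *\<^sub>R q = r *\<^sub>R (p * q)"
    unfolding scaleR_ore_quot_def by (metis central mult.assoc)
qed


section \<open>Valuations\<close>

text \<open>\<open>HOL-Algebra\<close> writes groups multiplicatively: \<open>\<otimes>\<close> is the addition and \<open>\<one>\<close> the zero of the
  value group, which need not be commutative. \<open>le_rel\<close> is the set of pairs \<open>(\<alpha>, \<beta>)\<close> with
  \<open>\<alpha> \<le> \<beta>\<close>.\<close>

record 'g ogroup = "'g monoid" +
  le_rel :: "('g \<times> 'g) set"

definition ordered_group :: "'g ogroup \<Rightarrow> bool" where
  "ordered_group \<Gamma> \<longleftrightarrow> group \<Gamma> \<and> linear_order_on (carrier \<Gamma>) (le_rel \<Gamma>) \<and>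
     (\<forall>\<alpha>\<in>carrier \<Gamma>. \<forall>\<beta>\<in>carrier \<Gamma>. \<forall>\<gamma>\<in>carrier \<Gamma>. (\<alpha>, \<beta>) \<in> le_rel \<Gamma> \<longrightarrow>
        (\<gamma> \<otimes>\<^bsub>\<Gamma>\<^esub> \<alpha>, \<gamma> \<otimes>\<^bsub>\<Gamma>\<^esub> \<beta>) \<in> le_rel \<Gamma> \<and> (\<alpha> \<otimes>\<^bsub>\<Gamma>\<^esub> \<gamma>, \<beta> \<otimes>\<^bsub>\<Gamma>\<^esub> \<gamma>) \<in> le_rel \<Gamma>)"

text \<open>\<open>\<Gamma> \<union> {\<infinity>}\<close> is modelled by the option type, with \<open>None\<close> for \<open>\<infinity>\<close>.\<close>

fun val_le :: "'g ogroup \<Rightarrow> 'g option \<Rightarrow> 'g option \<Rightarrow> bool" where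
  "val_le \<Gamma> _ None \<longleftrightarrow> True"
| "val_le \<Gamma> None (Some _) \<longleftrightarrow> False"
| "val_le \<Gamma> (Some \<alpha>) (Some \<beta>) \<longleftrightarrow> (\<alpha>, \<beta>) \<in> le_rel \<Gamma>"

definition val_min :: "'g ogroup \<Rightarrow> 'g option \<Rightarrow> 'g option \<Rightarrow> 'g option" where
  "val_min \<Gamma> x y = (if val_le \<Gamma> x y then x else y)"

fun val_add :: "'g ogroup \<Rightarrow> 'g option \<Rightarrow> 'g option \<Rightarrow> 'g option" where
  "val_add \<Gamma> (Some \<alpha>) (Some \<beta>) = Some (\<alpha> \<otimes>\<^bsub>\<Gamma>\<^esub> \<beta>)"
| "val_add \<Gamma> _ _ = None"

text \<open>Here \<open>A\<close> is a subring of \<open>'a\<close> containing the real numbers; the values of \<open>v\<close> outside \<open>A\<close>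
  are irrelevant. The last clause says that \<open>v\<close> is trivial on the real numbers.\<close>

definition valuation :: "'a::real_algebra_1 set \<Rightarrow> 'g ogroup \<Rightarrow> ('a \<Rightarrow> 'g option) \<Rightarrow> bool" where
  "valuation A \<Gamma> v \<longleftrightarrow> ordered_group \<Gamma> \<and>
     (\<forall>a\<in>A. v a \<in> insert None (Some ` carrier \<Gamma>)) \<and>
     (\<forall>a\<in>A. v a = None \<longleftrightarrow> a = 0) \<and>
     (\<forall>a\<in>A. \<forall>b\<in>A. v (a * b) = val_add \<Gamma> (v a) (v b)) \<and>
     (\<forall>a\<in>A. \<forall>b\<in>A. val_le \<Gamma> (val_min \<Gamma> (v a) (v b)) (v (a + b))) \<and>
     (\<forall>r::real. r \<noteq> 0 \<longrightarrow> v (of_real r) = Some \<one>\<^bsub>\<Gamma>\<^esub>)"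

definition valuation_ring :: "'a::real_algebra_1 set \<Rightarrow> 'g ogroup \<Rightarrow> ('a \<Rightarrow> 'g option) \<Rightarrow> 'a ring" where
  "valuation_ring K \<Gamma> v = ring_of_type_algebra\<lparr>carrier := {a \<in> K. val_le \<Gamma> (Some \<one>\<^bsub>\<Gamma>\<^esub>) (v a)}\<rparr>"

definition valuation_ideal :: "'a::real_algebra_1 set \<Rightarrow> 'g ogroup \<Rightarrow> ('a \<Rightarrow> 'g option) \<Rightarrow> 'a set" where
  "valuation_ideal K \<Gamma> v = {a \<in> K. val_le \<Gamma> (Some \<one>\<^bsub>\<Gamma>\<^esub>) (v a) \<and> v a \<noteq> Some \<one>\<^bsub>\<Gamma>\<^esub>}"

definition real_residue_field :: "'a::real_algebra_1 set \<Rightarrow> 'g ogroup \<Rightarrow> ('a \<Rightarrow> 'g option) \<Rightarrow> bool" where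
  "real_residue_field K \<Gamma> v \<longleftrightarrow>
     (\<lambda>r. valuation_ideal K \<Gamma> v +>\<^bsub>valuation_ring K \<Gamma> v\<^esub> of_real r)
       \<in> ring_iso (ring_of_type_algebra :: real ring) (valuation_ring K \<Gamma> v Quot valuation_ideal K \<Gamma> v)"

text \<open>For a subring \<open>A\<close> of \<open>'a\<close> that is itself an Ore domain, this is the quotient division ring
  of \<open>A\<close>, realised inside the one of \<open>'a\<close>.\<close>

definition fractions :: "'a::ore_domain set \<Rightarrow> 'a ore_quot set" where
  "fractions A = {ore_frac a s | a s. a \<in> A \<and> s \<in> A \<and> s \<noteq> 0}"

text \<open>The residue division ring of a valuation on an Ore domain is that of its (unique) extension
  to the quotient division ring.\<close>

definition ore_real_residue_field ::
  "'a::{ore_domain, real_algebra_1} set \<Rightarrow> 'g ogroup \<Rightarrow> ('a \<Rightarrow> 'g option) \<Rightarrow> bool" where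
  "ore_real_residue_field A \<Gamma> v \<longleftrightarrow> (\<exists>V. valuation (fractions A) \<Gamma> V \<and>
     (\<forall>a\<in>A. V (to_quot a) = v a) \<and> real_residue_field (fractions A) \<Gamma> V)"

text \<open>The subgroup generated by the values on \<open>A\<close>; for an Ore domain \<open>A\<close> it is the group of values
  of the nonzero elements of the quotient division ring.\<close>

definition value_group :: "'a set \<Rightarrow> 'g ogroup \<Rightarrow> ('a \<Rightarrow> 'g option) \<Rightarrow> 'g set" where
  "value_group A \<Gamma> v = generate \<Gamma> {\<gamma>. \<exists>a\<in>A. v a = Some \<gamma>}"

text \<open>\<open>w\<close> extends \<open>v\<close> when they agree on \<open>A\<close> after an order embedding of the value group of \<open>v\<close>
  into the possibly larger group \<open>\<Gamma>'\<close>. When the existence of \<open>\<Gamma>'\<close> is claimed, its elements can be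
  taken to be sets of elements of the quotient division ring \<open>D\<close>: the value group of a valuation
  on \<open>D\<close> is isomorphic to the group of cosets, in the nonzero elements of \<open>D\<close>, of the subgroup of
  elements of value zero.\<close>

definition extends_valuation ::
  "'a set \<Rightarrow> 'g ogroup \<Rightarrow> ('a \<Rightarrow> 'g option) \<Rightarrow> 'h ogroup \<Rightarrow> ('a \<Rightarrow> 'h option) \<Rightarrow> bool" where
  "extends_valuation A \<Gamma> v \<Gamma>' w \<longleftrightarrow>
     (\<exists>\<iota> \<in> hom (\<Gamma>\<lparr>carrier := value_group A \<Gamma> v\<rparr>) \<Gamma>'.
        (\<forall>\<alpha>\<in>value_group A \<Gamma> v. \<forall>\<beta>\<in>value_group A \<Gamma> v.
           (\<alpha>, \<beta>) \<in> le_rel \<Gamma> \<longleftrightarrow> (\<iota> \<alpha>, \<iota> \<beta>) \<in> le_rel \<Gamma>') \<and>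
        (\<forall>a\<in>A. w a = map_option \<iota> (v a)))"

text \<open>The skew polynomials with coefficients in \<open>S\<close>: \<open>skew_polys puiseux\<close> is \<open>R[y;\<delta>]\<close> and
  \<open>skew_polys UNIV\<close> is the skew polynomial ring over all generalized power series.\<close>

definition skew_polys :: "'a::real_diff_field set \<Rightarrow> 'a skew_poly set" where
  "skew_polys S = {p. \<forall>i. coeff (left_poly p) i \<in> S}"

end

theory Submission
  imports Defs "HOL-Library.Product_Plus" "HOL-Library.Product_Lexorder"
    "HOL-Computational_Algebra.Formal_Power_Series"
begin

text \<open>
  Square roots of \<open>1 + t\<close> with \<open>t\<close> infinitesimal force \<open>v\<close> to restrict to the \<open>x\<^sup>-\<^sup>1\<close>-adic valuation on the
  Puiseux series, and the relation \<open>y x - x y = 1\<close> forces \<open>v (y - p) < v (x\<^sup>-\<^sup>1)\<close> for every Puiseux series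
  \<open>p\<close>. Either some \<open>v (y - p)\<close> is not the value of a Puiseux series; then \<open>v\<close> is the Gauss valuation
  \<open>v (\<Sum>i. a\<^sub>i (y - p)\<^sup>i) = min (v a\<^sub>i + i v (y - p))\<close>, and the same formula extends it. Or successive
  approximations \<open>p\<^sub>k\<close> of \<open>y\<close> converge to a generalized series \<open>\<theta>\<close> with unbounded denominators; then a
  Newton--Puiseux argument gives \<open>v f = v a\<^sub>0\<close> for \<open>f = \<Sum>i. a\<^sub>i (y - p\<^sub>k)\<^sup>i\<close> and \<open>k\<close> large, so the Gauss
  valuation around \<open>\<theta>\<close> extends \<open>v\<close> when the value of \<open>y - \<theta>\<close> is put just above those of the
  \<open>y - p\<^sub>k\<close>. In both cases the ordered value group of the extension embeds into \<open>\<real> \<times> \<real>\<close> with the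
  lexicographic order, depending only on the cut that the value of \<open>y - \<theta>\<close> determines in \<open>\<rat>\<close>.
\<close>


section \<open>Generalized power series and Puiseux series\<close>

text \<open>The value group of \<open>v\<close> is not assumed commutative, so little can be
  computed in it until conjugation by powers of x is under control. The bound on v (y - p) does
  this: conjugating y - p adds only a multiple of x^-1, which is too small to change the value, so v
  (y - p) commutes with the values of Puiseux series. The same bound makes the derivation invisible
  in leading terms, which therefore multiply like commutative polynomials. The residue field stays
  real as soon as the value assigned to y - \<theta> avoids the divisible group of values of series:
  every leading part is then a single monomial with a real coefficient. When each y - p has its
  value inside that group, the value of y - \<theta> must be a new element, and the value group
  grows. What has to be matched between \<open>v\<close> and the model is then only a cut in the
  rationals.\<close>

definition gord :: "gseries \<Rightarrow> rat" where
  "gord f = (THE m. m \<in> supp f \<and> (\<forall>b\<in>supp f. m \<le> b))"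

lemma gord:
  assumes "f \<noteq> 0"
  shows "gcoeff f (gord f) \<noteq> 0" and "gcoeff f b \<noteq> 0 \<Longrightarrow> gord f \<le> b"
proof -
  have "supp f \<noteq> {}" using assms gseries_eqI[of f 0] by auto
  then obtain m where "m \<in> supp f" "\<And>b. b \<in> supp f \<Longrightarrow> m \<le> b"
    using wo_minE[OF wo_supp[of f], of "supp f"] by auto
  then have "\<exists>!m. m \<in> supp f \<and> (\<forall>b\<in>supp f. m \<le> b)" by (metis order_antisym)
  from theI'[OF this] show "gcoeff f (gord f) \<noteq> 0" "gcoeff f b \<noteq> 0 \<Longrightarrow> gord f \<le> b"
    unfolding gord_def by auto
qed

lemma gord_eqI:
  assumes "gcoeff f q \<noteq> 0" "\<And>b. b < q \<Longrightarrow> gcoeff f b = 0"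
  shows "gord f = q"
proof -
  have "f \<noteq> 0" using assms(1) by auto
  then show ?thesis using gord[of f] assms by (metis order_antisym not_less)
qed

lemma gcoeff_of_real: "gcoeff (of_real r) q = (if q = 0 then r else 0)"
  by (simp add: of_real_def gcoeff_one)

lemma gmonom_mult: "gmonom c p * gmonom d q = gmonom (c * d) (p + q)"
  by (rule gseries_eqI) (auto simp: gcoeff_gmonom_mult gcoeff_gmonom algebra_simps)

lemma gmonom_0 [simp]: "gmonom 0 q = 0"
  by (rule gseries_eqI) (simp add: gcoeff_gmonom)

lemma gmonom_at_0: "gmonom c 0 = of_real c"
  by (rule gseries_eqI) (simp add: gcoeff_gmonom gcoeff_of_real)

lemma gmonom_eq_0_iff [simp]: "gmonom c q = 0 \<longleftrightarrow> c = 0"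
  by (metis gcoeff_gmonom gcoeff_zero gmonom_0)

lemma gord_gmonom: "c \<noteq> 0 \<Longrightarrow> gord (gmonom c q) = q"
  by (rule gord_eqI) (auto simp: gcoeff_gmonom)

lemma der_gmonom: "der (gmonom c q) = gmonom (- of_rat q * c) (q + 1)"
  by (rule gseries_eqI) (auto simp: gcoeff_der gcoeff_gmonom algebra_simps)

lemma gmonom_eq_of_real_mult: "gmonom c q = of_real c * gmonom 1 q"
  using gmonom_mult[of c 0 1 q] by (simp add: gmonom_at_0)

text \<open>The group (1/n)Z of exponents. For \<open>n = 0\<close> the condition would admit every
  rational, hence the bound \<open>n \<ge> 1\<close> wherever denominators matter.\<close>

definition exps :: "nat \<Rightarrow> rat set" where
  "exps n = {q. of_nat n * q \<in> \<int>}"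

lemma exps_add: "p \<in> exps n \<Longrightarrow> q \<in> exps n \<Longrightarrow> p + q \<in> exps n"
  by (simp add: exps_def distrib_left)

lemma exps_diff: "p \<in> exps n \<Longrightarrow> q \<in> exps n \<Longrightarrow> p - q \<in> exps n"
  by (simp add: exps_def right_diff_distrib)

lemma exps_0_1 [simp]: "0 \<in> exps n" "1 \<in> exps n"
  by (auto simp: exps_def)

lemma exps_mono: "exps n \<subseteq> exps (n * m)" "exps m \<subseteq> exps (n * m)"
proof -
  have "of_nat (n * m) * q \<in> \<int>" if "of_nat n * q \<in> \<int>" for q :: rat
  proof -
    have "of_nat m * (of_nat n * q) \<in> \<int>" by (rule Ints_mult[OF Ints_of_nat that])
    then show ?thesis by (simp add: mult_ac)
  qed
  moreover have "of_nat (n * m) * q \<in> \<int>" if "of_nat m * q \<in> \<int>" for q :: rat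
  proof -
    have "of_nat n * (of_nat m * q) \<in> \<int>" by (rule Ints_mult[OF Ints_of_nat that])
    then show ?thesis by (simp add: mult_ac)
  qed
  ultimately show "exps n \<subseteq> exps (n * m)" "exps m \<subseteq> exps (n * m)"
    by (auto simp: exps_def)
qed

lemma ex_exps: "\<exists>n\<ge>1. q \<in> exps n"
proof -
  obtain a b where ab: "quotient_of q = (a, b)" by force
  then have "b > 0" "q = of_int a / of_int b"
    using quotient_of_denom_pos quotient_of_div by blast+
  then have "nat b \<ge> 1" "of_nat (nat b) * q \<in> \<int>" by auto
  then show ?thesis unfolding exps_def by blast
qed

text \<open>Multiplication by \<open>n\<close> produces a strictly increasing bounded sequence of
  integers. This is the contradiction that ends the Newton--Puiseux argument.\<close>

lemma exps_no_bounded_sequence: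
  assumes "n \<ge> 1" "\<And>k::nat. q k \<in> exps n" "\<And>k. q k < q (Suc k)" "\<And>k. q k < b"
  shows False
proof -
  define z where "z k = \<lfloor>of_nat n * q k\<rfloor>" for k
  have z: "of_int (z k) = of_nat n * q k" for k
    using assms(2)[of k] by (simp add: exps_def z_def)
  have "z k < z (Suc k)" for k
  proof -
    have "(of_int (z k) :: rat) < of_int (z (Suc k))"
      unfolding z using assms(1,3) by simp
    then show ?thesis by simp
  qed
  then have ge: "z 0 + int k \<le> z k" for k
    by (induction k) (auto simp: add1_zle_eq intro: order_trans, smt (verit))
  have "z k \<le> \<lfloor>of_nat n * b\<rfloor>" for k
    unfolding z_def using assms(1,4) by (intro floor_mono mult_left_mono) (auto simp: less_imp_le)
  then show False using ge[of "nat (\<lfloor>of_nat n * b\<rfloor> - z 0 + 1)"] by (smt (verit) nat_0_le of_nat_0_le_iff)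
qed

text \<open>The lower bound \<open>m\<close> in the definition of \<open>puiseux\<close> comes for
  free, because a well-ordered support is bounded below by \<open>gord f\<close>. Only the common
  denominator has to be tracked.\<close>

lemma puiseux_iff: "f \<in> puiseux \<longleftrightarrow> (\<exists>n\<ge>1. supp f \<subseteq> exps n)"
proof
  assume "f \<in> puiseux"
  then obtain n and m :: int where n: "n \<ge> 1"
    "\<And>q. gcoeff f q \<noteq> 0 \<Longrightarrow> \<exists>k\<ge>m. q = of_int k / of_nat n"
    unfolding puiseux_def by blast
  have "of_nat n * q \<in> \<int>" if "gcoeff f q \<noteq> 0" for q
    using n(2)[OF that] n(1) by auto
  then show "\<exists>n\<ge>1. supp f \<subseteq> exps n" using n(1) unfolding exps_def by blast
next
  assume "\<exists>n\<ge>1. supp f \<subseteq> exps n"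
  then obtain n where n: "n \<ge> 1" "supp f \<subseteq> exps n" by blast
  have "\<exists>k\<ge>\<lfloor>of_nat n * gord f\<rfloor>. q = of_int k / of_nat n" if q: "gcoeff f q \<noteq> 0" for q
  proof (intro exI conjI)
    have f: "f \<noteq> 0" using q by auto
    have "gord f \<le> q" using gord(2)[OF f q] .
    then show "\<lfloor>of_nat n * gord f\<rfloor> \<le> \<lfloor>of_nat n * q\<rfloor>" by (intro floor_mono mult_left_mono) auto
    have "of_int \<lfloor>of_nat n * q\<rfloor> = of_nat n * q" using n(2) q by (auto simp: exps_def subset_iff)
    then show "q = of_int \<lfloor>of_nat n * q\<rfloor> / of_nat n"
      using n(1) by (metis One_nat_def nonzero_mult_div_cancel_left not_less_eq_eq of_nat_eq_0_iff zero_order(1))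
  qed
  then show "f \<in> puiseux" using n(1) unfolding puiseux_def by blast
qed

lemma supp_exps_mult: "supp f \<subseteq> exps n \<Longrightarrow> supp g \<subseteq> exps n \<Longrightarrow> supp (f * g) \<subseteq> exps n"
  using supp_mult[of f g] by (fastforce intro: exps_add)

lemma supp_exps_add: "supp f \<subseteq> exps n \<Longrightarrow> supp g \<subseteq> exps n \<Longrightarrow> supp (f + g) \<subseteq> exps n"
  by (simp add: subset_iff) (metis add_0)

lemma supp_exps_der: "supp f \<subseteq> exps n \<Longrightarrow> supp (der f) \<subseteq> exps n"
  using exps_add[of _ n 1] by (fastforce simp: gcoeff_der)

lemma puiseux_common:
  assumes "f \<in> puiseux" "g \<in> puiseux"
  obtains n where "n \<ge> 1" "supp f \<subseteq> exps n" "supp g \<subseteq> exps n"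
proof -
  obtain n m where "n \<ge> 1" "supp f \<subseteq> exps n" "m \<ge> 1" "supp g \<subseteq> exps m"
    using assms unfolding puiseux_iff by blast
  then show ?thesis using that[of "n * m"] exps_mono[of n m] exps_mono[of m n] by force
qed

lemma puiseux_mult: "f \<in> puiseux \<Longrightarrow> g \<in> puiseux \<Longrightarrow> f * g \<in> puiseux"
  by (metis puiseux_common puiseux_iff supp_exps_mult)

lemma puiseux_add: "f \<in> puiseux \<Longrightarrow> g \<in> puiseux \<Longrightarrow> f + g \<in> puiseux"
  by (metis puiseux_common puiseux_iff supp_exps_add)

lemma puiseux_der: "f \<in> puiseux \<Longrightarrow> der f \<in> puiseux"
  unfolding puiseux_iff using supp_exps_der by blast

lemma puiseux_gmonom: "gmonom c q \<in> puiseux"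
proof -
  obtain n where "n \<ge> 1" "q \<in> exps n" using ex_exps by blast
  then show ?thesis unfolding puiseux_iff
    by (intro exI[of _ n]) (auto simp: gcoeff_gmonom split: if_splits)
qed

lemma puiseux_of_real: "of_real r \<in> puiseux"
  using puiseux_gmonom[of r 0] by (simp add: gmonom_at_0)

section \<open>Real power series in x^(-1/n) and square roots\<close>

lemma wo_fractions: "wo (range (\<lambda>k. of_nat k / of_nat n))"
  unfolding wo_iff
proof (intro allI impI)
  fix B :: "rat set"
  assume B: "B \<subseteq> range (\<lambda>k. of_nat k / of_nat n)" "B \<noteq> {}"
  define k where "k = (LEAST k. of_nat k / of_nat n \<in> B)"
  have "\<exists>k. of_nat k / of_nat n \<in> B" using B by blast
  then have "of_nat k / of_nat n \<in> B" unfolding k_def by (rule LeastI_ex)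
  moreover have "of_nat k / of_nat n \<le> b" if "b \<in> B" for b
  proof -
    have "b \<in> range (\<lambda>k. of_nat k / of_nat n)" using B(1) that by blast
    then obtain j where j: "b = of_nat j / of_nat n" by (auto simp: image_def)
    then have "k \<le> j" unfolding k_def using that by (intro Least_le) simp
    then show ?thesis using j by (simp add: divide_right_mono)
  qed
  ultimately show "\<exists>m\<in>B. \<forall>b\<in>B. m \<le> b" by blast
qed

text \<open>Substitution of x^(-1/n) for the variable. For \<open>n \<ge> 1\<close> the sum has at
  most one term; writing it as a sum avoids a case distinction on whether \<open>q\<close> is a
  multiple of 1/n.\<close>

definition gs_of_fps :: "nat \<Rightarrow> real fps \<Rightarrow> gseries" where
  "gs_of_fps n a = Abs_gseries (\<lambda>q. \<Sum>k | q = of_nat k / of_nat n. fps_nth a k)"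

lemma gs_of_fps_sum:
  assumes "n \<ge> 1"
  shows "gcoeff (gs_of_fps n a) q = (\<Sum>k | q = of_nat k / of_nat n. fps_nth a k)"
  unfolding gs_of_fps_def
proof (subst gcoeff_Abs)
  have "{q. (\<Sum>k | q = of_nat k / of_nat n. fps_nth a k) \<noteq> 0} \<subseteq> range (\<lambda>k. of_nat k / of_nat n)"
    by (auto elim!: sum.not_neutral_contains_not_neutral)
  then show "wo {q. (\<Sum>k | q = of_nat k / of_nat n. fps_nth a k) \<noteq> 0}"
    by (rule wo_subset[OF wo_fractions])
qed simp

lemma gcoeff_gs_of_fps:
  assumes "n \<ge> 1" shows "gcoeff (gs_of_fps n a) (of_nat k / of_nat n) = fps_nth a k"
proof -
  have "{j. (of_nat k / of_nat n :: rat) = of_nat j / of_nat n} = {k}"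
    using assms by auto
  then show ?thesis by (simp add: gs_of_fps_sum[OF assms])
qed

lemma supp_gs_of_fps:
  assumes "n \<ge> 1" "gcoeff (gs_of_fps n a) q \<noteq> 0" shows "\<exists>k. q = of_nat k / of_nat n"
  using assms(2) unfolding gs_of_fps_sum[OF assms(1)]
  by (auto elim!: sum.not_neutral_contains_not_neutral)

lemma gs_of_fps_eqI:
  assumes "n \<ge> 1" "\<And>q. gcoeff f q \<noteq> 0 \<Longrightarrow> \<exists>k. q = of_nat k / of_nat n"
    and "\<And>k. gcoeff f (of_nat k / of_nat n) = fps_nth a k"
  shows "f = gs_of_fps n a"
proof (rule gseries_eqI)
  fix q
  show "gcoeff f q = gcoeff (gs_of_fps n a) q"
  proof (cases "\<exists>k. q = of_nat k / of_nat n")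
    case True
    then show ?thesis using assms(3) gcoeff_gs_of_fps[OF assms(1)] by auto
  next
    case False
    then have "gcoeff f q = 0" "gcoeff (gs_of_fps n a) q = 0"
      using assms(2) supp_gs_of_fps[OF assms(1)] by blast+
    then show ?thesis by simp
  qed
qed

lemma gs_of_fps_mult:
  assumes n: "n \<ge> 1" shows "gs_of_fps n a * gs_of_fps n b = gs_of_fps n (a * b)"
proof (rule gs_of_fps_eqI[OF n])
  fix q assume "gcoeff (gs_of_fps n a * gs_of_fps n b) q \<noteq> 0"
  then obtain c d where cd: "q = c + d" "gcoeff (gs_of_fps n a) c \<noteq> 0" "gcoeff (gs_of_fps n b) d \<noteq> 0"
    using supp_mult[of "gs_of_fps n a" "gs_of_fps n b"] by blast
  then obtain i j where "c = of_nat i / of_nat n" "d = of_nat j / of_nat n"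
    using supp_gs_of_fps[OF n] by metis
  then have "q = of_nat (i + j) / of_nat n" using cd by (simp add: add_divide_distrib)
  then show "\<exists>k. q = of_nat k / of_nat n" by blast
next
  fix k
  let ?g = "\<lambda>i. (of_nat i / of_nat n :: rat)"
  have inj: "inj_on ?g {..k}" using n by (auto simp: inj_on_def)
  have "gcoeff (gs_of_fps n a * gs_of_fps n b) (?g k)
      = (\<Sum>c\<in>?g ` {..k}. gcoeff (gs_of_fps n a) c * gcoeff (gs_of_fps n b) (?g k - c))"
  proof (rule gcoeff_mult_superset)
    show "{c. gcoeff (gs_of_fps n a) c \<noteq> 0 \<and> gcoeff (gs_of_fps n b) (?g k - c) \<noteq> 0} \<subseteq> ?g ` {..k}"
    proof
      fix c assume "c \<in> {c. gcoeff (gs_of_fps n a) c \<noteq> 0 \<and> gcoeff (gs_of_fps n b) (?g k - c) \<noteq> 0}"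
      then obtain i j where ij: "c = ?g i" "?g k - c = ?g j" using supp_gs_of_fps[OF n] by blast
      then have "?g k = ?g i + ?g j" by simp
      then have "(of_nat k :: rat) = of_nat (i + j)" using n by (simp add: field_simps)
      then have "k = i + j" using of_nat_eq_iff by blast
      then show "c \<in> ?g ` {..k}" using ij(1) by auto
    qed
  qed simp
  also have "\<dots> = (\<Sum>i\<le>k. gcoeff (gs_of_fps n a) (?g i) * gcoeff (gs_of_fps n b) (?g k - ?g i))"
    by (simp add: sum.reindex[OF inj])
  also have "\<dots> = (\<Sum>i\<le>k. fps_nth a i * fps_nth b (k - i))"
  proof (rule sum.cong[OF refl])
    fix i assume "i \<in> {..k}"
    then have "?g k - ?g i = ?g (k - i)" by (simp add: of_nat_diff diff_divide_distrib)
    then show "gcoeff (gs_of_fps n a) (?g i) * gcoeff (gs_of_fps n b) (?g k - ?g i) = fps_nth a i * fps_nth b (k - i)"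
      by (simp add: gcoeff_gs_of_fps[OF n])
  qed
  finally show "gcoeff (gs_of_fps n a * gs_of_fps n b) (?g k) = fps_nth (a * b) k"
    by (simp add: fps_mult_nth atMost_atLeast0)
qed

text \<open>With a common denominator \<open>n\<close>, the series \<open>1 + t\<close> is a formal
  power series in x^(-1/n) with constant term 1, and such a series has a square root in the same
  variable.\<close>

lemma puiseux_sqrt:
  assumes t: "t \<in> puiseux" "\<And>q. gcoeff t q \<noteq> 0 \<Longrightarrow> 0 < q"
  shows "\<exists>s\<in>puiseux. s * s = 1 + t"
proof -
  obtain n where n: "n \<ge> 1" "supp t \<subseteq> exps n" using t puiseux_iff by blast
  define a where "a = Abs_fps (\<lambda>k. gcoeff (1 + t) (of_nat k / of_nat n))"
  have F: "1 + t = gs_of_fps n a"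
  proof (rule gs_of_fps_eqI[OF n(1)])
    fix q assume q: "gcoeff (1 + t) q \<noteq> 0"
    then consider "q = 0" | "gcoeff t q \<noteq> 0" by (auto simp: gcoeff_one split: if_splits)
    then show "\<exists>k. q = of_nat k / of_nat n"
    proof cases
      case 1
      then show ?thesis by (intro exI[of _ 0]) simp
    next
      case 2
      then obtain z where z: "of_nat n * q = of_int z" using n(2) by (auto simp: exps_def elim!: Ints_cases)
      have "0 < of_nat n * q" using t(2)[OF 2] n(1) by simp
      then have "(of_nat (nat z) :: rat) = of_nat n * q" unfolding z by simp
      then have "q = of_nat (nat z) / of_nat n" using n(1) by (simp add: field_simps)
      then show ?thesis by blast
    qed
  qed (simp add: a_def)
  have "gcoeff t 0 = 0" using t(2)[of 0] by auto
  then have a0: "fps_nth a 0 = 1" by (simp add: a_def gcoeff_one)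
  \<comment> \<open>The function choosing a root of the constant term may be constantly 1, since
    that constant term is 1.\<close>
  define b where "b = fps_radical (\<lambda>_ _. 1) 2 a"
  have "b ^ 2 = a"
    using power_radical[of a "\<lambda>_ _. 1" 1] a0 by (simp add: b_def numeral_2_eq_2)
  then have "gs_of_fps n b * gs_of_fps n b = 1 + t"
    by (simp add: gs_of_fps_mult[OF n(1)] F power2_eq_square)
  moreover have "gs_of_fps n b \<in> puiseux"
    unfolding puiseux_iff exps_def using n(1) supp_gs_of_fps[OF n(1), of b]
    by (intro exI[of _ n]) fastforce
  ultimately show ?thesis by blast
qed

section \<open>Substitution in skew polynomials\<close>

definition sconst :: "'a::real_diff_field \<Rightarrow> 'a skew_poly" where
  "sconst a = Abs_skew_poly [:a:]"

definition svar :: "'a::real_diff_field skew_poly" where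
  "svar = Abs_skew_poly [:0, 1:]"

lemma svar_sconst: "svar * sconst a = sconst a * svar + sconst (der a)"
  unfolding svar_def sconst_def by (rule skew_commutation)

lemma sconst_0 [simp]: "sconst 0 = 0"
  and sconst_1 [simp]: "sconst 1 = 1"
  and sconst_add: "sconst (a + b) = sconst a + sconst b"
  and sconst_diff: "sconst (a - b) = sconst a - sconst b"
  and sconst_uminus: "sconst (- a) = - sconst a"
  and sconst_mult: "sconst (a * b) = sconst a * sconst b"
  by (simp_all add: sconst_def skew_poly_eq_iff skew_poly_defs skew_mult_def one_pCons)

lemma sconst_eq_0_iff [simp]: "sconst a = 0 \<longleftrightarrow> a = 0"
  by (simp add: sconst_def skew_poly_eq_iff skew_poly_defs)

lemma of_real_eq_sconst: "of_real r = sconst (of_real r)"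
  by (simp add: of_real_def sconst_def skew_poly_eq_iff skew_poly_defs one_pCons)

lemma left_poly_add [simp]: "left_poly (f + g) = left_poly f + left_poly g"
  and left_poly_diff [simp]: "left_poly (f - g) = left_poly f - left_poly g"
  and left_poly_0 [simp]: "left_poly 0 = 0"
  and left_poly_1 [simp]: "left_poly 1 = 1"
  and left_poly_mult: "left_poly (f * g) = skew_mult (left_poly f) (left_poly g)"
  by (simp_all add: skew_poly_defs)

lemma left_poly_eq_0_iff [simp]: "left_poly f = 0 \<longleftrightarrow> f = 0"
  by (simp add: skew_poly_eq_iff)

lemma left_poly_sconst [simp]: "left_poly (sconst a) = [:a:]"
  and left_poly_svar [simp]: "left_poly svar = [:0, 1:]"
  by (simp_all add: sconst_def svar_def)

lemma left_poly_sum: "left_poly (\<Sum>i\<in>I. f i) = (\<Sum>i\<in>I. left_poly (f i))"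
  by (induction I rule: infinite_finite_induct) auto

lemma left_poly_sconst_mult [simp]: "left_poly (sconst a * f) = smult a (left_poly f)"
  by (simp add: left_poly_mult skew_mult_def)

lemma left_poly_svar_mult: "left_poly (svar * f) = y_mult (left_poly f)"
  by (simp add: left_poly_mult skew_mult_def)

lemma left_poly_svar_power: "left_poly (svar ^ i) = monom 1 i"
proof -
  have "left_poly (svar ^ i :: 'a skew_poly) = (y_mult ^^ i) 1"
    by (induction i) (simp_all add: left_poly_svar_mult)
  then show ?thesis by (simp add: y_mult_pow_1)
qed

definition seval :: "'a::real_diff_field skew_poly \<Rightarrow> 'a poly \<Rightarrow> 'a skew_poly" where
  "seval z p = (\<Sum>i\<le>degree p. sconst (coeff p i) * z ^ i)"

lemma seval_le:
  assumes "degree p \<le> n" shows "seval z p = (\<Sum>i\<le>n. sconst (coeff p i) * z ^ i)"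
  unfolding seval_def using assms by (intro sum.mono_neutral_left) (auto simp: coeff_eq_0)

lemma seval_0 [simp]: "seval z 0 = 0"
  by (simp add: seval_def)

lemma seval_add: "seval z (p + q) = seval z p + seval z q"
proof -
  define n where "n = max (degree p) (degree q)"
  have "degree (p + q) \<le> n" "degree p \<le> n" "degree q \<le> n"
    by (auto simp: n_def degree_add_le)
  then show ?thesis by (simp add: seval_le sconst_add distrib_right sum.distrib)
qed

lemma seval_sum: "seval z (\<Sum>i\<in>I. f i) = (\<Sum>i\<in>I. seval z (f i))"
  by (induction I rule: infinite_finite_induct) (auto simp: seval_add)

lemma seval_smult: "seval z (smult a p) = sconst a * seval z p"
  using seval_le[OF degree_smult_le[of a p], of z]
  by (simp add: seval_def[of z p] sconst_mult sum_distrib_left mult.assoc)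

lemma seval_pCons: "seval z (pCons a p) = sconst a + seval z p * z"
proof -
  have "seval z (pCons a p) = (\<Sum>i\<le>Suc (degree p). sconst (coeff (pCons a p) i) * z ^ i)"
    by (rule seval_le) (rule degree_pCons_le)
  also have "\<dots> = sconst a + (\<Sum>i\<le>degree p. sconst (coeff p i) * z ^ Suc i)"
    by (subst sum.atMost_Suc_shift) simp
  also have "\<dots> = sconst a + seval z p * z"
    by (simp only: seval_def sum_distrib_right power_Suc2 mult.assoc)
  finally show ?thesis .
qed

text \<open>The hypothesis says that \<open>z\<close> moves past constants exactly as y does. Skew
  multiplication is determined by this rule, so y -> z extends to a ring homomorphism.\<close>

lemma seval_y_mult:
  assumes z: "\<And>a. z * sconst a = sconst a * z + sconst (der a)"
  shows "seval z (y_mult p) = z * seval z p"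
proof (induction p)
  case 0
  then show ?case by simp
next
  case (pCons a p)
  have "y_mult (pCons a p) = pCons (der a) ([:a:] + y_mult p)"
    by (rule poly_eqI) (auto simp: coeff_y_mult coeff_pCons split: nat.split)
  then show ?case
    by (simp add: seval_pCons seval_add pCons.IH distrib_left distrib_right z mult.assoc)
qed

lemma seval_skew_mult:
  assumes z: "\<And>a. z * sconst a = sconst a * z + sconst (der a)"
  shows "seval z (skew_mult p q) = seval z p * seval z q"
proof -
  have "seval z ((y_mult ^^ i) q) = z ^ i * seval z q" for i
    by (induction i) (simp_all add: seval_y_mult[OF z] mult.assoc)
  then show ?thesis
    by (simp add: skew_mult_def seval_sum seval_smult seval_def[of z p] sum_distrib_right mult.assoc)
qed

lemma seval_svar: "seval svar (left_poly f) = f"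
  by (simp add: skew_poly_eq_iff seval_def left_poly_sum left_poly_svar_power smult_monom
      poly_as_sum_of_monoms)

text \<open>The ring automorphism \<open>y \<mapsto> y + \<theta>\<close>; its value at \<open>f\<close> lists the coefficients of the expansion
  of \<open>f\<close> in powers of \<open>y - \<theta>\<close>.\<close>

definition sshift :: "'a::real_diff_field \<Rightarrow> 'a skew_poly \<Rightarrow> 'a skew_poly" where
  "sshift \<theta> f = seval (svar + sconst \<theta>) (left_poly f)"

text \<open>Constants commute with each other, so adding \<open>sconst \<theta>\<close> to y leaves
  the commutation rule intact. Hence the substitution is multiplicative.\<close>

lemma svar_shift_sconst:
  "(svar + sconst \<theta>) * sconst a = sconst a * (svar + sconst \<theta>) + sconst (der a)"
  by (simp add: distrib_right distrib_left svar_sconst sconst_mult[symmetric] mult.commute)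

lemma sshift_add: "sshift \<theta> (f + g) = sshift \<theta> f + sshift \<theta> g"
  by (simp add: sshift_def seval_add)

lemma sshift_diff: "sshift \<theta> (f - g) = sshift \<theta> f - sshift \<theta> g"
  using sshift_add[of \<theta> "f - g" g] by (simp add: algebra_simps)

lemma sshift_0 [simp]: "sshift \<theta> 0 = 0"
  by (simp add: sshift_def)

lemma sshift_mult: "sshift \<theta> (f * g) = sshift \<theta> f * sshift \<theta> g"
  unfolding sshift_def left_poly_mult by (rule seval_skew_mult[OF svar_shift_sconst])

lemma sshift_sconst [simp]: "sshift \<theta> (sconst a) = sconst a"
  by (simp add: sshift_def seval_pCons)

lemma sshift_1 [simp]: "sshift \<theta> 1 = 1"
  using sshift_sconst[of \<theta> 1] by simp

lemma sshift_svar [simp]: "sshift \<theta> svar = svar + sconst \<theta>"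
  by (simp add: sshift_def seval_pCons)

lemma sshift_power: "sshift \<theta> (f ^ i) = sshift \<theta> f ^ i"
  by (induction i) (simp_all add: sshift_mult)

lemma sshift_sum: "sshift \<theta> (\<Sum>i\<in>I. f i) = (\<Sum>i\<in>I. sshift \<theta> (f i))"
  by (induction I rule: infinite_finite_induct) (auto simp: sshift_add)

lemma sshift_sshift: "sshift \<theta> (sshift \<eta> f) = sshift (\<theta> + \<eta>) f"
proof -
  have "sshift \<theta> (sshift \<eta> f) = (\<Sum>i\<le>degree (left_poly f). sconst (coeff (left_poly f) i) *
      (svar + sconst \<theta> + sconst \<eta>) ^ i)"
    unfolding sshift_def[of \<eta>] seval_def
    by (simp add: sshift_sum sshift_mult sshift_power sshift_add)
  then show ?thesis
    by (simp add: sshift_def[of "\<theta> + \<eta>"] seval_def sconst_add add.assoc)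
qed

lemma sshift_zero [simp]: "sshift 0 f = f"
  by (simp add: sshift_def seval_svar)

lemma sshift_eq_0_iff [simp]: "sshift \<theta> f = 0 \<longleftrightarrow> f = 0"
  using sshift_sshift[of "- \<theta>" \<theta> f] by auto

lemma sshift_expansion:
  "f = (\<Sum>i\<le>degree (left_poly (sshift \<theta> f)).
     sconst (coeff (left_poly (sshift \<theta> f)) i) * (svar - sconst \<theta>) ^ i)"
proof -
  have "f = sshift (- \<theta>) (sshift \<theta> f)" by (simp add: sshift_sshift)
  then show ?thesis by (simp add: sshift_def[of "- \<theta>"] seval_def sconst_uminus)
qed

text \<open>Three instances occur: the Puiseux series, all generalized series, and the series with
  exponents in \<open>exps n\<close>. The last one keeps denominators bounded under shifts in the
  Newton--Puiseux argument.\<close>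

locale diff_subring =
  fixes S :: "'a::real_diff_field set"
  assumes of_real_mem: "of_real r \<in> S"
    and add_mem: "a \<in> S \<Longrightarrow> b \<in> S \<Longrightarrow> a + b \<in> S"
    and mult_mem: "a \<in> S \<Longrightarrow> b \<in> S \<Longrightarrow> a * b \<in> S"
    and der_mem: "a \<in> S \<Longrightarrow> der a \<in> S"
begin

lemma zero_mem: "0 \<in> S" and one_mem: "1 \<in> S"
  using of_real_mem[of 0] of_real_mem[of 1] by auto

lemma uminus_mem: "a \<in> S \<Longrightarrow> - a \<in> S"
  using mult_mem[OF of_real_mem[of "- 1"]] by simp

lemma skew_add: "f \<in> skew_polys S \<Longrightarrow> g \<in> skew_polys S \<Longrightarrow> f + g \<in> skew_polys S"
  by (simp add: skew_polys_def add_mem)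

lemma skew_sconst_iff: "sconst a \<in> skew_polys S \<longleftrightarrow> a \<in> S"
  by (force simp: skew_polys_def coeff_pCons zero_mem split: nat.split dest: spec[of _ 0])

lemma skew_svar: "svar \<in> skew_polys S"
  by (auto simp: skew_polys_def coeff_pCons zero_mem one_mem split: nat.split)

lemma skew_of_real: "of_real r \<in> skew_polys S"
  by (simp add: of_real_eq_sconst skew_sconst_iff of_real_mem)

lemma skew_0: "0 \<in> skew_polys S" and skew_1: "1 \<in> skew_polys S"
  using skew_of_real[of 0] skew_of_real[of 1] by auto

lemma skew_sum: "(\<And>i. i \<in> I \<Longrightarrow> f i \<in> skew_polys S) \<Longrightarrow> (\<Sum>i\<in>I. f i) \<in> skew_polys S"
  by (induction I rule: infinite_finite_induct) (auto simp: skew_add skew_0)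

lemma skew_sconst_mult: "a \<in> S \<Longrightarrow> f \<in> skew_polys S \<Longrightarrow> sconst a * f \<in> skew_polys S"
  by (simp add: skew_polys_def mult_mem)

lemma skew_svar_mult: "f \<in> skew_polys S \<Longrightarrow> svar * f \<in> skew_polys S"
  by (auto simp: skew_polys_def left_poly_svar_mult coeff_y_mult add_mem der_mem zero_mem split: nat.split)

lemma skew_mult:
  assumes f: "f \<in> skew_polys S" and g: "g \<in> skew_polys S" shows "f * g \<in> skew_polys S"
proof -
  have pw: "svar ^ i * g \<in> skew_polys S" for i
    by (induction i) (simp_all add: g mult.assoc skew_svar_mult)
  have "f * g = (\<Sum>i\<le>degree (left_poly f). sconst (coeff (left_poly f) i) * (svar ^ i * g))"
    by (subst seval_svar[of f, symmetric]) (simp add: seval_def sum_distrib_right mult.assoc)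
  also have "\<dots> \<in> skew_polys S"
    using f by (intro skew_sum skew_sconst_mult pw) (simp add: skew_polys_def)
  finally show ?thesis .
qed

lemma skew_power: "f \<in> skew_polys S \<Longrightarrow> f ^ i \<in> skew_polys S"
  by (induction i) (auto simp: skew_1 skew_mult)

lemma skew_uminus: "f \<in> skew_polys S \<Longrightarrow> - f \<in> skew_polys S"
  using skew_mult[OF skew_of_real[of "- 1"]] by simp

lemma skew_diff: "f \<in> skew_polys S \<Longrightarrow> g \<in> skew_polys S \<Longrightarrow> f - g \<in> skew_polys S"
  using skew_add[OF _ skew_uminus] by (metis diff_conv_add_uminus)

lemma skew_sshift:
  assumes "\<theta> \<in> S" "f \<in> skew_polys S" shows "sshift \<theta> f \<in> skew_polys S"
proof -
  have "svar + sconst \<theta> \<in> skew_polys S" using assms by (simp add: skew_add skew_svar skew_sconst_iff)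
  moreover have "coeff (left_poly f) i \<in> S" for i using assms by (simp add: skew_polys_def)
  ultimately show ?thesis
    unfolding sshift_def seval_def by (intro skew_sum skew_sconst_mult skew_power)
qed

end

lemma diff_subring_puiseux: "diff_subring puiseux"
  by unfold_locales (auto intro: puiseux_of_real puiseux_add puiseux_mult puiseux_der)

lemma diff_subring_UNIV: "diff_subring UNIV"
  by unfold_locales auto

lemma diff_subring_exps: "diff_subring {f. supp f \<subseteq> exps n}"
proof
  show "of_real r \<in> {f. supp f \<subseteq> exps n}" for r
    by (auto simp: gcoeff_of_real split: if_splits)
qed (simp_all add: supp_exps_add supp_exps_mult supp_exps_der del: gcoeff_add)

section \<open>Gauss valuations\<close>

text \<open>A positive cone on \<open>\<rat> \<times> \<int>\<close> extending the order of \<open>\<rat>\<close>.\<close>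

definition slope_cone :: "(rat \<Rightarrow> int \<Rightarrow> bool) \<Rightarrow> bool" where
  "slope_cone P \<longleftrightarrow> (\<forall>p i q j. P p i \<longrightarrow> P q j \<longrightarrow> P (p + q) (i + j)) \<and>
     (\<forall>q i. \<not> (P q i \<and> P (- q) (- i))) \<and>
     (\<forall>q. P q 0 \<longleftrightarrow> 0 < q) \<and> (\<forall>q. P q 1 \<or> P (- q) (- 1))"

lemma slope_cone_scale:
  assumes "slope_cone P" "P q i" shows "P (of_nat (Suc n) * q) (int (Suc n) * i)"
proof (induction n)
  case 0
  then show ?case using assms by simp
next
  case (Suc n)
  then have "P (of_nat (Suc n) * q + q) (int (Suc n) * i + i)"
    using assms unfolding slope_cone_def by blast
  then show ?case by (simp add: algebra_simps)
qed

text \<open>The pair (q, i) is the i-fold multiple of (q/i, 1), and a cone is closed under positive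
  multiples. Hence the sign of (q, i) is that of (q/i, 1).\<close>

lemma slope_cone_iff:
  assumes P: "slope_cone P" and i: "0 < i"
  shows "P q i \<longleftrightarrow> P (q / of_int i) 1" and "P q i \<or> P (- q) (- i)"
proof -
  obtain n where n: "i = int (Suc n)" using zero_less_imp_eq_int[OF i] by (metis gr0_implies_Suc)
  have e: "of_nat (Suc n) * (q / of_int i) = q" by (simp add: n)
  have 1: "P q i" if "P (q / of_int i) 1"
    using slope_cone_scale[OF P that, of n] unfolding e n by (simp del: of_nat_Suc)
  have 2: "P (- q) (- i)" if "P (- (q / of_int i)) (- 1)"
    using slope_cone_scale[OF P that, of n] unfolding mult_minus_right e n by (simp del: of_nat_Suc)
  have "P (q / of_int i) 1 \<or> P (- (q / of_int i)) (- 1)" "\<not> (P q i \<and> P (- q) (- i))"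
    using P unfolding slope_cone_def by blast+
  with 1 2 show "P q i \<longleftrightarrow> P (q / of_int i) 1" "P q i \<or> P (- q) (- i)" by blast+
qed

lemma slope_cone_total:
  assumes P: "slope_cone P" and nz: "q \<noteq> 0 \<or> i \<noteq> 0"
  shows "P q i \<or> P (- q) (- i)"
proof -
  consider "i = 0" | "0 < i" | "0 < - i" by linarith
  then show ?thesis
  proof cases
    case 1
    have "P q 0 \<longleftrightarrow> 0 < q" "P (- q) 0 \<longleftrightarrow> 0 < - q" using P unfolding slope_cone_def by blast+
    then show ?thesis using nz 1 by (simp add: neq_iff disj_commute)
  next
    case 2
    then show ?thesis by (rule slope_cone_iff(2)[OF P])
  next
    case 3
    then show ?thesis using slope_cone_iff(2)[OF P 3, of "- q"] by (simp add: disj_commute)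
  qed
qed

text \<open>A cone is determined by its cut, the set of \<open>q\<close> with \<open>P q 1\<close>.
  This reduces the comparison of two ordered value groups to the comparison of two cuts in the
  rationals.\<close>

lemma slope_cone_eq:
  assumes P: "slope_cone P" and Q: "slope_cone Q" and eq: "\<And>q. P q 1 \<longleftrightarrow> Q q 1"
  shows "P q i \<longleftrightarrow> Q q i"
proof -
  have pos: "P q i \<longleftrightarrow> Q q i" if "0 < i" for q i
    using slope_cone_iff(1)[OF P that] slope_cone_iff(1)[OF Q that] eq by blast
  consider "i = 0" | "0 < i" | "0 < - i" by linarith
  then show ?thesis
  proof cases
    case 1
    have "P q 0 \<longleftrightarrow> 0 < q" "Q q 0 \<longleftrightarrow> 0 < q" using P Q unfolding slope_cone_def by blast+
    then show ?thesis by (simp add: 1)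
  next
    case 2
    then show ?thesis by (rule pos)
  next
    case 3
    have "\<not> (P q i \<and> P (- q) (- i))" "\<not> (Q q i \<and> Q (- q) (- i))"
      using P Q unfolding slope_cone_def by blast+
    moreover have "P q i \<or> P (- q) (- i)" "Q q i \<or> Q (- q) (- i)"
      using slope_cone_total[OF P, of q i] slope_cone_total[OF Q, of q i] 3 by simp_all
    ultimately show ?thesis using pos[OF 3, of "- q"] by blast
  qed
qed

lemma add_eq_add_imp_eq:
  fixes a b c d :: "'v::linordered_ab_group_add"
  assumes "a + b = c + d" "c \<le> a" "d \<le> b" shows "a = c" "b = d"
  using assms by (metis add_less_le_mono less_irrefl order_le_less add.commute)+

text \<open>The monomial x^-q y^i is to have weight \<open>\<rho> q + \<kappa> i\<close>. The locale
  serves twice: with generic weights for the extension, and with weights in the rationals themselves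
  for the Newton--Puiseux argument.\<close>

locale gauss_weights =
  fixes \<rho> :: "rat \<Rightarrow> 'v::linordered_ab_group_add" and \<kappa> :: "int \<Rightarrow> 'v"
  assumes rho_add: "\<rho> (p + q) = \<rho> p + \<rho> q"
    and rho_strict: "p < q \<Longrightarrow> \<rho> p < \<rho> q"
    and kappa_add: "\<kappa> (i + j) = \<kappa> i + \<kappa> j"
    and kappa_1: "\<kappa> 1 < \<rho> 1"
begin

lemma rho_0 [simp]: "\<rho> 0 = 0" and kappa_0 [simp]: "\<kappa> 0 = 0"
  using rho_add[of 0 0] kappa_add[of 0 0] by simp_all

lemma rho_minus: "\<rho> (- q) = - \<rho> q" and kappa_minus: "\<kappa> (- i) = - \<kappa> i"
  using rho_add[of q "- q"] kappa_add[of i "- i"] by (simp_all add: eq_neg_iff_add_eq_0 add.commute)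

lemma rho_less_iff [simp]: "\<rho> p < \<rho> q \<longleftrightarrow> p < q"
  using rho_strict[of p q] rho_strict[of q p] by (cases p q rule: linorder_cases) auto

lemma rho_le_iff [simp]: "\<rho> p \<le> \<rho> q \<longleftrightarrow> p \<le> q"
  by (simp add: not_less[symmetric])

lemma rho_eq_iff [simp]: "\<rho> p = \<rho> q \<longleftrightarrow> p = q"
  by (simp add: order_eq_iff)

lemma rho_diff: "\<rho> (p - q) = \<rho> p - \<rho> q"
  using rho_add[of p "- q"] by (simp add: rho_minus)

lemma kappa_diff: "\<kappa> (i - j) = \<kappa> i - \<kappa> j"
  using kappa_add[of i "- j"] by (simp add: kappa_minus)

text \<open>A weight \<mu> need not be the value of a power of x; the coefficient is then 0. This
  lets \<open>symb\<close> take the coefficient at \<open>M - \<kappa> (int i)\<close> for every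
  \<open>i\<close>.\<close>

definition coeff_at :: "'v \<Rightarrow> gseries \<Rightarrow> real" where
  "coeff_at \<mu> b = (if \<mu> \<in> range \<rho> then gcoeff b (inv_into UNIV \<rho> \<mu>) else 0)"

lemma coeff_at_rho [simp]: "coeff_at (\<rho> q) b = gcoeff b q"
proof -
  have "inj \<rho>" by (rule injI) simp
  then show ?thesis by (simp add: coeff_at_def inv_into_f_f)
qed

lemma coeff_at_notin: "\<mu> \<notin> range \<rho> \<Longrightarrow> coeff_at \<mu> b = 0"
  by (simp add: coeff_at_def)

lemma coeff_at_0 [simp]: "coeff_at \<mu> 0 = 0"
  by (simp add: coeff_at_def)

lemma coeff_at_add: "coeff_at \<mu> (a + b) = coeff_at \<mu> a + coeff_at \<mu> b"
  by (simp add: coeff_at_def)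

lemma coeff_at_neq_0D:
  assumes "coeff_at \<mu> b \<noteq> 0" shows "\<exists>q. \<mu> = \<rho> q \<and> gcoeff b q \<noteq> 0"
proof -
  have "\<mu> \<in> range \<rho>" using assms by (auto simp: coeff_at_def split: if_splits)
  then show ?thesis using assms by auto
qed

text \<open>If all exponents of \<open>b\<close> and \<open>c\<close> have values at least \<mu> and
  \<nu>, two of them can add up to \<mu> + \<nu> only when both bounds are attained. So the
  convolution has at most one term.\<close>

lemma coeff_at_mult:
  assumes b: "\<And>q. gcoeff b q \<noteq> 0 \<Longrightarrow> \<mu> \<le> \<rho> q" and c: "\<And>q. gcoeff c q \<noteq> 0 \<Longrightarrow> \<nu> \<le> \<rho> q"
  shows "coeff_at (\<mu> + \<nu>) (b * c) = coeff_at \<mu> b * coeff_at \<nu> c"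
proof (cases "\<mu> + \<nu> \<in> range \<rho>")
  case False
  have "coeff_at \<mu> b * coeff_at \<nu> c = 0"
  proof (rule ccontr)
    assume "coeff_at \<mu> b * coeff_at \<nu> c \<noteq> 0"
    then obtain p q where "\<mu> = \<rho> p" "\<nu> = \<rho> q"
      using coeff_at_neq_0D by (metis mult_zero_left mult_zero_right)
    then show False using False rho_add by (metis rangeI)
  qed
  then show ?thesis using False by (simp add: coeff_at_notin)
next
  case True
  then obtain s where s: "\<mu> + \<nu> = \<rho> s" by blast
  have key: "\<mu> = \<rho> p \<and> \<nu> = \<rho> (s - p)" if "gcoeff b p \<noteq> 0 \<and> gcoeff c (s - p) \<noteq> 0" for p
    using add_eq_add_imp_eq[of "\<rho> p" "\<rho> (s - p)" \<mu> \<nu>] b[of p] c[of "s - p"] that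
    by (simp add: s rho_diff)
  show ?thesis
  proof (cases "\<mu> \<in> range \<rho>")
    case True
    then obtain p where p: "\<mu> = \<rho> p" by blast
    then have n: "\<nu> = \<rho> (s - p)" using s by (simp add: rho_diff algebra_simps)
    have "gcoeff (b * c) s = (\<Sum>a\<in>{p}. gcoeff b a * gcoeff c (s - a))"
      using key p by (intro gcoeff_mult_superset) auto
    moreover have "\<rho> p + \<rho> (s - p) = \<rho> s" using s p n by simp
    ultimately show ?thesis by (simp add: p n)
  next
    case False
    have e: "{a. gcoeff b a \<noteq> 0 \<and> gcoeff c (s - a) \<noteq> 0} = {}" using key False by blast
    have "gcoeff (b * c) s = 0" unfolding gcoeff_mult e by simp
    then show ?thesis using False s by (simp add: coeff_at_notin)
  qed
qed

text \<open>A lower bound instead of a least weight: the zero polynomial satisfies it for every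
  \<open>M\<close>, so sums need no case distinctions.\<close>

definition weight_ge :: "'v \<Rightarrow> gseries poly \<Rightarrow> bool" where
  "weight_ge M p \<longleftrightarrow> (\<forall>i a. gcoeff (coeff p i) a \<noteq> 0 \<longrightarrow> M \<le> \<rho> a + \<kappa> (int i))"

text \<open>The terms of weight \<open>M\<close>, as a polynomial in the symbol of \<open>y\<close>. Since \<open>\<kappa> 1 < \<rho> 1\<close>, the derivation
  strictly increases weights relative to multiplication by \<open>y\<close>, so symbols multiply commutatively.\<close>

definition symb :: "'v \<Rightarrow> gseries poly \<Rightarrow> real poly" where
  "symb M p = (\<Sum>i\<le>degree p. monom (coeff_at (M - \<kappa> (int i)) (coeff p i)) i)"

lemma coeff_symb: "coeff (symb M p) i = coeff_at (M - \<kappa> (int i)) (coeff p i)"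
  by (auto simp: symb_def coeff_sum coeff_eq_0 if_distrib cong: if_cong)

lemma weight_geD: "weight_ge M p \<Longrightarrow> gcoeff (coeff p i) a \<noteq> 0 \<Longrightarrow> M - \<kappa> (int i) \<le> \<rho> a"
  by (auto simp: weight_ge_def diff_le_eq)

lemma weight_ge_0 [simp]: "weight_ge M 0"
  by (simp add: weight_ge_def)

lemma symb_0 [simp]: "symb M 0 = 0"
  by (rule poly_eqI) (simp add: coeff_symb)

lemma weight_ge_add: "weight_ge M p \<Longrightarrow> weight_ge M q \<Longrightarrow> weight_ge M (p + q)"
  by (simp add: weight_ge_def) (metis add_0)

lemma symb_add: "symb M (p + q) = symb M p + symb M q"
  by (rule poly_eqI) (simp add: coeff_symb coeff_at_add)

lemma weight_ge_sum: "(\<And>i. i \<in> I \<Longrightarrow> weight_ge M (f i)) \<Longrightarrow> weight_ge M (\<Sum>i\<in>I. f i)"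
  by (induction I rule: infinite_finite_induct) (auto intro: weight_ge_add)

lemma symb_sum: "symb M (\<Sum>i\<in>I. f i) = (\<Sum>i\<in>I. symb M (f i))"
  by (induction I rule: infinite_finite_induct) (auto simp: symb_add)

lemma weight_ge_smult:
  assumes b: "\<And>a. gcoeff b a \<noteq> 0 \<Longrightarrow> \<mu> \<le> \<rho> a" and p: "weight_ge M p"
  shows "weight_ge (\<mu> + M) (smult b p)"
  unfolding weight_ge_def
proof (intro allI impI)
  fix i a assume "gcoeff (coeff (smult b p) i) a \<noteq> 0"
  then obtain c d where "a = c + d" "gcoeff b c \<noteq> 0" "gcoeff (coeff p i) d \<noteq> 0"
    using supp_mult[of b "coeff p i"] by auto
  then show "\<mu> + M \<le> \<rho> a + \<kappa> (int i)"
    using b[of c] p by (auto simp: weight_ge_def rho_add add.assoc intro: add_mono)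
qed

lemma symb_smult:
  assumes b: "\<And>a. gcoeff b a \<noteq> 0 \<Longrightarrow> \<mu> \<le> \<rho> a" and p: "weight_ge M p"
  shows "symb (\<mu> + M) (smult b p) = smult (coeff_at \<mu> b) (symb M p)"
proof (rule poly_eqI)
  fix i
  have "coeff_at (\<mu> + (M - \<kappa> (int i))) (b * coeff p i) = coeff_at \<mu> b * coeff_at (M - \<kappa> (int i)) (coeff p i)"
    by (rule coeff_at_mult) (use b weight_geD[OF p] in auto)
  then show "coeff (symb (\<mu> + M) (smult b p)) i = coeff (smult (coeff_at \<mu> b) (symb M p)) i"
    by (simp add: coeff_symb add_diff_eq)
qed

lemma weight_der_less:
  assumes "weight_ge M p" "gcoeff (der (coeff p i)) a \<noteq> 0"
  shows "M + \<kappa> 1 < \<rho> a + \<kappa> (int i)"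
proof -
  have "gcoeff (coeff p i) (a - 1) \<noteq> 0" using assms(2) by (auto simp: gcoeff_der)
  then have "M \<le> \<rho> (a - 1) + \<kappa> (int i)" using assms(1) by (auto simp: weight_ge_def)
  then have "M + \<rho> 1 \<le> \<rho> a + \<kappa> (int i)" by (simp add: rho_diff algebra_simps)
  then show ?thesis using kappa_1 by (meson add_strict_left_mono less_le_trans)
qed

lemma weight_ge_y_mult: "weight_ge M p \<Longrightarrow> weight_ge (M + \<kappa> 1) (y_mult p)"
  unfolding weight_ge_def[of "M + \<kappa> 1"]
proof (intro allI impI)
  fix i a assume p: "weight_ge M p" and nz: "gcoeff (coeff (y_mult p) i) a \<noteq> 0"
  show "M + \<kappa> 1 \<le> \<rho> a + \<kappa> (int i)"
  proof (cases "gcoeff (der (coeff p i)) a = 0")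
    case False
    then show ?thesis using weight_der_less[OF p] by (simp add: less_imp_le)
  next
    case True
    then obtain j where j: "i = Suc j" "gcoeff (coeff p j) a \<noteq> 0"
      using nz by (auto simp: coeff_y_mult split: nat.splits)
    then have "M \<le> \<rho> a + \<kappa> (int j)" using p by (auto simp: weight_ge_def)
    moreover have "\<kappa> (int i) = \<kappa> (int j) + \<kappa> 1" by (simp add: j(1) kappa_add[symmetric] add.commute)
    ultimately show ?thesis by (simp add: add.assoc[symmetric])
  qed
qed

lemma symb_y_mult: 
  assumes p: "weight_ge M p" shows "symb (M + \<kappa> 1) (y_mult p) = pCons 0 (symb M p)"
proof (rule poly_eqI)
  fix i
  have "coeff_at (M + \<kappa> 1 - \<kappa> (int i)) (der (coeff p i)) = 0"
  proof (rule ccontr)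
    assume "coeff_at (M + \<kappa> 1 - \<kappa> (int i)) (der (coeff p i)) \<noteq> 0"
    then obtain q where "M + \<kappa> 1 - \<kappa> (int i) = \<rho> q" "gcoeff (der (coeff p i)) q \<noteq> 0"
      using coeff_at_neq_0D by blast
    then show False using weight_der_less[OF p, of i q] by (simp add: algebra_simps)
  qed
  moreover have e: "M + \<kappa> 1 - \<kappa> (int (Suc j)) = M - \<kappa> (int j)" for j
    using kappa_add[of 1 "int j"] by (simp add: algebra_simps)
  ultimately show "coeff (symb (M + \<kappa> 1) (y_mult p)) i = coeff (pCons 0 (symb M p)) i"
    by (cases i) (simp_all only: coeff_symb coeff_y_mult coeff_at_add coeff_pCons nat.case e
        coeff_at_0 add_0 add_0_right)
qed

lemma weight_ge_skew_mult_aux: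
  assumes "weight_ge N q"
  shows "weight_ge (N + \<kappa> (int i)) ((y_mult ^^ i) q) \<and>
    symb (N + \<kappa> (int i)) ((y_mult ^^ i) q) = monom 1 i * symb N q"
proof (induction i)
  case 0
  then show ?case using assms by simp
next
  case (Suc i)
  have e: "N + \<kappa> (int (Suc i)) = N + \<kappa> (int i) + \<kappa> 1"
    using kappa_add[of "int i" 1] by (simp add: add.commute add.left_commute)
  show ?case
    unfolding e using weight_ge_y_mult[of "N + \<kappa> (int i)"] symb_y_mult[of "N + \<kappa> (int i)"] Suc
    by (simp add: monom_Suc)
qed

lemma symb_skew_mult:
  assumes p: "weight_ge M p" and q: "weight_ge N q"
  shows "weight_ge (M + N) (skew_mult p q)" "symb (M + N) (skew_mult p q) = symb M p * symb N q"
proof -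
  \<comment> \<open>The weight is split between the coefficient of y^i in \<open>p\<close> and the
    product y^i \<open>q\<close>, so that all summands of \<open>skew_mult p q\<close> are compared
    at the same total weight.\<close>
  have e: "M + N = (M - \<kappa> (int i)) + (N + \<kappa> (int i))" for i by simp
  have "weight_ge (M + N) (smult (coeff p i) ((y_mult ^^ i) q))" for i
    unfolding e[of i] by (rule weight_ge_smult)
      (use weight_geD[OF p] weight_ge_skew_mult_aux[OF q] in auto)
  then show "weight_ge (M + N) (skew_mult p q)"
    unfolding skew_mult_def by (intro weight_ge_sum)
  have "symb (M + N) (smult (coeff p i) ((y_mult ^^ i) q))
      = monom (coeff_at (M - \<kappa> (int i)) (coeff p i)) i * symb N q" for i
    unfolding e[of i]
    by (subst symb_smult) (use weight_geD[OF p] weight_ge_skew_mult_aux[OF q, of i] in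
        \<open>auto simp: mult_smult_left[symmetric] smult_monom\<close>)
  then show "symb (M + N) (skew_mult p q) = symb M p * symb N q"
    by (simp add: skew_mult_def symb_sum sum_distrib_right symb_def[of M p])
qed

section \<open>The Gauss valuation as the least weight of a term\<close>

definition weight :: "gseries poly \<Rightarrow> 'v" where
  "weight p = Min ((\<lambda>i. \<rho> (gord (coeff p i)) + \<kappa> (int i)) ` {i. coeff p i \<noteq> 0})"

lemma finite_coeff_neq_0: "finite {i. coeff p i \<noteq> 0}"
  by (rule finite_subset[of _ "{..degree p}"]) (auto intro: le_degree)

lemma weight_ge_weight: "weight_ge (weight p) p"
  unfolding weight_ge_def
proof (intro allI impI)
  fix i a assume a: "gcoeff (coeff p i) a \<noteq> 0"
  then have nz: "coeff p i \<noteq> 0" by auto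
  then have "weight p \<le> \<rho> (gord (coeff p i)) + \<kappa> (int i)"
    unfolding weight_def using finite_coeff_neq_0 by (intro Min_le) auto
  also have "\<dots> \<le> \<rho> a + \<kappa> (int i)" using gord(2)[OF nz a] by simp
  finally show "weight p \<le> \<rho> a + \<kappa> (int i)" .
qed

lemma weight_attained:
  assumes "p \<noteq> 0" obtains i where "coeff p i \<noteq> 0" "weight p = \<rho> (gord (coeff p i)) + \<kappa> (int i)"
proof -
  have "{i. coeff p i \<noteq> 0} \<noteq> {}" using assms by (auto simp: poly_eq_iff)
  then have "weight p \<in> (\<lambda>i. \<rho> (gord (coeff p i)) + \<kappa> (int i)) ` {i. coeff p i \<noteq> 0}"
    unfolding weight_def using finite_coeff_neq_0 by (intro Min_in) auto
  then show ?thesis using that by auto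
qed

lemma weight_ge_iff:
  assumes "p \<noteq> 0" shows "weight_ge M p \<longleftrightarrow> M \<le> weight p"
proof
  assume M: "weight_ge M p"
  obtain i where "coeff p i \<noteq> 0" "weight p = \<rho> (gord (coeff p i)) + \<kappa> (int i)"
    using weight_attained[OF assms] .
  then show "M \<le> weight p" using M gord(1) by (auto simp: weight_ge_def)
next
  assume "M \<le> weight p"
  then show "weight_ge M p"
    using weight_ge_weight[of p] unfolding weight_ge_def by (meson order_trans)
qed

lemma symb_weight_neq_0:
  assumes "p \<noteq> 0" shows "symb (weight p) p \<noteq> 0"
proof -
  obtain i where i: "coeff p i \<noteq> 0" "weight p = \<rho> (gord (coeff p i)) + \<kappa> (int i)"
    using weight_attained[OF assms] .
  then have "coeff (symb (weight p) p) i \<noteq> 0" using gord(1) by (simp add: coeff_symb)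
  then show ?thesis by auto
qed

lemma weight_eqI:
  assumes "weight_ge M p" "symb M p \<noteq> 0" shows "weight p = M"
proof -
  obtain i where "coeff (symb M p) i \<noteq> 0" using assms(2) by (auto simp: poly_eq_iff)
  then obtain a where a: "M - \<kappa> (int i) = \<rho> a" "gcoeff (coeff p i) a \<noteq> 0"
    using coeff_at_neq_0D unfolding coeff_symb by blast
  have p: "p \<noteq> 0" using a by auto
  have "weight p \<le> \<rho> a + \<kappa> (int i)" using weight_ge_weight[of p] a(2) by (auto simp: weight_ge_def)
  also have "\<dots> = M" using a(1) by (simp add: algebra_simps)
  finally show ?thesis using weight_ge_iff[OF p] assms(1) by (simp add: order_antisym)
qed

text \<open>The symbols at the least weights are nonzero and \<open>real poly\<close> is an integral
  domain, so their product is a nonzero symbol of the skew product.\<close>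

lemma weight_skew_mult:
  assumes "p \<noteq> 0" "q \<noteq> 0" shows "weight (skew_mult p q) = weight p + weight q"
  using symb_skew_mult[OF weight_ge_weight weight_ge_weight, of p q] symb_weight_neq_0 assms
  by (intro weight_eqI) auto

lemma weight_add:
  assumes "p \<noteq> 0" "q \<noteq> 0" "p + q \<noteq> 0" shows "min (weight p) (weight q) \<le> weight (p + q)"
  using assms by (auto simp: weight_ge_iff[symmetric] intro!: weight_ge_add) (simp_all add: weight_ge_iff)

lemma weight_const: "b \<noteq> 0 \<Longrightarrow> weight [:b:] = \<rho> (gord b)"
proof -
  assume b: "b \<noteq> 0"
  have "coeff [:b:] i \<noteq> 0 \<longleftrightarrow> i = 0" for i using b by (cases i) auto
  then have "{i. coeff [:b:] i \<noteq> 0} = {0}" by blast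
  then show ?thesis by (simp add: weight_def)
qed

end

text \<open>Since \<open>\<rat>\<close> is divisible, the assumption makes the weights of distinct monomials distinct.\<close>

locale generic_weights = gauss_weights \<rho> \<kappa>
  for \<rho> :: "rat \<Rightarrow> 'v::linordered_ab_group_add" and \<kappa> :: "int \<Rightarrow> 'v" +
  assumes kappa_1_neq: "\<kappa> 1 \<noteq> \<rho> q"
begin

text \<open>Totality at i = 1 is exactly the genericity assumption:
  \<open>\<rho> q + \<kappa> 1\<close> never vanishes.\<close>

lemma slope_cone_weights: "slope_cone (\<lambda>q i. 0 < \<rho> q + \<kappa> i)"
  unfolding slope_cone_def
proof (intro conjI allI impI)
  fix q
  have "\<rho> q + \<kappa> 1 \<noteq> 0" using kappa_1_neq[of "- q"] by (simp add: rho_minus eq_neg_iff_add_eq_0 add.commute)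
  moreover have "\<rho> (- q) + \<kappa> (- 1) = - (\<rho> q + \<kappa> 1)" by (simp add: rho_minus kappa_minus)
  ultimately show "0 < \<rho> q + \<kappa> 1 \<or> 0 < \<rho> (- q) + \<kappa> (- 1)"
    by (simp only: neg_0_less_iff_less neq_iff) blast
next
  fix p q i j assume "0 < \<rho> p + \<kappa> i" "0 < \<rho> q + \<kappa> j"
  then have "0 < (\<rho> p + \<kappa> i) + (\<rho> q + \<kappa> j)" by (rule add_pos_pos)
  then show "0 < \<rho> (p + q) + \<kappa> (i + j)" by (simp add: rho_add kappa_add algebra_simps)
next
  fix q i
  have "\<rho> (- q) + \<kappa> (- i) = - (\<rho> q + \<kappa> i)" by (simp add: rho_minus kappa_minus)
  then show "\<not> (0 < \<rho> q + \<kappa> i \<and> 0 < \<rho> (- q) + \<kappa> (- i))"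
    by (metis less_asym neg_0_less_iff_less)
next
  fix q show "0 < \<rho> q + \<kappa> 0 \<longleftrightarrow> 0 < q" using rho_less_iff[of 0 q] by simp
qed

lemma weights_eq_iff: "\<rho> p + \<kappa> i = \<rho> q + \<kappa> j \<longleftrightarrow> p = q \<and> i = j"
proof
  assume e: "\<rho> p + \<kappa> i = \<rho> q + \<kappa> j"
  then have z: "\<rho> (p - q) + \<kappa> (i - j) = 0" by (simp add: rho_diff kappa_diff algebra_simps)
  then have z': "\<rho> (- (p - q)) + \<kappa> (- (i - j)) = 0" unfolding rho_minus kappa_minus
    by (metis add.inverse_distrib_swap add.commute add.inverse_neutral)
  show "p = q \<and> i = j"
    using slope_cone_total[OF slope_cone_weights, of "p - q" "i - j"] z z' by auto
qed auto

text \<open>Distinct monomials have distinct weights, so at a given weight all symbols are real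
  multiples of one power of the variable. A real multiple of \<open>q\<close> therefore cancels the
  leading term of \<open>p\<close>; this is what keeps the residue field real.\<close>

lemma weight_residue:
  assumes nz: "p \<noteq> 0" "q \<noteq> 0" and eq: "weight p = weight q"
  shows "\<exists>r. p = smult (of_real r) q \<or> weight q < weight (p - smult (of_real r) q)"
proof -
  define M where "M = weight q"
  obtain i where i: "coeff q i \<noteq> 0" "M = \<rho> (gord (coeff q i)) + \<kappa> (int i)"
    using weight_attained[OF nz(2)] unfolding M_def by blast
  have only: "coeff (symb M f) j = 0" if "j \<noteq> i" for f j
  proof (rule ccontr)
    assume "coeff (symb M f) j \<noteq> 0"
    then obtain a where "M - \<kappa> (int j) = \<rho> a" using coeff_at_neq_0D unfolding coeff_symb by blast
    then have "\<rho> a + \<kappa> (int j) = \<rho> (gord (coeff q i)) + \<kappa> (int i)" using i by (simp add: algebra_simps)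
    then show False using that by (simp add: weights_eq_iff)
  qed
  define c where "c = coeff (symb M q) i"
  have c: "c \<noteq> 0" using i gord(1) by (simp add: c_def coeff_symb)
  define r where "r = coeff (symb M p) i / c"
  define s where "s = smult (of_real (- r)) q"
  have pw: "weight_ge M p" "weight_ge M q" using weight_ge_weight M_def eq by metis+
  have sup0: "0 \<le> \<rho> a" if "gcoeff (of_real (- r)) a \<noteq> 0" for a
    using that by (auto simp: gcoeff_of_real split: if_splits)
  have "weight_ge (0 + M) s" "symb (0 + M) s = smult (coeff_at 0 (of_real (- r))) (symb M q)"
    unfolding s_def using weight_ge_smult[OF sup0 pw(2)] symb_smult[OF sup0 pw(2)] by blast+
  moreover have "coeff_at 0 (of_real (- r)) = - r"
    using coeff_at_rho[of 0 "of_real (- r)"] by (simp add: gcoeff_of_real del: of_real_minus)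
  ultimately have s: "weight_ge M s" "symb M s = smult (- r) (symb M q)" by auto
  have "symb M (p + s) = 0"
  proof (rule poly_eqI)
    fix j show "coeff (symb M (p + s)) j = coeff 0 j"
      using c only[of j] by (cases "j = i") (auto simp: symb_add s r_def c_def)
  qed
  moreover have "weight_ge M (p + s)" using pw s by (intro weight_ge_add)
  ultimately have "p + s = 0 \<or> M < weight (p + s)"
    using weight_ge_iff symb_weight_neq_0 by (metis order_le_less)
  moreover have "p + s = p - smult (of_real r) q" by (simp add: s_def)
  ultimately show ?thesis unfolding M_def by (intro exI[of _ r]) auto
qed

end

section \<open>Residue fields and quotient division rings\<close>

lemma subring_of_type_ring:
  fixes B :: "'a::ring_1 set"
  assumes "0 \<in> B" "1 \<in> B" "\<And>a b. a \<in> B \<Longrightarrow> b \<in> B \<Longrightarrow> a + b \<in> B"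
    "\<And>a. a \<in> B \<Longrightarrow> - a \<in> B" "\<And>a b. a \<in> B \<Longrightarrow> b \<in> B \<Longrightarrow> a * b \<in> B"
  shows "ring (ring_of_type_algebra\<lparr>carrier := B\<rparr>)"
  unfolding ring_of_type_algebra_def
  by unfold_locales (use assms in \<open>auto simp: algebra_simps Units_def intro!: bexI[of _ "- _"]\<close>)

text \<open>Reduces the residue field condition to an elementwise one: modulo \<open>J\<close> every
  element of \<open>B\<close> is a real number (\<open>res\<close>, surjectivity), and
  \<open>J\<close> contains no nonzero real (injectivity).\<close>

lemma real_coset_iso:
  fixes B J :: "'a::real_algebra_1 set"
  defines "R \<equiv> ring_of_type_algebra\<lparr>carrier := B\<rparr>"
  assumes real: "\<And>r. of_real r \<in> B" "\<And>r. r \<noteq> 0 \<Longrightarrow> of_real r \<notin> J"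
    and B: "\<And>a b. a \<in> B \<Longrightarrow> b \<in> B \<Longrightarrow> a + b \<in> B" "\<And>a b. a \<in> B \<Longrightarrow> b \<in> B \<Longrightarrow> a * b \<in> B"
    and J: "J \<subseteq> B" "\<And>a b. a \<in> J \<Longrightarrow> b \<in> J \<Longrightarrow> a + b \<in> J"
      "\<And>a b. a \<in> J \<Longrightarrow> b \<in> B \<Longrightarrow> a * b \<in> J" "\<And>a b. a \<in> J \<Longrightarrow> b \<in> B \<Longrightarrow> b * a \<in> J"
    and res: "\<And>a. a \<in> B \<Longrightarrow> \<exists>r. a - of_real r \<in> J"
  shows "(\<lambda>r. J +>\<^bsub>R\<^esub> of_real r) \<in> ring_iso (ring_of_type_algebra :: real ring) (R Quot J)"
proof -
  have negB: "- a \<in> B" if "a \<in> B" for a using B(2)[OF real(1)[of "- 1"] that] by simp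
  have negJ: "- a \<in> J" if "a \<in> J" for a using J(4)[OF that real(1)[of "- 1"]] by simp
  have zero: "0 \<in> J"
  proof -
    have "0 \<in> B" using real(1)[of 0] by simp
    \<comment> \<open>That 0 lies in \<open>J\<close> is extracted from \<open>res\<close>: some
      real number lies there, and it cannot be nonzero.\<close>
    then obtain r where "0 - of_real r \<in> J" using res by blast
    then have "of_real (- r) \<in> J" by simp
    then show ?thesis using real(2)[of "- r"] by (cases "r = 0") auto
  qed
  have R: "ring R"
    unfolding R_def by (rule subring_of_type_ring)
      (use zero J(1) B negB real(1)[of 1] in auto)
  interpret R: ring R by (rule R)
  have minus: "\<ominus>\<^bsub>R\<^esub> k = - k" if "k \<in> B" for k
  proof -
    have "\<ominus>\<^bsub>R\<^esub> k \<oplus>\<^bsub>R\<^esub> k = \<zero>\<^bsub>R\<^esub>" using that by (intro R.l_neg) (simp add: R_def)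
    then show ?thesis by (simp add: R_def ring_of_type_algebra_def eq_neg_iff_add_eq_0)
  qed
  have "ideal J R"
  proof (rule idealI[OF R])
    show "subgroup J (add_monoid R)"
    proof (rule R.add.subgroupI)
      fix a assume a: "a \<in> J"
      then show "\<ominus>\<^bsub>R\<^esub> a \<in> J" using J(1) minus[of a] negJ by auto
    qed (use zero J in \<open>auto simp: R_def ring_of_type_algebra_def\<close>)
  qed (use J in \<open>auto simp: R_def ring_of_type_algebra_def\<close>)
  then interpret J: ideal J R .
  have coset: "J +>\<^bsub>R\<^esub> a = {h + a | h. h \<in> J}" for a
    by (auto simp: a_r_coset_def r_coset_def R_def ring_of_type_algebra_def)
  have sub: "h - k \<in> J" if "h \<in> J" "k \<in> J" for h k
    using J(2)[OF that(1) negJ[OF that(2)]] by simp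
  have eq: "J +>\<^bsub>R\<^esub> a = J +>\<^bsub>R\<^esub> b \<longleftrightarrow> a - b \<in> J" for a b
  proof
    assume e: "J +>\<^bsub>R\<^esub> a = J +>\<^bsub>R\<^esub> b"
    have "0 + a \<in> J +>\<^bsub>R\<^esub> a" unfolding coset[of a] using zero by blast
    then have "0 + a \<in> {h + b | h. h \<in> J}" unfolding e coset[of b] .
    then show "a - b \<in> J" by auto
  next
    assume ab: "a - b \<in> J"
    show "J +>\<^bsub>R\<^esub> a = J +>\<^bsub>R\<^esub> b"
      unfolding coset
    proof safe
      fix h assume "h \<in> J"
      then have "h + (a - b) \<in> J" using ab by (rule J(2))
      moreover have "h + a = (h + (a - b)) + b" by simp
      ultimately show "\<exists>h'. h + a = h' + b \<and> h' \<in> J" by blast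
    next
      fix h assume "h \<in> J"
      then have "h - (a - b) \<in> J" using ab by (rule sub)
      moreover have "h + b = (h - (a - b)) + a" by simp
      ultimately show "\<exists>h'. h + b = h' + a \<and> h' \<in> J" by blast
    qed
  qed
  have hom: "(\<lambda>r. J +>\<^bsub>R\<^esub> of_real r) \<in> ring_hom (ring_of_type_algebra :: real ring) (R Quot J)"
  proof -
    have "(of_real :: real \<Rightarrow> 'a) \<in> ring_hom (ring_of_type_algebra :: real ring) R"
      by (rule ring_hom_memI) (use real in \<open>auto simp: R_def ring_of_type_algebra_def\<close>)
    from ring_hom_trans[OF this J.rcos_ring_hom] show ?thesis by (simp add: comp_def)
  qed
  have "inj (\<lambda>r. J +>\<^bsub>R\<^esub> of_real r)"
  proof (rule injI)
    fix r s assume "J +>\<^bsub>R\<^esub> of_real r = J +>\<^bsub>R\<^esub> of_real s"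
    then have "of_real (r - s) \<in> J" using eq by simp
    then show "r = s" using real(2)[of "r - s"] by auto
  qed
  moreover have "carrier (R Quot J) = (\<lambda>a. J +>\<^bsub>R\<^esub> a) ` B"
    by (auto simp: FactRing_def A_RCOSETS_def' R_def)
  moreover have "range (\<lambda>r. J +>\<^bsub>R\<^esub> of_real r) = (\<lambda>a. J +>\<^bsub>R\<^esub> a) ` B"
  proof
    show "(\<lambda>a. J +>\<^bsub>R\<^esub> a) ` B \<subseteq> range (\<lambda>r. J +>\<^bsub>R\<^esub> of_real r)"
    proof
      fix c assume "c \<in> (\<lambda>a. J +>\<^bsub>R\<^esub> a) ` B"
      then obtain a where a: "a \<in> B" "c = J +>\<^bsub>R\<^esub> a" by blast
      then obtain s where "a - of_real s \<in> J" using res by blast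
      then show "c \<in> range (\<lambda>r. J +>\<^bsub>R\<^esub> of_real r)" using eq a(2) by blast
    qed
  qed (use real in blast)
  ultimately show ?thesis
    using hom by (simp add: ring_iso_def bij_betw_def ring_of_type_algebra_def)
qed

text \<open>Transport of structure along an injection. The value group is built as a linearly
  ordered type, whereas the theorem prescribes the type of the elements of its group.\<close>

definition copy_group :: "('v::linordered_ab_group_add \<Rightarrow> 'h) \<Rightarrow> 'h ogroup" where
  "copy_group e = \<lparr>carrier = range e,
     monoid.mult = (\<lambda>a b. e (inv_into UNIV e a + inv_into UNIV e b)), one = e 0,
     le_rel = {(e a, e b) | a b. a \<le> b}\<rparr>"

context
  fixes e :: "'v::linordered_ab_group_add \<Rightarrow> 'h"
  assumes e: "inj e"
begin

lemma copy_group_simps: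
  "carrier (copy_group e) = range e" "e a \<otimes>\<^bsub>copy_group e\<^esub> e b = e (a + b)"
  "\<one>\<^bsub>copy_group e\<^esub> = e 0" "(e a, e b) \<in> le_rel (copy_group e) \<longleftrightarrow> a \<le> b"
  using e by (auto simp: copy_group_def inj_def)

lemma ordered_group_copy_group: "ordered_group (copy_group e)"
  unfolding ordered_group_def
proof (intro conjI)
  show "group (copy_group e)"
  proof (rule groupI)
    fix x assume "x \<in> carrier (copy_group e)"
    then obtain a where "x = e a" by (auto simp: copy_group_simps)
    then have "e (- a) \<otimes>\<^bsub>copy_group e\<^esub> x = \<one>\<^bsub>copy_group e\<^esub>" by (simp add: copy_group_simps)
    then show "\<exists>y\<in>carrier (copy_group e). y \<otimes>\<^bsub>copy_group e\<^esub> x = \<one>\<^bsub>copy_group e\<^esub>"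
      by (auto simp: copy_group_simps)
  qed (auto simp: copy_group_simps add.assoc)
  show "linear_order_on (carrier (copy_group e)) (le_rel (copy_group e))"
    unfolding linear_order_on_def partial_order_on_def preorder_on_def
      refl_on_def trans_def antisym_def total_on_def
  proof (intro conjI allI ballI impI)
    fix x y z
    assume xy: "(x, y) \<in> le_rel (copy_group e)" and yz: "(y, z) \<in> le_rel (copy_group e)"
    obtain a b c where "x = e a" "y = e b" "z = e c" using xy yz by (auto simp: copy_group_def)
    then show "(x, z) \<in> le_rel (copy_group e)" using xy yz by (simp add: copy_group_simps)
  next
    fix x y
    assume xy: "(x, y) \<in> le_rel (copy_group e)" and yx: "(y, x) \<in> le_rel (copy_group e)"
    obtain a b where "x = e a" "y = e b" using xy by (auto simp: copy_group_def)
    then show "x = y" using xy yx by (simp add: copy_group_simps)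
  qed (auto simp: copy_group_simps, auto simp: copy_group_def)
qed (auto simp: copy_group_simps)

end

section \<open>Extending a valuation to the quotient division ring\<close>

lemma of_real_quot: "of_real r = (to_quot (of_real r) :: 'a::{ore_domain, real_algebra_1} ore_quot)"
  by (simp add: of_real_def[where 'a = "'a ore_quot"] scaleR_ore_quot_def)

lemma fractions_UNIV: "fractions (UNIV :: 'a::ore_domain set) = UNIV"
proof -
  have "x \<in> fractions (UNIV :: 'a set)" for x
    by (rule frac_cases[of x]) (auto simp: fractions_def)
  then show ?thesis by blast
qed

text \<open>Everything is stated for nonzero elements of the Ore domain. \<open>W_residue\<close> is
  the residue condition for the fraction a b^-1 of value 0, with the denominator cleared.\<close>

locale ore_valuation =
  fixes W :: "'a::{ore_domain, real_algebra_1} \<Rightarrow> 'v::linordered_ab_group_add"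
  assumes W_mult: "a \<noteq> 0 \<Longrightarrow> b \<noteq> 0 \<Longrightarrow> W (a * b) = W a + W b"
    and W_add: "a \<noteq> 0 \<Longrightarrow> b \<noteq> 0 \<Longrightarrow> a + b \<noteq> 0 \<Longrightarrow> min (W a) (W b) \<le> W (a + b)"
    and W_real: "r \<noteq> 0 \<Longrightarrow> W (of_real r) = 0"
    and W_residue: "a \<noteq> 0 \<Longrightarrow> b \<noteq> 0 \<Longrightarrow> W a = W b \<Longrightarrow>
      \<exists>r. a = of_real r * b \<or> W b < W (a - of_real r * b)"
begin

definition quot_val :: "'a ore_quot \<Rightarrow> 'v" where
  "quot_val q = (let p = SOME p. snd p \<noteq> 0 \<and> q = ore_frac (fst p) (snd p) in W (fst p) - W (snd p))"

text \<open>Two representations of a fraction become equal after multiplying each one's numerator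
  and denominator by a common factor, which cancels from the difference of values.\<close>

lemma quot_val_frac:
  assumes "a \<noteq> 0" "s \<noteq> 0" shows "quot_val (ore_frac a s) = W a - W s"
proof -
  define p where "p = (SOME p. snd p \<noteq> 0 \<and> ore_frac a s = ore_frac (fst p) (snd p))"
  have "\<exists>p. snd p \<noteq> 0 \<and> ore_frac a s = ore_frac (fst p) (snd p)"
    using assms by (intro exI[of _ "(a, s)"]) simp
  then have p: "snd p \<noteq> 0" "ore_frac a s = ore_frac (fst p) (snd p)"
    unfolding p_def by (rule someI2_ex, blast)+
  then have p0: "fst p \<noteq> 0" using assms by (metis frac_eq_0_iff)
  obtain c d where cd: "c \<noteq> 0" "d \<noteq> 0" "a * c = fst p * d" "s * c = snd p * d"
    using p frac_eq_iff[OF assms(2) p(1)] by blast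
  have "W a + W c = W (fst p) + W d" "W s + W c = W (snd p) + W d"
    using cd W_mult assms p p0 by metis+
  then have "W (fst p) - W (snd p) = W a - W s" by (metis add_diff_cancel_right)
  then show ?thesis unfolding quot_val_def Let_def p_def[symmetric] .
qed

lemma quot_val_mult:
  assumes "p \<noteq> 0" "q \<noteq> 0" shows "quot_val (p * q) = quot_val p + quot_val q"
proof -
  obtain a s t where *: "s \<noteq> 0" "t \<noteq> 0" "p = ore_frac a s" "q = ore_frac s t"
    using frac_chain[OF assms(2), of p] by metis
  then have "a \<noteq> 0" using assms by (auto simp: frac_0)
  then show ?thesis using * by (simp add: frac_mult_chain quot_val_frac)
qed

lemma quot_val_add:
  assumes "p \<noteq> 0" "q \<noteq> 0" "p + q \<noteq> 0" shows "min (quot_val p) (quot_val q) \<le> quot_val (p + q)"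
proof -
  obtain a b s where *: "s \<noteq> 0" "p = ore_frac a s" "q = ore_frac b s" by (rule frac_common)
  then have nz: "a \<noteq> 0" "b \<noteq> 0" "a + b \<noteq> 0" using assms by (auto simp: frac_0 frac_add)
  have "min (W a - W s) (W b - W s) = min (W a) (W b) - W s" by (simp add: min_def)
  then show ?thesis using * nz W_add[OF nz] by (simp add: frac_add quot_val_frac diff_right_mono)
qed

lemma quot_val_real: "r \<noteq> 0 \<Longrightarrow> quot_val (of_real r) = 0"
  using W_real[of 1] by (simp add: of_real_quot quot_val_frac W_real)

lemma quot_val_residue:
  assumes "p \<noteq> 0" "quot_val p = 0"
  shows "\<exists>r. p = of_real r \<or> 0 < quot_val (p - of_real r)"
proof -
  obtain a s where *: "s \<noteq> 0" "p = ore_frac a s" by (rule frac_cases)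
  then have a: "a \<noteq> 0" using assms by (auto simp: frac_0)
  then have "W a = W s" using assms * by (simp add: quot_val_frac)
  then obtain r where r: "a = of_real r * s \<or> W s < W (a - of_real r * s)"
    using W_residue[OF a *(1)] by blast
  have "ore_frac (of_real r * s) s = of_real r"
    using frac_scale[OF *(1), of 1 "of_real r"] by (simp add: of_real_quot)
  then have "p = ore_frac (a - of_real r * s) s + of_real r"
    using frac_add[OF *(1), of "a - of_real r * s" "of_real r * s"] * by simp
  then have d: "p - of_real r = ore_frac (a - of_real r * s) s" by (simp add: algebra_simps)
  show ?thesis
  proof (cases "a = of_real r * s")
    case True
    then have "p - of_real r = 0" using d * by (simp add: frac_0)
    then show ?thesis by auto
  next
    case False
    then have "0 < quot_val (p - of_real r)" using r * d by (simp add: quot_val_frac)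
    then show ?thesis by blast
  qed
qed

context
  fixes e :: "'v \<Rightarrow> 'h"
  assumes e: "inj e"
begin

lemma valuation_copy:
  "valuation UNIV (copy_group e) (\<lambda>a. if a = 0 then None else Some (e (W a)))"
  unfolding valuation_def
  using ordered_group_copy_group[OF e] W_add[unfolded min_def]
  by (force simp: copy_group_simps[OF e] W_mult W_real val_min_def min_def split: if_splits)

abbreviation "quot_value q \<equiv> (if q = 0 then None else Some (e (quot_val q)))"

lemma valuation_quot_copy: "valuation UNIV (copy_group e) (\<lambda>q. quot_value q)"
  unfolding valuation_def
  using ordered_group_copy_group[OF e] quot_val_add[unfolded min_def]
  by (force simp: copy_group_simps[OF e] quot_val_mult quot_val_real val_min_def min_def split: if_splits)

lemma real_residue_field_quot: "real_residue_field UNIV (copy_group e) (\<lambda>q. quot_value q)"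
proof -
  define B where "B = {q. q = 0 \<or> 0 \<le> quot_val q}"
  define J where "J = {q. q = 0 \<or> 0 < quot_val q}"
  have "{q \<in> UNIV. val_le (copy_group e) (Some \<one>\<^bsub>copy_group e\<^esub>) (quot_value q)} = B"
    by (auto simp: copy_group_simps[OF e] B_def)
  then have ring_eq: "valuation_ring UNIV (copy_group e) (\<lambda>q. quot_value q) = ring_of_type_algebra\<lparr>carrier := B\<rparr>"
    by (simp only: valuation_ring_def)
  have ideal_eq: "valuation_ideal UNIV (copy_group e) (\<lambda>q. quot_value q) = J"
    unfolding valuation_ideal_def J_def
    by (auto simp: copy_group_simps[OF e] inj_eq[OF e])
  show ?thesis
    unfolding real_residue_field_def ring_eq ideal_eq
  proof (rule real_coset_iso)
    show "of_real r \<in> B" for r by (cases "r = 0") (auto simp: B_def quot_val_real)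
    show "r \<noteq> 0 \<Longrightarrow> of_real r \<notin> J" for r by (auto simp: J_def quot_val_real)
    show "J \<subseteq> B" by (auto simp: J_def B_def)
    show "a + b \<in> B" if "a \<in> B" "b \<in> B" for a b
    proof (cases "a = 0 \<or> b = 0 \<or> a + b = 0")
      case False
      then have "0 \<le> min (quot_val a) (quot_val b)" using that by (auto simp: B_def)
      also have "\<dots> \<le> quot_val (a + b)" using False by (intro quot_val_add) auto
      finally show ?thesis by (simp add: B_def)
    qed (use that in \<open>auto simp: B_def\<close>)
    show "a + b \<in> J" if "a \<in> J" "b \<in> J" for a b
    proof (cases "a = 0 \<or> b = 0 \<or> a + b = 0")
      case False
      then have "0 < min (quot_val a) (quot_val b)" using that by (auto simp: J_def)
      also have "\<dots> \<le> quot_val (a + b)" using False by (intro quot_val_add) auto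
      finally show ?thesis by (simp add: J_def)
    qed (use that in \<open>auto simp: J_def\<close>)
    show "a * b \<in> B" if "a \<in> B" "b \<in> B" for a b
      using that by (cases "a = 0 \<or> b = 0") (auto simp: B_def quot_val_mult)
    show "a * b \<in> J" "b * a \<in> J" if "a \<in> J" "b \<in> B" for a b
      using that by (cases "a = 0 \<or> b = 0",
        auto simp: B_def J_def quot_val_mult add_pos_nonneg add_nonneg_pos)+
    fix a assume "a \<in> B"
    then consider "a \<in> J" | "a \<noteq> 0" "quot_val a = 0"
      by (auto simp: B_def J_def order_le_less)
    then show "\<exists>r. a - of_real r \<in> J"
    proof cases
      case 1
      then show ?thesis by (intro exI[of _ 0]) simp
    next
      case 2
      then show ?thesis using quot_val_residue[of a] by (auto simp: J_def)
    qed
  qed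
qed

lemma ore_real_residue_field_copy:
  "ore_real_residue_field UNIV (copy_group e) (\<lambda>a. if a = 0 then None else Some (e (W a)))"
proof -
  have "W 1 = 0" using W_real[of 1] by simp
  then have "quot_value (to_quot a) = (if a = 0 then None else Some (e (W a)))" for a
    by (simp add: frac_eq_0_iff quot_val_frac)
  then show ?thesis
    unfolding ore_real_residue_field_def fractions_UNIV
    using valuation_quot_copy real_residue_field_quot by blast
qed

end

end

section \<open>Valuations on skew polynomial rings\<close>

text \<open>The coefficient ring is a parameter because both the given valuation and its constructed
  extension are analysed with these lemmas, in particular with \<open>nv_expansion\<close>.\<close>

locale skew_valuation = diff_subring S for S :: "gseries set" +
  fixes \<Gamma> :: "'g ogroup" and v :: "gseries skew_poly \<Rightarrow> 'g option"
  assumes val: "valuation (skew_polys S) \<Gamma> v"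
begin

abbreviation "A \<equiv> skew_polys S"
abbreviation "gle \<alpha> \<beta> \<equiv> (\<alpha>, \<beta>) \<in> le_rel \<Gamma>"
definition "glt \<alpha> \<beta> \<longleftrightarrow> gle \<alpha> \<beta> \<and> \<alpha> \<noteq> \<beta>"

lemma ordered: "ordered_group \<Gamma>"
  using val by (simp add: valuation_def)

sublocale G: group \<Gamma>
  using ordered by (simp add: ordered_group_def)

lemma linear: "linear_order_on (carrier \<Gamma>) (le_rel \<Gamma>)"
  using ordered by (simp add: ordered_group_def)

lemma gle_carrier: "gle \<alpha> \<beta> \<Longrightarrow> \<alpha> \<in> carrier \<Gamma> \<and> \<beta> \<in> carrier \<Gamma>"
  using linear by (auto simp: linear_order_on_def partial_order_on_def preorder_on_def)

lemma gle_refl: "\<alpha> \<in> carrier \<Gamma> \<Longrightarrow> gle \<alpha> \<alpha>"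
  using linear by (auto simp: linear_order_on_def partial_order_on_def preorder_on_def refl_on_def)

lemma gle_trans: "gle \<alpha> \<beta> \<Longrightarrow> gle \<beta> \<gamma> \<Longrightarrow> gle \<alpha> \<gamma>"
  using linear unfolding linear_order_on_def partial_order_on_def preorder_on_def trans_def by blast

lemma gle_antisym: "gle \<alpha> \<beta> \<Longrightarrow> gle \<beta> \<alpha> \<Longrightarrow> \<alpha> = \<beta>"
  using linear unfolding linear_order_on_def partial_order_on_def antisym_def by blast

lemma glt_cases: "\<alpha> \<in> carrier \<Gamma> \<Longrightarrow> \<beta> \<in> carrier \<Gamma> \<Longrightarrow> glt \<alpha> \<beta> \<or> \<alpha> = \<beta> \<or> glt \<beta> \<alpha>"
  using linear unfolding linear_order_on_def total_on_def glt_def by blast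

lemma glt_irrefl: "\<not> glt \<alpha> \<alpha>"
  by (simp add: glt_def)

lemma glt_asym: "glt \<alpha> \<beta> \<Longrightarrow> \<not> glt \<beta> \<alpha>"
  using gle_antisym by (auto simp: glt_def)

lemma glt_le_trans: "glt \<alpha> \<beta> \<Longrightarrow> gle \<beta> \<gamma> \<Longrightarrow> glt \<alpha> \<gamma>"
  using gle_trans gle_antisym unfolding glt_def by blast

lemma glt_trans: "glt \<alpha> \<beta> \<Longrightarrow> glt \<beta> \<gamma> \<Longrightarrow> glt \<alpha> \<gamma>"
  using glt_le_trans unfolding glt_def by blast

lemma glt_carrier: "glt \<alpha> \<beta> \<Longrightarrow> \<alpha> \<in> carrier \<Gamma> \<and> \<beta> \<in> carrier \<Gamma>"
  using gle_carrier unfolding glt_def by blast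

lemma gle_iff: "\<alpha> \<in> carrier \<Gamma> \<Longrightarrow> \<beta> \<in> carrier \<Gamma> \<Longrightarrow> gle \<alpha> \<beta> \<longleftrightarrow> \<not> glt \<beta> \<alpha>"
  by (metis gle_antisym gle_refl glt_cases glt_def)

lemma gle_mult_left: "gle \<alpha> \<beta> \<Longrightarrow> \<gamma> \<in> carrier \<Gamma> \<Longrightarrow> gle (\<gamma> \<otimes>\<^bsub>\<Gamma>\<^esub> \<alpha>) (\<gamma> \<otimes>\<^bsub>\<Gamma>\<^esub> \<beta>)"
  and gle_mult_right: "gle \<alpha> \<beta> \<Longrightarrow> \<gamma> \<in> carrier \<Gamma> \<Longrightarrow> gle (\<alpha> \<otimes>\<^bsub>\<Gamma>\<^esub> \<gamma>) (\<beta> \<otimes>\<^bsub>\<Gamma>\<^esub> \<gamma>)"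
  using ordered gle_carrier unfolding ordered_group_def by blast+

lemma glt_mult_left: "glt \<alpha> \<beta> \<Longrightarrow> \<gamma> \<in> carrier \<Gamma> \<Longrightarrow> glt (\<gamma> \<otimes>\<^bsub>\<Gamma>\<^esub> \<alpha>) (\<gamma> \<otimes>\<^bsub>\<Gamma>\<^esub> \<beta>)"
  using gle_mult_left gle_carrier unfolding glt_def by (metis G.l_cancel)

lemma glt_mult_right: "glt \<alpha> \<beta> \<Longrightarrow> \<gamma> \<in> carrier \<Gamma> \<Longrightarrow> glt (\<alpha> \<otimes>\<^bsub>\<Gamma>\<^esub> \<gamma>) (\<beta> \<otimes>\<^bsub>\<Gamma>\<^esub> \<gamma>)"
  using gle_mult_right gle_carrier unfolding glt_def by (metis G.r_cancel)

lemma glt_mult: "glt \<alpha> \<beta> \<Longrightarrow> glt \<gamma> \<delta> \<Longrightarrow> glt (\<alpha> \<otimes>\<^bsub>\<Gamma>\<^esub> \<gamma>) (\<beta> \<otimes>\<^bsub>\<Gamma>\<^esub> \<delta>)"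
  using glt_trans glt_mult_left glt_mult_right glt_carrier by meson

lemma glt_le_mult: "glt \<alpha> \<beta> \<Longrightarrow> gle \<gamma> \<delta> \<Longrightarrow> glt (\<alpha> \<otimes>\<^bsub>\<Gamma>\<^esub> \<gamma>) (\<beta> \<otimes>\<^bsub>\<Gamma>\<^esub> \<delta>)"
  using glt_le_trans gle_mult_left glt_mult_right glt_carrier gle_carrier by meson

text \<open>Strict inequalities can be multiplied in an ordered group without commutativity, so
  squaring is strictly monotone.\<close>

lemma square_inj:
  assumes "\<alpha> \<in> carrier \<Gamma>" "\<beta> \<in> carrier \<Gamma>" "\<alpha> \<otimes>\<^bsub>\<Gamma>\<^esub> \<alpha> = \<beta> \<otimes>\<^bsub>\<Gamma>\<^esub> \<beta>"
  shows "\<alpha> = \<beta>"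
  using glt_cases[OF assms(1,2)] glt_mult[of \<alpha> \<beta> \<alpha> \<beta>] glt_mult[of \<beta> \<alpha> \<beta> \<alpha>] assms(3)
  by (auto simp: glt_irrefl)

section \<open>Values of nonzero elements and strictly dominant terms\<close>

definition nv :: "gseries skew_poly \<Rightarrow> 'g" where
  "nv a = the (v a)"

lemma v_eq: "a \<in> A \<Longrightarrow> v a = (if a = 0 then None else Some (nv a))"
  using val by (auto simp: valuation_def nv_def)

lemma nv_closed [simp]: "a \<in> A \<Longrightarrow> a \<noteq> 0 \<Longrightarrow> nv a \<in> carrier \<Gamma>"
  using val v_eq[of a] by (force simp: valuation_def)

lemma nv_mult: "a \<in> A \<Longrightarrow> b \<in> A \<Longrightarrow> a \<noteq> 0 \<Longrightarrow> b \<noteq> 0 \<Longrightarrow> nv (a * b) = nv a \<otimes>\<^bsub>\<Gamma>\<^esub> nv b"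
proof -
  assume ab: "a \<in> A" "b \<in> A" "a \<noteq> 0" "b \<noteq> 0"
  then have "v (a * b) = val_add \<Gamma> (v a) (v b)" using val unfolding valuation_def by blast
  then show ?thesis using ab by (simp add: v_eq nv_def[of "a * b"])
qed

lemma nv_real: "r \<noteq> 0 \<Longrightarrow> nv (of_real r) = \<one>\<^bsub>\<Gamma>\<^esub>"
  using val by (simp add: valuation_def nv_def)

lemma nv_1 [simp]: "nv 1 = \<one>\<^bsub>\<Gamma>\<^esub>"
  using nv_real[of 1] by simp

lemma nv_real_mult: "a \<in> A \<Longrightarrow> a \<noteq> 0 \<Longrightarrow> r \<noteq> 0 \<Longrightarrow> nv (of_real r * a) = nv a"
  by (simp add: nv_mult skew_of_real nv_real)

lemma nv_uminus: "a \<in> A \<Longrightarrow> a \<noteq> 0 \<Longrightarrow> nv (- a) = nv a"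
  using nv_real_mult[of a "- 1"] by simp

lemma nv_power: "a \<in> A \<Longrightarrow> a \<noteq> 0 \<Longrightarrow> nv (a ^ i) = nv a [^]\<^bsub>\<Gamma>\<^esub> i"
proof (induction i)
  case (Suc i)
  then have "nv (a ^ i * a) = nv (a ^ i) \<otimes>\<^bsub>\<Gamma>\<^esub> nv a" by (intro nv_mult skew_power) auto
  then show ?case using Suc by (simp add: power_Suc2 del: power_Suc)
qed simp

text \<open>Zero counts as having infinite value, since \<open>nv 0\<close> carries no
  information.\<close>

definition vgt :: "'g \<Rightarrow> gseries skew_poly \<Rightarrow> bool" where
  "vgt \<gamma> a \<longleftrightarrow> a = 0 \<or> glt \<gamma> (nv a)"

definition vge :: "'g \<Rightarrow> gseries skew_poly \<Rightarrow> bool" where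
  "vge \<gamma> a \<longleftrightarrow> a = 0 \<or> gle \<gamma> (nv a)"

lemma vgt_imp_vge: "vgt \<gamma> a \<Longrightarrow> vge \<gamma> a"
  by (auto simp: vgt_def vge_def glt_def)

lemma nv_add:
  assumes "a \<in> A" "b \<in> A" "a \<noteq> 0" "b \<noteq> 0" "a + b \<noteq> 0"
  shows "gle (nv a) (nv (a + b)) \<or> gle (nv b) (nv (a + b))"
proof -
  have "val_le \<Gamma> (val_min \<Gamma> (v a) (v b)) (v (a + b))" using val assms by (simp add: valuation_def)
  then show ?thesis using assms by (auto simp: v_eq skew_add val_min_def split: if_splits)
qed

lemma vgt_add: 
  assumes "a \<in> A" "b \<in> A" "vgt \<gamma> a" "vgt \<gamma> b" shows "vgt \<gamma> (a + b)"
proof (cases "a = 0 \<or> b = 0 \<or> a + b = 0")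
  case False
  then show ?thesis using assms nv_add[of a b] glt_le_trans unfolding vgt_def by blast
qed (use assms in \<open>auto simp: vgt_def\<close>)

lemma vge_add: 
  assumes "a \<in> A" "b \<in> A" "vge \<gamma> a" "vge \<gamma> b" shows "vge \<gamma> (a + b)"
proof (cases "a = 0 \<or> b = 0 \<or> a + b = 0")
  case False
  then show ?thesis using assms nv_add[of a b] gle_trans unfolding vge_def by blast
qed (use assms in \<open>auto simp: vge_def\<close>)

lemma vgt_uminus: "a \<in> A \<Longrightarrow> vgt \<gamma> a \<Longrightarrow> vgt \<gamma> (- a)"
  by (cases "a = 0") (auto simp: vgt_def nv_uminus)

lemma vgt_diff:
  assumes "a \<in> A" "b \<in> A" "vgt \<gamma> a" "vgt \<gamma> b" shows "vgt \<gamma> (a - b)"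
  using vgt_add[of a "- b"] assms by (simp add: vgt_uminus skew_uminus)

lemma vge_real_mult: "a \<in> A \<Longrightarrow> vge \<gamma> a \<Longrightarrow> vge \<gamma> (of_real r * a)"
  by (cases "r = 0 \<or> a = 0") (auto simp: vge_def nv_real_mult)

lemma vgt_sum:
  assumes "\<And>i. i \<in> I \<Longrightarrow> f i \<in> A \<and> vgt \<gamma> (f i)" shows "vgt \<gamma> (\<Sum>i\<in>I. f i)"
proof -
  have "(\<Sum>i\<in>I. f i) \<in> A \<and> vgt \<gamma> (\<Sum>i\<in>I. f i)"
    using assms by (induction I rule: infinite_finite_induct) (auto simp: vgt_add skew_add skew_0, auto simp: vgt_def)
  then show ?thesis ..
qed

lemma vgt_mult:
  assumes "a \<in> A" "b \<in> A" "vgt \<gamma> a" "vge \<delta> b" shows "vgt (\<gamma> \<otimes>\<^bsub>\<Gamma>\<^esub> \<delta>) (a * b)"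
  using assms by (cases "a = 0 \<or> b = 0") (auto simp: vgt_def vge_def nv_mult glt_le_mult)

text \<open>If \<open>a + b\<close> had a value greater than that of \<open>a\<close>, so would
  \<open>a = (a + b) - b\<close>.\<close>

lemma nv_dominant:
  assumes "a \<in> A" "b \<in> A" "a \<noteq> 0" "vgt (nv a) b" shows "a + b \<noteq> 0" "nv (a + b) = nv a"
proof -
  have not: "\<not> vgt (nv a) (a + b)"
  proof
    assume "vgt (nv a) (a + b)"
    then have "vgt (nv a) (a + b - b)" using assms by (intro vgt_diff skew_add)
    then show False using assms by (simp add: vgt_def glt_irrefl)
  qed
  then show nz: "a + b \<noteq> 0" by (auto simp: vgt_def)
  have "vge (nv a) a" using assms by (simp add: vge_def gle_refl)
  then have "vge (nv a) (a + b)" using assms by (intro vge_add) (auto intro: vgt_imp_vge)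
  then show "nv (a + b) = nv a" using nz not by (auto simp: vge_def vgt_def glt_def)
qed

lemma svar_diff_mem: "p \<in> S \<Longrightarrow> svar - sconst p \<in> A"
  by (intro skew_diff skew_svar) (simp add: skew_sconst_iff)

lemma svar_neq_sconst [simp]: "svar \<noteq> (sconst p :: gseries skew_poly)"
proof -
  have "coeff (left_poly (svar - sconst p)) 1 = 1" by simp
  then show ?thesis by force
qed

lemma svar_diff_neq_0: "svar - sconst p \<noteq> (0 :: gseries skew_poly)"
  by simp

lemma nv_expansion:
  fixes f p
  defines "h \<equiv> left_poly (sshift p f)"
  assumes f: "f \<in> A" "p \<in> S" and i: "coeff h i \<noteq> 0"
    and min: "\<And>j. j \<noteq> i \<Longrightarrow> coeff h j \<noteq> 0 \<Longrightarrow>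
      glt (nv (sconst (coeff h i)) \<otimes>\<^bsub>\<Gamma>\<^esub> nv (svar - sconst p) [^]\<^bsub>\<Gamma>\<^esub> i)
         (nv (sconst (coeff h j)) \<otimes>\<^bsub>\<Gamma>\<^esub> nv (svar - sconst p) [^]\<^bsub>\<Gamma>\<^esub> j)"
  shows "nv f = nv (sconst (coeff h i)) \<otimes>\<^bsub>\<Gamma>\<^esub> nv (svar - sconst p) [^]\<^bsub>\<Gamma>\<^esub> i"
proof -
  define t where "t j = sconst (coeff h j) * (svar - sconst p) ^ j" for j
  have hS: "coeff h j \<in> S" for j
    using skew_sshift[OF f(2,1)] by (simp add: h_def skew_polys_def)
  have tA: "t j \<in> A" for j
    unfolding t_def using hS f by (intro skew_mult skew_power svar_diff_mem) (auto simp: skew_sconst_iff)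
  have t0: "t j \<noteq> 0 \<longleftrightarrow> coeff h j \<noteq> 0" for j
    by (simp add: t_def svar_diff_neq_0)
  have nvt: "nv (t j) = nv (sconst (coeff h j)) \<otimes>\<^bsub>\<Gamma>\<^esub> nv (svar - sconst p) [^]\<^bsub>\<Gamma>\<^esub> j"
    if "coeff h j \<noteq> 0" for j
    using that hS f unfolding t_def
    by (subst nv_mult) (auto simp: skew_sconst_iff skew_power svar_diff_mem svar_diff_neq_0 nv_power)
  have "i \<le> degree h" using i by (rule le_degree)
  then have "f = t i + (\<Sum>j\<in>{..degree h} - {i}. t j)"
    using sshift_expansion[of f p] by (simp add: h_def[symmetric] t_def sum.remove)
  moreover have "vgt (nv (t i)) (\<Sum>j\<in>{..degree h} - {i}. t j)"
  proof (rule vgt_sum)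
    fix j assume "j \<in> {..degree h} - {i}"
    then show "t j \<in> A \<and> vgt (nv (t i)) (t j)"
      using min[of j] tA t0[of j] nvt[OF i] nvt[of j] by (auto simp: vgt_def)
  qed
  ultimately have "nv f = nv (t i)"
    using nv_dominant(2)[of "t i" "\<Sum>j\<in>{..degree h} - {i}. t j"] tA t0 i skew_sum by metis
  then show ?thesis using nvt[OF i] by simp
qed

end

text \<open>The residue field hypothesis enters with denominators cleared, so that the analysis
  stays inside the skew polynomial ring; \<open>residue_of_quotient\<close> derives this
  form.\<close>

locale puiseux_valuation = skew_valuation puiseux \<Gamma> v
  for \<Gamma> :: "'g ogroup" and v :: "gseries skew_poly \<Rightarrow> 'g option" +
  assumes residue: "a \<in> A \<Longrightarrow> b \<in> A \<Longrightarrow> a \<noteq> 0 \<Longrightarrow> b \<noteq> 0 \<Longrightarrow> nv a = nv b \<Longrightarrow>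
    \<exists>r. vgt (nv b) (a - of_real r * b)"
begin

text \<open>If \<open>t\<close> is infinitesimal with \<open>v t \<le> 0\<close>, then \<open>v (1 - c t) > v t\<close> for some real \<open>c\<close>, and
  \<open>s\<^sup>2 = 1 - (c\<^sup>2 + 1) t\<^sup>2\<close> is solvable among the Puiseux series. Thus \<open>s\<^sup>2 + t\<^sup>2\<close> has value
  greater than \<open>2 v t\<close>, and the residue of \<open>s / t\<close> is a real square root of \<open>-1\<close>.\<close>

lemma infinitesimal_pos:
  assumes t: "t \<in> puiseux" "\<And>q. gcoeff t q \<noteq> 0 \<Longrightarrow> 0 < q"
  shows "vgt \<one>\<^bsub>\<Gamma>\<^esub> (sconst t)"
proof (rule ccontr)
  assume neg: "\<not> vgt \<one>\<^bsub>\<Gamma>\<^esub> (sconst t)"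
  define T where "T = sconst t"
  define \<tau> where "\<tau> = nv T"
  have T: "T \<in> A" "T \<noteq> 0" using neg t by (auto simp: T_def vgt_def skew_sconst_iff)
  have \<tau>: "\<tau> \<in> carrier \<Gamma>" using T by (simp add: \<tau>_def)
  have le1: "gle \<tau> \<one>\<^bsub>\<Gamma>\<^esub>" using neg \<tau> by (auto simp: vgt_def \<tau>_def T_def gle_iff)
  \<comment> \<open>If t has value 0, \<open>c\<close> is the residue of 1 / t; if its value is
    negative, 1 already has greater value and \<open>c = 0\<close> works.\<close>
  have "\<exists>c. vgt \<tau> (1 - of_real c * T)"
  proof (cases "\<tau> = \<one>\<^bsub>\<Gamma>\<^esub>")
    case True
    then show ?thesis using residue[of 1 T] T skew_1 by (simp add: \<tau>_def)
  next
    case False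
    then show ?thesis using le1 by (intro exI[of _ 0]) (simp add: vgt_def glt_def)
  qed
  then obtain c where c: "vgt \<tau> (1 - of_real c * T)" ..
  \<comment> \<open>The constant makes s^2 + t^2 equal to 1 - c^2 t^2 = (1 - c t) (1 + c t), whose
    first factor has value greater than \<tau> and whose second has value at least \<tau>.\<close>
  have "\<exists>s\<in>puiseux. s * s = 1 + of_real (- (c\<^sup>2 + 1)) * (t * t)"
  proof (rule puiseux_sqrt)
    show "of_real (- (c\<^sup>2 + 1)) * (t * t) \<in> puiseux"
      using t(1) by (intro mult_mem of_real_mem)
    fix q assume "gcoeff (of_real (- (c\<^sup>2 + 1)) * (t * t)) q \<noteq> 0"
    then have "gcoeff (t * t) q \<noteq> 0"
      unfolding gmonom_at_0[symmetric] gcoeff_gmonom_mult by auto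
    then obtain a b where "q = a + b" "gcoeff t a \<noteq> 0" "gcoeff t b \<noteq> 0"
      using supp_mult[of t t] by blast
    then show "0 < q" using t(2) by (simp add: add_pos_pos)
  qed
  then obtain s where s: "s \<in> puiseux" "s * s = 1 + of_real (- (c\<^sup>2 + 1)) * (t * t)" ..
  define Q where "Q = sconst s"
  have Q: "Q \<in> A" using s by (simp add: Q_def skew_sconst_iff)
  have "s * s + t * t = (1 - of_real c * t) * (1 + of_real c * t)"
    unfolding s(2) by (simp add: algebra_simps power2_eq_square)
  then have eq: "Q * Q + T * T = (1 - of_real c * T) * (1 + of_real c * T)"
    unfolding Q_def T_def of_real_eq_sconst sconst_mult[symmetric] sconst_add[symmetric]
      sconst_diff[symmetric] sconst_1[symmetric] by simp
  have cT: "of_real c * T \<in> A" using T by (intro skew_mult skew_of_real)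
  have "vge \<tau> (1 + of_real c * T)"
    using le1 T cT skew_1 \<tau> by (intro vge_add vge_real_mult) (auto simp: vge_def \<tau>_def gle_refl)
  then have big: "vgt (\<tau> \<otimes>\<^bsub>\<Gamma>\<^esub> \<tau>) (Q * Q + T * T)"
    unfolding eq using c cT skew_1 by (intro vgt_mult skew_add skew_diff)
  have TT: "T * T \<in> A" "T * T \<noteq> 0" "nv (T * T) = \<tau> \<otimes>\<^bsub>\<Gamma>\<^esub> \<tau>"
    using T by (simp_all add: skew_mult nv_mult \<tau>_def)
  have QQ: "Q * Q \<in> A" using Q by (simp add: skew_mult)
  have "Q * Q = - (T * T) + (Q * Q + T * T)" by simp
  moreover have "- (T * T) + (Q * Q + T * T) \<noteq> 0" "nv (- (T * T) + (Q * Q + T * T)) = nv (- (T * T))"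
    using nv_dominant[of "- (T * T)" "Q * Q + T * T"] big TT QQ
    by (auto simp: skew_uminus skew_add nv_uminus)
  ultimately have Q2: "Q * Q \<noteq> 0" "nv (Q * Q) = \<tau> \<otimes>\<^bsub>\<Gamma>\<^esub> \<tau>" using TT by (simp_all add: nv_uminus)
  then have Q0: "Q \<noteq> 0" by auto
  have "nv Q \<otimes>\<^bsub>\<Gamma>\<^esub> nv Q = \<tau> \<otimes>\<^bsub>\<Gamma>\<^esub> \<tau>" using nv_mult[OF Q Q Q0 Q0] Q2(2) by simp
  then have "nv Q = \<tau>" by (rule square_inj[OF nv_closed[OF Q Q0] \<tau>])
  then obtain r where r: "vgt \<tau> (Q - of_real r * T)" using residue[of Q T] Q Q0 T by (auto simp: \<tau>_def)
  have rT: "of_real r * T \<in> A" using T by (intro skew_mult skew_of_real)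
  have "vge \<tau> (Q + of_real r * T)"
    using \<open>nv Q = \<tau>\<close> T Q rT \<tau> by (intro vge_add vge_real_mult) (auto simp: vge_def \<tau>_def gle_refl)
  then have "vgt (\<tau> \<otimes>\<^bsub>\<Gamma>\<^esub> \<tau>) ((Q - of_real r * T) * (Q + of_real r * T))"
    using r Q rT by (intro vgt_mult skew_add skew_diff)
  then have "vgt (\<tau> \<otimes>\<^bsub>\<Gamma>\<^esub> \<tau>) (Q * Q + T * T - (Q - of_real r * T) * (Q + of_real r * T))"
    using big T Q by (intro vgt_diff skew_add skew_mult skew_diff skew_of_real)
  also have "Q * Q + T * T - (Q - of_real r * T) * (Q + of_real r * T) = of_real (1 + r\<^sup>2) * (T * T)"
    unfolding Q_def T_def of_real_eq_sconst sconst_mult[symmetric] sconst_add[symmetric]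
      sconst_diff[symmetric] by (rule arg_cong[where f = sconst]) (simp add: algebra_simps power2_eq_square)
  finally have v: "vgt (\<tau> \<otimes>\<^bsub>\<Gamma>\<^esub> \<tau>) (of_real (1 + r\<^sup>2) * (T * T))" .
  have nz: "1 + r\<^sup>2 \<noteq> 0" by (metis add_pos_nonneg less_irrefl zero_le_power2 zero_less_one)
  then have "of_real (1 + r\<^sup>2) * (T * T) \<noteq> 0" using TT by (simp del: of_real_add)
  then show False using v TT nz by (simp add: vgt_def nv_real_mult glt_irrefl del: of_real_add)
qed

section \<open>Values of Puiseux series and of y - p\<close>

definition \<gamma> :: "rat \<Rightarrow> 'g" where
  "\<gamma> q = nv (sconst (gmonom 1 q))"

lemma sconst_gmonom_mem: "sconst (gmonom c q) \<in> A"
  by (simp add: skew_sconst_iff puiseux_gmonom)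

lemma \<gamma>_closed [simp]: "\<gamma> q \<in> carrier \<Gamma>"
  by (simp add: \<gamma>_def sconst_gmonom_mem)

lemma \<gamma>_add: "\<gamma> (p + q) = \<gamma> p \<otimes>\<^bsub>\<Gamma>\<^esub> \<gamma> q"
proof -
  have "sconst (gmonom 1 (p + q)) = sconst (gmonom 1 p) * sconst (gmonom 1 q)"
    by (simp add: sconst_mult[symmetric] gmonom_mult)
  then show ?thesis unfolding \<gamma>_def by (simp add: nv_mult sconst_gmonom_mem)
qed

lemma \<gamma>_0 [simp]: "\<gamma> 0 = \<one>\<^bsub>\<Gamma>\<^esub>"
  by (simp add: \<gamma>_def gmonom_at_0)

lemma nv_gmonom: "c \<noteq> 0 \<Longrightarrow> nv (sconst (gmonom c q)) = \<gamma> q"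
proof -
  assume c: "c \<noteq> 0"
  have "sconst (gmonom c q) = of_real c * sconst (gmonom 1 q)"
    by (subst gmonom_eq_of_real_mult) (simp add: of_real_eq_sconst sconst_mult)
  then show ?thesis using c by (simp add: nv_real_mult sconst_gmonom_mem \<gamma>_def)
qed

lemma \<gamma>_strict: "p < q \<Longrightarrow> glt (\<gamma> p) (\<gamma> q)"
proof -
  assume pq: "p < q"
  have "vgt \<one>\<^bsub>\<Gamma>\<^esub> (sconst (gmonom 1 (q - p)))"
    by (rule infinitesimal_pos) (use pq in \<open>auto simp: puiseux_gmonom gcoeff_gmonom split: if_splits\<close>)
  then have "glt \<one>\<^bsub>\<Gamma>\<^esub> (\<gamma> (q - p))" by (simp add: vgt_def \<gamma>_def)
  then have "glt (\<gamma> p \<otimes>\<^bsub>\<Gamma>\<^esub> \<one>\<^bsub>\<Gamma>\<^esub>) (\<gamma> p \<otimes>\<^bsub>\<Gamma>\<^esub> \<gamma> (q - p))" by (rule glt_mult_left) simp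
  then show ?thesis by (simp add: \<gamma>_add[symmetric])
qed

lemma \<gamma>_less_iff: "glt (\<gamma> p) (\<gamma> q) \<longleftrightarrow> p < q"
  using \<gamma>_strict[of p q] \<gamma>_strict[of q p] glt_asym glt_irrefl by (metis linorder_cases)

text \<open>Factoring out the leading term leaves 1 + t with t infinitesimal, which has value
  0.\<close>

lemma nv_sconst:
  assumes p: "p \<in> puiseux" "p \<noteq> 0" shows "nv (sconst p) = \<gamma> (gord p)"
proof -
  define q where "q = gord p"
  define c where "c = gcoeff p q"
  define t where "t = gmonom (1 / c) (- q) * p - 1"
  have c: "c \<noteq> 0" using gord(1)[OF p(2)] by (simp add: c_def q_def)
  have tK: "t \<in> puiseux"
    using p uminus_mem[OF one_mem] unfolding t_def diff_conv_add_uminus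
    by (intro puiseux_add puiseux_mult puiseux_gmonom) auto
  have tpos: "0 < a" if "gcoeff t a \<noteq> 0" for a
  proof (rule ccontr)
    assume a: "\<not> 0 < a"
    have "gcoeff p (a + q) = 0" if "a \<noteq> 0"
      using gord(2)[OF p(2), of "a + q"] a that by (auto simp: q_def)
    then show False using that c
      by (cases "a = 0") (auto simp: t_def gcoeff_gmonom_mult gcoeff_one c_def add.commute)
  qed
  have "gmonom c q * (1 + t) = p"
    using c by (simp add: t_def mult.assoc[symmetric] gmonom_mult gmonom_at_0)
  then have e: "sconst p = sconst (gmonom c q) * (1 + sconst t)"
    by (metis sconst_mult sconst_add sconst_1)
  have "1 + sconst t \<noteq> 0" "nv (1 + sconst t) = nv 1"
    using nv_dominant[of 1 "sconst t"] infinitesimal_pos[OF tK tpos] skew_1 tK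
    by (auto simp: skew_sconst_iff)
  then show ?thesis
    unfolding e using c tK
    by (subst nv_mult) (simp_all add: sconst_gmonom_mem skew_add skew_1 skew_sconst_iff nv_gmonom q_def puiseux_gmonom)
qed

text \<open>From y x^q = x^q y + q x^(q-1), conjugation by x^-q turns \<open>u\<close> into u + q
  x^-1. The result is nonzero because it is again y minus a constant.\<close>

lemma \<gamma>_conj:
  fixes p q
  assumes p: "p \<in> puiseux"
  defines "u \<equiv> svar - sconst p"
  shows "u + sconst (gmonom (of_rat q) 1) \<noteq> 0"
    "\<gamma> q \<otimes>\<^bsub>\<Gamma>\<^esub> nv u \<otimes>\<^bsub>\<Gamma>\<^esub> \<gamma> (- q) = nv (u + sconst (gmonom (of_rat q) 1))"
proof -
  have "sconst (gmonom 1 q) * u * sconst (gmonom 1 (- q))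
      = sconst (gmonom 1 q) * (sconst (gmonom 1 (- q)) * u + sconst (gmonom (of_rat q) (1 - q)))"
    by (simp add: u_def mult.assoc left_diff_distrib right_diff_distrib svar_sconst der_gmonom of_rat_minus
        sconst_mult[symmetric] mult.commute[of p] distrib_left)
  also have "\<dots> = u + sconst (gmonom (of_rat q) 1)"
    by (simp add: distrib_left mult.assoc[symmetric] sconst_mult[symmetric] gmonom_mult gmonom_at_0)
  finally have e: "sconst (gmonom 1 q) * u * sconst (gmonom 1 (- q)) = u + sconst (gmonom (of_rat q) 1)" .
  show "u + sconst (gmonom (of_rat q) 1) \<noteq> 0"
      using svar_diff_neq_0[of "p - gmonom (of_rat q) 1"]
    by (simp add: u_def sconst_diff algebra_simps del: svar_neq_sconst)
  show "\<gamma> q \<otimes>\<^bsub>\<Gamma>\<^esub> nv u \<otimes>\<^bsub>\<Gamma>\<^esub> \<gamma> (- q) = nv (u + sconst (gmonom (of_rat q) 1))"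
    unfolding e[symmetric] \<gamma>_def using p svar_diff_neq_0[of p]
    by (simp add: u_def nv_mult skew_mult sconst_gmonom_mem svar_diff_mem)
qed

text \<open>If \<open>u\<close> had greater value than x^-1, then u + x^-1 would have value
  \<open>\<gamma> 1\<close>. As this is the value of a conjugate of \<open>u\<close> by x^-1,
  cancelling \<open>\<gamma> 1\<close> would give \<open>nv u = \<gamma> 1\<close>.\<close>

lemma nv_svar_not_greater:
  assumes p: "p \<in> puiseux" shows "\<not> glt (\<gamma> 1) (nv (svar - sconst p))"
proof
  define u where "u = svar - sconst p"
  assume "glt (\<gamma> 1) (nv (svar - sconst p))"
  then have "glt (nv (sconst (gmonom 1 1))) (nv u)" by (simp add: \<gamma>_def u_def)
  moreover have u: "u \<in> A" "u \<noteq> 0" using p svar_diff_mem svar_diff_neq_0 by (auto simp: u_def)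
  ultimately have "nv (sconst (gmonom 1 1) + u) = \<gamma> 1"
    using nv_dominant(2)[of "sconst (gmonom 1 1)" u] by (simp add: sconst_gmonom_mem vgt_def \<gamma>_def)
  then have "\<gamma> 1 \<otimes>\<^bsub>\<Gamma>\<^esub> nv u \<otimes>\<^bsub>\<Gamma>\<^esub> \<gamma> (- 1) = \<gamma> 1"
    using \<gamma>_conj(2)[OF p, of 1] by (simp add: u_def add.commute)
  then have "\<gamma> 1 \<otimes>\<^bsub>\<Gamma>\<^esub> nv u \<otimes>\<^bsub>\<Gamma>\<^esub> \<gamma> (- 1) \<otimes>\<^bsub>\<Gamma>\<^esub> \<gamma> 1 = \<gamma> 1 \<otimes>\<^bsub>\<Gamma>\<^esub> \<gamma> 1" by simp
  then have "\<gamma> 1 \<otimes>\<^bsub>\<Gamma>\<^esub> nv u = \<gamma> 1 \<otimes>\<^bsub>\<Gamma>\<^esub> \<gamma> 1"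
    using u by (simp add: G.m_assoc \<gamma>_add[symmetric])
  then have "nv u = \<gamma> 1" using u by (simp add: G.l_cancel)
  then show False using \<open>glt (nv (sconst (gmonom 1 1))) (nv u)\<close> by (simp add: \<gamma>_def glt_irrefl)
qed

lemma svar_diff_step:
  "svar - sconst p - of_real r * sconst (gmonom 1 q) = svar - sconst (p + gmonom r q)"
  by (subst (2) gmonom_eq_of_real_mult) (simp add: of_real_eq_sconst sconst_mult sconst_add)

text \<open>The residue of (y - p) / x^-q supplies the next term of the approximation; it is nonzero
  because the value strictly increases.\<close>

lemma nv_svar_step:
  assumes p: "p \<in> puiseux" and q: "nv (svar - sconst p) = \<gamma> q"
  shows "\<exists>r. r \<noteq> 0 \<and> glt (\<gamma> q) (nv (svar - sconst (p + gmonom r q)))"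
proof -
  obtain r where "vgt (\<gamma> q) (svar - sconst p - of_real r * sconst (gmonom 1 q))"
    using residue[of "svar - sconst p" "sconst (gmonom 1 q)"] p q
    by (auto simp: svar_diff_mem svar_diff_neq_0 sconst_gmonom_mem \<gamma>_def)
  then have r: "glt (\<gamma> q) (nv (svar - sconst (p + gmonom r q)))"
    unfolding svar_diff_step by (simp add: vgt_def svar_diff_neq_0)
  then have "r \<noteq> 0" using q glt_irrefl by auto
  then show ?thesis using r by blast
qed

text \<open>Conjugating \<open>u = y - p\<close> by \<open>x\<close> gives \<open>u - x\<^sup>-\<^sup>1\<close>, so that \<open>v u > v (x\<^sup>-\<^sup>1)\<close> is impossible;
  equality is excluded as well, since then \<open>p\<close> could be improved.\<close>

lemma nv_svar_less:
  assumes p: "p \<in> puiseux" shows "glt (nv (svar - sconst p)) (\<gamma> 1)"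
proof -
  have "nv (svar - sconst p) \<noteq> \<gamma> 1"
    using nv_svar_step[OF p] nv_svar_not_greater puiseux_add[OF p puiseux_gmonom] by blast
  then show ?thesis
    using nv_svar_not_greater[OF p] glt_cases[of "nv (svar - sconst p)" "\<gamma> 1"] p svar_diff_mem svar_diff_neq_0
    by auto
qed

text \<open>Because v u < v (x^-1), the term added by conjugation with x^-q does not affect the
  value of u. Only now is it known that \<open>\<gamma> q\<close> and v u commute.\<close>

lemma \<gamma>_commute:
  assumes p: "p \<in> puiseux"
  shows "\<gamma> q \<otimes>\<^bsub>\<Gamma>\<^esub> nv (svar - sconst p) = nv (svar - sconst p) \<otimes>\<^bsub>\<Gamma>\<^esub> \<gamma> q"
proof -
  define u where "u = svar - sconst p"
  have u: "u \<in> A" "u \<noteq> 0" using p svar_diff_mem svar_diff_neq_0 by (auto simp: u_def)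
  have "vgt (nv u) (sconst (gmonom (of_rat q) 1))"
    using nv_svar_less[OF p] by (cases "q = 0") (auto simp: vgt_def nv_gmonom u_def)
  then have "nv (u + sconst (gmonom (of_rat q) 1)) = nv u"
    using u by (intro nv_dominant sconst_gmonom_mem)
  then have "\<gamma> q \<otimes>\<^bsub>\<Gamma>\<^esub> nv u \<otimes>\<^bsub>\<Gamma>\<^esub> \<gamma> (- q) = nv u"
    using \<gamma>_conj(2)[OF p, of q] by (simp add: u_def)
  then have "\<gamma> q \<otimes>\<^bsub>\<Gamma>\<^esub> nv u \<otimes>\<^bsub>\<Gamma>\<^esub> \<gamma> (- q) \<otimes>\<^bsub>\<Gamma>\<^esub> \<gamma> q = nv u \<otimes>\<^bsub>\<Gamma>\<^esub> \<gamma> q" by simp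
  then show ?thesis using u by (simp add: G.m_assoc \<gamma>_add[symmetric] u_def)
qed

end

section \<open>Extensions with a prescribed cut\<close>

instance prod :: (linordered_ab_group_add, linordered_ab_group_add) linordered_ab_group_add
  by standard auto

text \<open>Every cut below 1 is realized in the lexicographic plane: the supremum of the cut places
  the new element up to an infinitesimal, and the second coordinate decides on which side of the
  supremum it lies.\<close>

lemma ex_generic_weights:
  fixes C :: "rat set"
  assumes down: "\<And>p q. q \<in> C \<Longrightarrow> p \<le> q \<Longrightarrow> p \<in> C" and one: "1 \<notin> C"
  shows "\<exists>(\<rho> :: rat \<Rightarrow> real \<times> real) \<kappa>. generic_weights \<rho> \<kappa> \<and> (\<forall>q. \<rho> q < \<kappa> 1 \<longleftrightarrow> q \<in> C)"
proof (cases "C = {}")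
  case True
  \<comment> \<open>For the empty cut y must lie below every power of x, so the two coordinates
    exchange their roles and y is infinitely negative.\<close>
  have "generic_weights (\<lambda>q. (0, of_rat q)) (\<lambda>i. (- of_int i, 0) :: real \<times> real)"
    by unfold_locales (auto simp: of_rat_add of_rat_less)
  then show ?thesis
    using True by (intro exI[of _ "\<lambda>q. (0, of_rat q)"] exI[of _ "\<lambda>i. (- of_int i, 0)"]) auto
next
  case False
  define \<sigma> :: real where "\<sigma> = Sup (of_rat ` C)"
  have bdd: "bdd_above (of_rat ` C :: real set)"
    using down one by (intro bdd_aboveI[of _ 1]) (force simp: not_le intro: less_imp_le)
  have below: "q \<in> C" if lt: "of_rat q < \<sigma>" for q
  proof -
    have "\<exists>x\<in>C. real_of_rat q < of_rat x"
      using less_cSupD[of "of_rat ` C" "real_of_rat q"] lt False by (auto simp: \<sigma>_def)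
    then show ?thesis using down by (auto simp: of_rat_less less_imp_le)
  qed
  have above: "of_rat q \<le> \<sigma>" if "q \<in> C" for q
    unfolding \<sigma>_def by (rule cSup_upper[OF _ bdd]) (use that in auto)
  \<comment> \<open>If the cut has a greatest element, the new value lies just above it; otherwise
    just below the supremum, so that a rational supremum outside the cut stays above the new
    value.\<close>
  define \<epsilon> :: real where "\<epsilon> = (if \<sigma> \<in> of_rat ` C then 1 else - 1)"
  define \<rho> :: "rat \<Rightarrow> real \<times> real" where "\<rho> q = (of_rat q, 0)" for q
  define \<kappa> :: "int \<Rightarrow> real \<times> real" where "\<kappa> i = (of_int i * \<sigma>, of_int i * \<epsilon>)" for i
  have iff: "\<rho> q < \<kappa> 1 \<longleftrightarrow> q \<in> C" for q
  proof (cases "of_rat q = \<sigma>")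
    case True
    then have "\<sigma> \<in> of_rat ` C \<longleftrightarrow> q \<in> C" by (auto simp: image_iff)
    then show ?thesis using True by (simp add: \<rho>_def \<kappa>_def \<epsilon>_def)
  next
    case False
    then show ?thesis using below[of q] above[of q] by (auto simp: \<rho>_def \<kappa>_def)
  qed
  have "\<kappa> 1 \<noteq> \<rho> q" for q by (simp add: \<kappa>_def \<rho>_def \<epsilon>_def)
  moreover have "\<kappa> 1 < \<rho> 1" using iff[of 1] one \<open>\<kappa> 1 \<noteq> \<rho> 1\<close> by (metis linorder_neqE)
  ultimately have "generic_weights \<rho> \<kappa>"
    by unfold_locales (auto simp: \<rho>_def \<kappa>_def of_rat_add of_rat_less distrib_right)
  then show ?thesis using iff by blast
qed

context generic_weights
begin

text \<open>The shift is an injective ring homomorphism fixing the constants, so the Gauss valuation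
  around \<theta> is the one around 0 composed with it.\<close>

lemma ore_valuation_weight: "ore_valuation (\<lambda>f. weight (left_poly (sshift \<theta> f)))"
proof
  fix a b :: "gseries skew_poly"
  assume a: "a \<noteq> 0" and b: "b \<noteq> 0"
  show "weight (left_poly (sshift \<theta> (a * b))) = weight (left_poly (sshift \<theta> a)) + weight (left_poly (sshift \<theta> b))"
    using a b by (simp add: sshift_mult left_poly_mult weight_skew_mult)
  show "min (weight (left_poly (sshift \<theta> a))) (weight (left_poly (sshift \<theta> b)))
      \<le> weight (left_poly (sshift \<theta> (a + b)))" if "a + b \<noteq> 0"
  proof -
    have "left_poly (sshift \<theta> a) + left_poly (sshift \<theta> b) = left_poly (sshift \<theta> (a + b))"
      by (simp add: sshift_add)
    moreover have "left_poly (sshift \<theta> (a + b)) \<noteq> 0" using that by simp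
    ultimately show ?thesis using weight_add[of "left_poly (sshift \<theta> a)" "left_poly (sshift \<theta> b)"] a b by simp
  qed
  assume "weight (left_poly (sshift \<theta> a)) = weight (left_poly (sshift \<theta> b))"
  then obtain r where r: "left_poly (sshift \<theta> a) = smult (of_real r) (left_poly (sshift \<theta> b)) \<or>
      weight (left_poly (sshift \<theta> b))
        < weight (left_poly (sshift \<theta> a) - smult (of_real r) (left_poly (sshift \<theta> b)))"
    using weight_residue a b by (metis left_poly_eq_0_iff sshift_eq_0_iff)
  have e: "left_poly (sshift \<theta> a) - smult (of_real r) (left_poly (sshift \<theta> b))
      = left_poly (sshift \<theta> (a - of_real r * b))"
    by (simp add: sshift_diff sshift_mult of_real_eq_sconst)
  have "left_poly (sshift \<theta> a) = smult (of_real r) (left_poly (sshift \<theta> b)) \<longleftrightarrow> a = of_real r * b"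
    by (metis e eq_iff_diff_eq_0 left_poly_eq_0_iff sshift_eq_0_iff)
  then show "\<exists>r. a = of_real r * b \<or> weight (left_poly (sshift \<theta> b)) < weight (left_poly (sshift \<theta> (a - of_real r * b)))"
    using r unfolding e by blast
next
  fix r :: real assume "r \<noteq> 0"
  then show "weight (left_poly (sshift \<theta> (of_real r))) = 0"
    by (simp add: of_real_eq_sconst weight_const gmonom_at_0[symmetric] gord_gmonom)
qed

end

text \<open>Both valuations are parametrized by one auxiliary group. Since \<phi> and \<psi> induce
  the same order on it, they have the same fibres, and the embedding sends \<open>\<phi> s\<close>
  to \<open>\<psi> s\<close>.\<close>

lemma extends_valuationI:
  fixes \<phi> :: "'s::ab_group_add \<Rightarrow> 'g" and \<psi> :: "'s \<Rightarrow> 'h"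
  assumes \<Gamma>: "ordered_group \<Gamma>" and \<Gamma>': "ordered_group \<Gamma>'"
    and \<phi>: "\<And>s. \<phi> s \<in> carrier \<Gamma>" "\<And>s t. \<phi> (s + t) = \<phi> s \<otimes>\<^bsub>\<Gamma>\<^esub> \<phi> t"
    and \<psi>: "\<And>s. \<psi> s \<in> carrier \<Gamma>'" "\<And>s t. \<psi> (s + t) = \<psi> s \<otimes>\<^bsub>\<Gamma>'\<^esub> \<psi> t"
    and order: "\<And>s t. (\<phi> s, \<phi> t) \<in> le_rel \<Gamma> \<longleftrightarrow> (\<psi> s, \<psi> t) \<in> le_rel \<Gamma>'"
    and zero: "v 0 = None" "w 0 = None"
    and vals: "\<And>a. a \<in> A \<Longrightarrow> a \<noteq> 0 \<Longrightarrow> \<exists>s. v a = Some (\<phi> s) \<and> w a = Some (\<psi> s)"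
  shows "extends_valuation A \<Gamma> v \<Gamma>' w"
proof -
  interpret G: group \<Gamma> using \<Gamma> by (simp add: ordered_group_def)
  have refl: "(\<alpha>, \<alpha>) \<in> le_rel \<Gamma>" if "\<alpha> \<in> carrier \<Gamma>" for \<alpha>
    using \<Gamma> that by (auto simp: ordered_group_def linear_order_on_def partial_order_on_def preorder_on_def refl_on_def)
  have antisym: "\<alpha> = \<beta>" if "(\<alpha>, \<beta>) \<in> le_rel \<Gamma>'" "(\<beta>, \<alpha>) \<in> le_rel \<Gamma>'" for \<alpha> \<beta>
    using \<Gamma>' that unfolding ordered_group_def linear_order_on_def partial_order_on_def antisym_def by blast
  have \<phi>0: "\<phi> 0 = \<one>\<^bsub>\<Gamma>\<^esub>" using \<phi>(2)[of 0 0] \<phi>(1)[of 0] by simp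
  have inv: "inv\<^bsub>\<Gamma>\<^esub> (\<phi> s) = \<phi> (- s)" for s
    using \<phi>(2)[of "- s" s] \<phi>(1) \<phi>0 by (intro G.inv_equality) auto
  have vals': "\<exists>s. \<gamma> = \<phi> s" if "a \<in> A" "v a = Some \<gamma>" for a \<gamma>
    using vals[of a] that zero by (cases "a = 0") auto
  have range: "value_group A \<Gamma> v \<subseteq> range \<phi>"
  proof
    fix \<gamma> assume "\<gamma> \<in> value_group A \<Gamma> v"
    then show "\<gamma> \<in> range \<phi>" unfolding value_group_def
    proof (induction rule: generate.induct)
      case one
      then show ?case using \<phi>0 by (metis rangeI)
    next
      case (incl h)
      then show ?case using vals' by blast
    next
      case (inv h)
      then obtain s where "h = \<phi> s" using vals' by blast
      then show ?case using \<open>\<And>s. inv\<^bsub>\<Gamma>\<^esub> (\<phi> s) = \<phi> (- s)\<close> by auto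
    next
      case (eng h1 h2)
      then show ?case using \<phi>(2) by (metis (no_types, lifting) imageE rangeI)
    qed
  qed
  define \<iota> where "\<iota> \<alpha> = \<psi> (SOME s. \<phi> s = \<alpha>)" for \<alpha>
  have \<iota>: "\<iota> (\<phi> s) = \<psi> s" for s
  proof -
    define t where "t = (SOME t. \<phi> t = \<phi> s)"
    have "\<phi> t = \<phi> s" unfolding t_def by (rule someI[of _ s]) simp
    \<comment> \<open>Independence of the choice: equal \<phi>-values are comparable both ways,
      hence so are the \<psi>-values.\<close>
    then have "(\<psi> t, \<psi> s) \<in> le_rel \<Gamma>'" "(\<psi> s, \<psi> t) \<in> le_rel \<Gamma>'"
      using refl[OF \<phi>(1)[of s]] by (simp_all add: order[symmetric])
    then show ?thesis unfolding \<iota>_def t_def[symmetric] by (rule antisym)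
  qed
  have \<iota>_hom: "\<iota> (\<alpha> \<otimes>\<^bsub>\<Gamma>\<^esub> \<beta>) = \<iota> \<alpha> \<otimes>\<^bsub>\<Gamma>'\<^esub> \<iota> \<beta>" "\<iota> \<alpha> \<in> carrier \<Gamma>'"
    "(\<alpha>, \<beta>) \<in> le_rel \<Gamma> \<longleftrightarrow> (\<iota> \<alpha>, \<iota> \<beta>) \<in> le_rel \<Gamma>'"
    if \<alpha>\<beta>: "\<alpha> \<in> value_group A \<Gamma> v" "\<beta> \<in> value_group A \<Gamma> v" for \<alpha> \<beta>
  proof -
    obtain s t where "\<alpha> = \<phi> s" "\<beta> = \<phi> t" using \<alpha>\<beta> range by blast
    then show "\<iota> (\<alpha> \<otimes>\<^bsub>\<Gamma>\<^esub> \<beta>) = \<iota> \<alpha> \<otimes>\<^bsub>\<Gamma>'\<^esub> \<iota> \<beta>" "\<iota> \<alpha> \<in> carrier \<Gamma>'"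
      "(\<alpha>, \<beta>) \<in> le_rel \<Gamma> \<longleftrightarrow> (\<iota> \<alpha>, \<iota> \<beta>) \<in> le_rel \<Gamma>'"
      using \<psi> order by (simp_all add: \<iota> \<phi>(2)[symmetric])
  qed
  have "w a = map_option \<iota> (v a)" if "a \<in> A" for a
    using vals[OF that] zero \<iota> by (cases "a = 0") auto
  then show ?thesis
    unfolding extends_valuation_def hom_def using \<iota>_hom by (intro bexI[of _ \<iota>]) auto
qed

text \<open>Any injection would do; singletons of the linear polynomials a + b y merely name the
  pairs of reals in the prescribed type.\<close>

definition quot_code :: "real \<times> real \<Rightarrow> gseries skew_poly ore_quot set" where
  "quot_code = (\<lambda>(a, b). {to_quot (sconst (of_real a) + sconst (of_real b) * svar)})"

lemma inj_quot_code: "inj quot_code"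
proof (rule injI)
  fix x y assume "quot_code x = quot_code y"
  moreover obtain a b c d where "x = (a, b)" "y = (c, d)" by (metis surj_pair)
  ultimately have xy: "x = (a, b)" "y = (c, d)"
    and "sconst (of_real a) + sconst (of_real b) * svar
      = sconst (of_real c) + sconst (of_real d) * (svar :: gseries skew_poly)"
    by (auto simp: quot_code_def frac_inj)
  then have "[:of_real a, of_real b:] = [:of_real c, of_real d :: gseries:]"
    by (simp add: skew_poly_eq_iff)
  then show "x = y" by (simp add: xy)
qed

lemma skew_polys_UNIV [simp]: "skew_polys UNIV = UNIV"
  by (simp add: skew_polys_def)


section \<open>Expansions around a transcendental pseudo-limit\<close>

context gauss_weights
begin

text \<open>The element y + s has weight \<open>\<kappa> 1\<close>, and its symbol is T + r, where r
  is the coefficient of s at that weight. As symbols multiply, the shift acts on them as the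
  substitution T -> T + r.\<close>

lemma symb_sshift:
  assumes s: "\<And>a. gcoeff s a \<noteq> 0 \<Longrightarrow> \<kappa> 1 \<le> \<rho> a" and f: "weight_ge M (left_poly f)"
  shows "weight_ge M (left_poly (sshift s f))"
    "symb M (left_poly (sshift s f)) = pcompose (symb M (left_poly f)) [:coeff_at (\<kappa> 1) s, 1:]"
proof -
  let ?z = "svar + sconst s" and ?l = "[:coeff_at (\<kappa> 1) s, 1:]"
  let ?c = "\<lambda>i. coeff (left_poly f) i"
  have z: "weight_ge (\<kappa> 1) (left_poly ?z)"
    unfolding weight_ge_def
    using s by (auto simp: coeff_pCons gcoeff_one split: nat.splits if_splits)
  have at1: "coeff_at 0 1 = 1" using coeff_at_rho[of 0 1] by (simp add: gcoeff_one)
  have sz: "symb (\<kappa> 1) (left_poly ?z) = ?l"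
    by (rule poly_eqI) (auto simp: coeff_symb coeff_pCons at1 split: nat.split)
  have pw: "weight_ge (\<kappa> (int i)) (left_poly (?z ^ i)) \<and> symb (\<kappa> (int i)) (left_poly (?z ^ i)) = ?l ^ i" for i
  proof (induction i)
    case 0
    have "symb 0 1 = 1"
      by (rule poly_eqI) (simp add: coeff_symb at1)
    moreover have "weight_ge 0 1"
      by (auto simp: weight_ge_def gcoeff_one split: if_splits)
    ultimately show ?case by simp
  next
    case (Suc i)
    have e: "\<kappa> (int (Suc i)) = \<kappa> 1 + \<kappa> (int i)" using kappa_add[of 1 "int i"] by simp
    show ?case
      unfolding e power_Suc left_poly_mult using symb_skew_mult[OF z] Suc sz by simp
  qed
  have t: "left_poly (sshift s f) = (\<Sum>i\<le>degree (left_poly f). smult (?c i) (left_poly (?z ^ i)))"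
    by (simp add: sshift_def seval_def left_poly_sum)
  have e: "M = (M - \<kappa> (int i)) + \<kappa> (int i)" for i by simp
  have w: "weight_ge M (smult (?c i) (left_poly (?z ^ i)))" for i
    by (subst e[of i], rule weight_ge_smult) (use weight_geD[OF f] pw in auto)
  then show "weight_ge M (left_poly (sshift s f))" unfolding t by (intro weight_ge_sum)
  have "symb M (smult (?c i) (left_poly (?z ^ i))) = smult (coeff_at (M - \<kappa> (int i)) (?c i)) (?l ^ i)" for i
    by (subst e[of i], subst symb_smult) (use weight_geD[OF f] pw in auto)
  moreover have "pcompose (monom c i) ?l = smult c (?l ^ i)" for c i
    by (induction i) (simp_all add: monom_0 monom_Suc pcompose_pCons)
  ultimately show "symb M (left_poly (sshift s f)) = pcompose (symb M (left_poly f)) ?l"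
    unfolding t symb_sum by (simp add: symb_def[of M "left_poly f"] pcompose_sum)
qed

end

lemma skew_polys_puiseux_exps:
  assumes "f \<in> skew_polys puiseux" obtains n where "n \<ge> 1" "f \<in> skew_polys {a. supp a \<subseteq> exps n}"
proof -
  have "\<exists>n\<ge>1. \<forall>i<m. supp (coeff (left_poly f) i) \<subseteq> exps n" for m
  proof (induction m)
    case 0
    then show ?case by auto
  next
    case (Suc m)
    then obtain n where n: "n \<ge> 1" "\<And>i. i < m \<Longrightarrow> supp (coeff (left_poly f) i) \<subseteq> exps n" by blast
    have "coeff (left_poly f) m \<in> puiseux" using assms by (simp add: skew_polys_def)
    then obtain k where k: "k \<ge> 1" "supp (coeff (left_poly f) m) \<subseteq> exps k" unfolding puiseux_iff by blast
    have "supp (coeff (left_poly f) i) \<subseteq> exps (n * k)" if "i < Suc m" for i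
    proof (cases "i = m")
      case True
      then show ?thesis using k(2) exps_mono(2)[of k n] by blast
    next
      case False
      then have "i < m" using that by simp
      then show ?thesis using n(2) exps_mono(1)[of n k] by blast
    qed
    moreover have "n * k \<ge> 1" using n k by simp
    ultimately show ?case by blast
  qed
  then obtain n where n: "n \<ge> 1" "\<And>i. i < Suc (degree (left_poly f)) \<Longrightarrow> supp (coeff (left_poly f) i) \<subseteq> exps n"
    by blast
  have "supp (coeff (left_poly f) i) \<subseteq> exps n" for i
    using n(2)[of i] by (cases "i \<le> degree (left_poly f)") (auto simp: coeff_eq_0)
  then show ?thesis using that n(1) by (auto simp: skew_polys_def)
qed

lemma monom_shift_coeffs:
  fixes g :: "real poly"
  assumes g: "pcompose g [:r, 1:] = monom c (Suc d)" and c: "c \<noteq> 0" and r: "r \<noteq> 0"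
  shows "coeff g d \<noteq> 0" "coeff g (Suc d) \<noteq> 0"
proof -
  have "pcompose [:r, 1:] [:- r, 1:] = [:0, 1:]" by (simp add: pcompose_pCons)
  then have "g = pcompose (pcompose g [:r, 1:]) [:- r, 1:]" by (simp add: pcompose_assoc[symmetric])
  moreover have "pcompose (monom c i) [:- r, 1:] = smult c ([:- r, 1:] ^ i)" for i
    by (induction i) (simp_all add: monom_0 monom_Suc pcompose_pCons)
  ultimately have "g = smult c ([:- r, 1:] ^ Suc d)" unfolding g by simp
  then have "coeff g i = c * (of_nat (Suc d choose i) * (- r) ^ (Suc d - i))" if "i \<le> Suc d" for i
    using coeff_linear_poly_power[OF that, of "- r" 1] by (simp del: power_Suc)
  from this[of d] this[of "Suc d"] show "coeff g d \<noteq> 0" "coeff g (Suc d) \<noteq> 0"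
    using c r by (simp_all del: of_nat_Suc)
qed

text \<open>The Newton--Puiseux argument: passing from one approximation to the next, the degree of the
  symbol does not increase. If it stays constant and positive, then the symbol is \<open>c (T - r)\<^sup>d\<close>, whose
  coefficient at \<open>d - 1\<close> is nonzero because the characteristic is zero; so the next exponent lies in the group
  generated by the exponents of the coefficients, and all exponents have a common denominator.\<close>

lemma ex_constant_expansion:
  fixes q :: "nat \<Rightarrow> rat" and r :: "nat \<Rightarrow> real" and P :: "nat \<Rightarrow> gseries"
  defines "h \<equiv> \<lambda>k f. left_poly (sshift (P k) f)"
  assumes P0: "P 0 = 0" and P_Suc: "\<And>k. P (Suc k) = P k + gmonom (r k) (q k)"
    and r: "\<And>k. r k \<noteq> 0" and mono: "\<And>k. q k < q (Suc k)" and less1: "\<And>k. q k < 1"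
    and f: "f \<in> skew_polys puiseux" "f \<noteq> 0"
  shows "\<exists>k. coeff (h k f) 0 \<noteq> 0 \<and> (\<forall>j>0. coeff (h k f) j \<noteq> 0 \<longrightarrow>
    gord (coeff (h k f) 0) < gord (coeff (h k f) j) + of_nat j * q k)"
proof -
  define F where "F k = sshift (P k) f" for k
  have F_Suc: "F (Suc k) = sshift (gmonom (r k) (q k)) (F k)" for k
    by (simp add: F_def P_Suc sshift_sshift add.commute)
  have F0: "left_poly (F k) \<noteq> 0" for k using f by (simp add: F_def)
  \<comment> \<open>At stage \<open>k\<close> the variable gets the weight \<open>q k\<close>. These
    weights are not generic: several monomials may share a weight, and the symbol records one side
    of the Newton polygon.\<close>
  interpret w: gauss_weights "\<lambda>x::rat. x" "\<lambda>i. of_int i * q k" for k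
    by unfold_locales (simp_all add: less1 distrib_right)
  note [simp del] = w.rho_0 w.rho_less_iff w.rho_le_iff w.rho_eq_iff
  have coeff_at: "w.coeff_at \<mu> b = gcoeff b \<mu>" for \<mu> b
    by (rule w.coeff_at_rho)
  define M where "M k = w.weight k (left_poly (F k))" for k
  define g where "g k = w.symb k (M k) (left_poly (F k))" for k
  have g_coeff: "coeff (g k) i = gcoeff (coeff (left_poly (F k)) i) (M k - of_nat i * q k)" for k i
    by (simp add: g_def w.coeff_symb coeff_at)
  have wge: "w.weight_ge k (M k) (left_poly (F k))" for k unfolding M_def by (rule w.weight_ge_weight)
  have g0: "g k \<noteq> 0" for k unfolding g_def M_def using F0 by (rule w.symb_weight_neq_0)
  \<comment> \<open>The symbol of the next expansion, still measured with the old weight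
    \<open>q k\<close>; \<open>g (Suc k)\<close> uses the new weight.\<close>
  define g' where "g' k = pcompose (g k) [:r k, 1:]" for k
  have supp_step: "q k \<le> a" if "gcoeff (gmonom (r k) (q k)) a \<noteq> 0" for k a
    using that by (auto simp: gcoeff_gmonom split: if_splits)
  have wge': "w.weight_ge k (M k) (left_poly (F (Suc k)))" for k
    unfolding F_Suc by (rule w.symb_sshift(1)) (use supp_step wge in auto)
  have g'_eq: "g' k = w.symb k (M k) (left_poly (F (Suc k)))" for k
    unfolding F_Suc g'_def g_def
    by (subst w.symb_sshift(2)) (use supp_step wge in \<open>auto simp: coeff_at gcoeff_gmonom\<close>)
  have g'0: "g' k \<noteq> 0" and deg_g': "degree (g' k) = degree (g k)" for k
    using g0[of k] by (simp_all add: g'_def pcompose_eq_0_iff degree_pcompose)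
  \<comment> \<open>Raising the weight of the variable penalizes T^i more than T^e when i > e. So
    once T^e occurs at the old least weight, no higher power can attain the new one.\<close>
  have step: "degree (g (Suc k)) \<le> e" if e: "coeff (g' k) e \<noteq> 0" for k e
  proof (rule degree_le, intro allI impI)
    fix i assume i: "e < i"
    have "gcoeff (coeff (left_poly (F (Suc k))) e) (M k - of_nat e * q k) \<noteq> 0"
      using e by (simp add: g'_eq w.coeff_symb coeff_at)
    then have 1: "M (Suc k) \<le> M k - of_nat e * q k + of_nat e * q (Suc k)"
      using wge[of "Suc k"] unfolding w.weight_ge_def by fastforce
    show "coeff (g (Suc k)) i = 0"
    proof (rule ccontr)
      assume "coeff (g (Suc k)) i \<noteq> 0"
      then have "M k \<le> M (Suc k) - of_nat i * q (Suc k) + of_nat i * q k"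
        using wge'[of k] unfolding g_coeff w.weight_ge_def by fastforce
      with 1 have "of_nat i * (q (Suc k) - q k) \<le> of_nat e * (q (Suc k) - q k)"
        by (simp add: algebra_simps)
      then show False using i mono[of k] by simp
    qed
  qed
  define D where "D k = degree (g k)" for k
  have D_Suc: "D (Suc k) \<le> D k" for k
  proof -
    have "degree (g (Suc k)) \<le> degree (g' k)" by (rule step) (simp add: g'0)
    then show ?thesis by (simp add: D_def deg_g')
  qed
  have D_mono: "D k \<le> D j" if "j \<le> k" for j k
    using that D_Suc by (rule lift_Suc_antimono_le[rotated])
  obtain K where K: "\<And>k. D K \<le> D k"
    using ex_has_least_nat[of "\<lambda>_. True" 0 D] by blast
  have D_const: "D k = D K" if "K \<le> k" for k
    using K[of k] D_mono[OF that] by simp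
  have "D K = 0"
  proof (rule ccontr)
    assume "D K \<noteq> 0"
    then obtain d where d: "D K = Suc d" by (metis not0_implies_Suc)
    have two: "coeff (g k) d \<noteq> 0" "coeff (g k) (Suc d) \<noteq> 0" if k: "K \<le> k" for k
    proof -
      have dg: "degree (g' k) = Suc d" using D_const[OF k] d by (simp add: D_def deg_g')
      \<comment> \<open>A lower power in \<open>g' k\<close> would make the next degree drop,
        against the minimality of \<open>D K\<close>.\<close>
      have low: "coeff (g' k) i = 0" if "i < Suc d" for i
        using step[of k i] D_const[of "Suc k"] k d that by (auto simp: D_def)
      then have "g' k = monom (lead_coeff (g' k)) (Suc d)"
        using low dg by (intro poly_eqI) (metis coeff_eq_0 coeff_monom linorder_cases)
      then show "coeff (g k) d \<noteq> 0" "coeff (g k) (Suc d) \<noteq> 0"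
        using monom_shift_coeffs[of "g k" "r k" "lead_coeff (g' k)" d] g'0[of k] r[of k]
        by (auto simp: g'_def[symmetric])
    qed
    have "P k \<in> puiseux" for k
      by (induction k) (use puiseux_of_real[of 0] in \<open>auto simp: P0 P_Suc intro: puiseux_add puiseux_gmonom\<close>)
    then have "F K \<in> skew_polys puiseux"
      unfolding F_def using diff_subring.skew_sshift[OF diff_subring_puiseux] f by blast
    then obtain n where n: "n \<ge> 1" "F K \<in> skew_polys {a. supp a \<subseteq> exps n}"
      by (rule skew_polys_puiseux_exps)
    have q_exps: "q k \<in> exps n" if k: "K \<le> k" "F k \<in> skew_polys {a. supp a \<subseteq> exps n}" for k
    proof -
      \<comment> \<open>Both numbers are exponents occurring in neighbouring coefficients of
        \<open>F k\<close>; their difference is \<open>q k\<close>.\<close>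
      have "M k - of_nat d * q k \<in> exps n" "M k - of_nat (Suc d) * q k \<in> exps n"
        using k(2) two[OF k(1)] unfolding g_coeff skew_polys_def by blast+
      then have "(M k - of_nat d * q k) - (M k - of_nat (Suc d) * q k) \<in> exps n" by (rule exps_diff)
      then show ?thesis by (simp add: algebra_simps)
    qed
    have FK: "F (K + k) \<in> skew_polys {a. supp a \<subseteq> exps n}" for k
    proof (induction k)
      case (Suc k)
      have "gmonom (r (K + k)) (q (K + k)) \<in> {a. supp a \<subseteq> exps n}"
        using q_exps[of "K + k"] Suc by (auto simp: gcoeff_gmonom split: if_splits)
      then show ?case
        using diff_subring.skew_sshift[OF diff_subring_exps] Suc by (simp add: F_Suc)
    qed (use n in simp)
    show False
    proof (rule exps_no_bounded_sequence[OF n(1)])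
      show "q (K + k) \<in> exps n" for k using q_exps FK by simp
      show "q (K + k) < q (K + Suc k)" for k using mono by simp
      show "q (K + k) < 1" for k by (rule less1)
    qed
  qed
  then have deg0: "coeff (g K) j = 0" if "j > 0" for j
    using that by (simp add: D_def coeff_eq_0)
  \<comment> \<open>The symbol is a nonzero constant, so the constant coefficient alone attains the
    least weight.\<close>
  have "coeff (g K) 0 \<noteq> 0" using g0[of K] deg0 by (metis gr0I leading_coeff_0_iff)
  then have c0: "gcoeff (coeff (left_poly (F K)) 0) (M K) \<noteq> 0" by (simp add: g_coeff)
  then have c0': "coeff (left_poly (F K)) 0 \<noteq> 0" by auto
  have "gord (coeff (left_poly (F K)) 0) \<le> M K" using gord(2)[OF c0' c0] .
  moreover have "M K < gord (coeff (left_poly (F K)) j) + of_nat j * q K"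
    if j: "j > 0" "coeff (left_poly (F K)) j \<noteq> 0" for j
  proof -
    define a where "a = gord (coeff (left_poly (F K)) j)"
    have a: "gcoeff (coeff (left_poly (F K)) j) a \<noteq> 0" using gord(1)[OF j(2)] by (simp add: a_def)
    then have "M K \<le> a + of_nat j * q K" using wge[of K] unfolding w.weight_ge_def by fastforce
    moreover have "M K \<noteq> a + of_nat j * q K"
    proof
      assume "M K = a + of_nat j * q K"
      then have "coeff (g K) j = gcoeff (coeff (left_poly (F K)) j) a" by (simp add: g_coeff)
      then show False using a deg0[OF j(1)] by simp
    qed
    ultimately show ?thesis by (simp add: a_def)
  qed
  ultimately have "gord (coeff (left_poly (F K)) 0) < gord (coeff (left_poly (F K)) j) + of_nat j * q K"
    if "j > 0" "coeff (left_poly (F K)) j \<noteq> 0" for j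
    using that by (meson le_less_trans)
  then show ?thesis
    using c0' unfolding h_def F_def by blast
qed

section \<open>The extension theorem\<close>

context generic_weights
begin

definition shifted_val :: "('v \<Rightarrow> 'h) \<Rightarrow> gseries \<Rightarrow> gseries skew_poly \<Rightarrow> 'h option" where
  "shifted_val e \<theta> f = (if f = 0 then None else Some (e (weight (left_poly (sshift \<theta> f)))))"

lemma valuation_shifted_val:
  assumes "inj e"
  shows "valuation (skew_polys UNIV) (copy_group e) (shifted_val e \<theta>)"
    and "ore_real_residue_field (skew_polys UNIV) (copy_group e) (shifted_val e \<theta>)"
  using ore_valuation.valuation_copy[OF ore_valuation_weight assms, of \<theta>]
    ore_valuation.ore_real_residue_field_copy[OF ore_valuation_weight assms, of \<theta>]
  by (simp_all add: shifted_val_def[abs_def])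

lemma weight_linear:
  assumes b: "b \<noteq> 0" "\<rho> (gord b) < \<kappa> 1" shows "weight [:b, 1:] = \<rho> (gord b)"
proof (rule weight_eqI)
  show "weight_ge (\<rho> (gord b)) [:b, 1:]"
    unfolding weight_ge_def using b gord(2)[OF b(1)]
    by (auto simp: coeff_pCons gcoeff_one split: nat.splits if_splits)
  have "coeff (symb (\<rho> (gord b)) [:b, 1:]) 0 \<noteq> 0" using gord(1)[OF b(1)] by (simp add: coeff_symb)
  then show "symb (\<rho> (gord b)) [:b, 1:] \<noteq> 0" by auto
qed

end

lemma (in group) commutes_int_pow:
  assumes c: "x \<otimes> y = y \<otimes> x" and x: "x \<in> carrier G" and y: "y \<in> carrier G"
  shows "x [^] (i::int) \<otimes> y = y \<otimes> x [^] i"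
proof -
  have nat: "x [^] (n::nat) \<otimes> y = y \<otimes> x [^] n" for n
    by (rule group_commutes_pow[OF c x y])
  have inv: "inv z \<otimes> y = y \<otimes> inv z" if z: "z \<in> carrier G" "z \<otimes> y = y \<otimes> z" for z
  proof -
    have "inv z \<otimes> y = inv z \<otimes> (y \<otimes> z) \<otimes> inv z" using y z(1) by (simp add: m_assoc)
    also have "\<dots> = y \<otimes> inv z" unfolding z(2)[symmetric] using y z(1) by (simp add: m_assoc[symmetric])
    finally show ?thesis .
  qed
  show ?thesis
    by (cases i rule: int_cases2) (use nat inv x in \<open>simp_all add: int_pow_int int_pow_neg_int\<close>)
qed

context skew_valuation
begin

text \<open>The fraction a b^-1 has value 0, so surjectivity onto the residue ring yields a real
  \<open>r\<close> with a b^-1 - r in the valuation ideal. Multiplying by \<open>b\<close> on the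
  right clears the denominator.\<close>

lemma residue_of_quotient:
  assumes R: "ore_real_residue_field A \<Gamma> v"
    and a: "a \<in> A" "a \<noteq> 0" and b: "b \<in> A" "b \<noteq> 0" and eq: "nv a = nv b"
  shows "\<exists>r. vgt (nv b) (a - of_real r * b)"
proof -
  obtain V where V: "valuation (fractions A) \<Gamma> V" "\<And>a. a \<in> A \<Longrightarrow> V (to_quot a) = v a"
    and res: "real_residue_field (fractions A) \<Gamma> V"
    using R unfolding ore_real_residue_field_def by blast
  define R where "R = valuation_ring (fractions A) \<Gamma> V"
  define I where "I = valuation_ideal (fractions A) \<Gamma> V"
  have to_quot_mem: "to_quot c \<in> fractions A" if "c \<in> A" for c
    using that skew_1 zero_neq_one unfolding fractions_def by (metis (mono_tags, lifting) mem_Collect_eq)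
  have V_mult: "V (x * y) = val_add \<Gamma> (V x) (V y)" if "x \<in> fractions A" "y \<in> fractions A" for x y
    using V(1) that unfolding valuation_def by blast
  have V_closed: "V x = None \<or> (\<exists>\<alpha>\<in>carrier \<Gamma>. V x = Some \<alpha>)" if "x \<in> fractions A" for x
    using V(1) that unfolding valuation_def by blast
  have V_0: "V x = None \<longleftrightarrow> x = 0" if "x \<in> fractions A" for x
    using V(1) that by (simp add: valuation_def)
  have coset: "I +>\<^bsub>R\<^esub> x = {h + x | h. h \<in> I}" for x
    by (auto simp: a_r_coset_def r_coset_def R_def valuation_ring_def ring_of_type_algebra_def)
  have zero: "0 \<in> I"
  proof -
    have "0 \<in> fractions A" using to_quot_mem[OF skew_0] by (simp add: zero_ore_quot_def)
    then show ?thesis using V_0[of 0] by (simp add: I_def valuation_ideal_def)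
  qed
  define x where "x = ore_frac a b"
  have x: "x \<in> fractions A" using a b by (auto simp: x_def fractions_def)
  have "x \<noteq> 0" using a b by (simp add: x_def frac_eq_0_iff)
  then obtain \<alpha> where \<alpha>: "\<alpha> \<in> carrier \<Gamma>" "V x = Some \<alpha>" using V_closed[OF x] V_0[OF x] by auto
  have "x * to_quot b = to_quot a" using b by (simp add: x_def frac_mult_chain)
  then have "Some (nv a) = val_add \<Gamma> (V x) (Some (nv b))"
    using V_mult[OF x to_quot_mem[OF b(1)]] V(2) a b by (simp add: v_eq)
  then have "\<alpha> \<otimes>\<^bsub>\<Gamma>\<^esub> nv b = nv b" using \<alpha> eq by simp
  then have "\<alpha> = \<one>\<^bsub>\<Gamma>\<^esub>" using \<alpha> b by simp
  then have "x \<in> carrier R" using x \<alpha> by (simp add: R_def valuation_ring_def gle_refl)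
  then have "I +>\<^bsub>R\<^esub> x \<in> carrier (R Quot I)" by (auto simp: FactRing_def A_RCOSETS_def')
  moreover have "carrier (R Quot I) = range (\<lambda>r. I +>\<^bsub>R\<^esub> of_real r)"
    using res unfolding real_residue_field_def R_def[symmetric] I_def[symmetric] ring_iso_def bij_betw_def
    by (simp add: ring_of_type_algebra_def)
  ultimately obtain r where r: "I +>\<^bsub>R\<^esub> x = I +>\<^bsub>R\<^esub> of_real r" by auto
  have "0 + x \<in> I +>\<^bsub>R\<^esub> x" unfolding coset[of x] using zero by blast
  then have "0 + x \<in> {h + of_real r | h. h \<in> I}" unfolding r coset[of "of_real r"] .
  then obtain h where h: "h \<in> I" "x = h + of_real r" by auto
  have hF: "h \<in> fractions A" and hV: "val_le \<Gamma> (Some \<one>\<^bsub>\<Gamma>\<^esub>) (V h)" "V h \<noteq> Some \<one>\<^bsub>\<Gamma>\<^esub>"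
    using h(1) by (auto simp: I_def valuation_ideal_def)
  have "h = ore_frac (a - of_real r * b) b"
  proof -
    have "of_real r = ore_frac (of_real r * b) b"
      using frac_scale[OF b(2), of 1 "of_real r"] by (simp add: of_real_quot)
    then have "ore_frac (a - of_real r * b) b + of_real r = x"
      using frac_add[OF b(2), of "a - of_real r * b" "of_real r * b"] by (simp add: x_def)
    then show ?thesis using h(2) by (metis add_right_cancel)
  qed
  then have d: "to_quot (a - of_real r * b) = h * to_quot b" using b by (simp add: frac_mult_chain)
  have dA: "a - of_real r * b \<in> A" using a b by (intro skew_diff skew_mult skew_of_real)
  have "vgt (nv b) (a - of_real r * b)"
  proof (cases "a - of_real r * b = 0")
    case True
    then show ?thesis by (simp add: vgt_def)
  next
    case False
    have "Some (nv (a - of_real r * b)) = val_add \<Gamma> (V h) (Some (nv b))"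
      using V(2)[OF dA] V_mult[OF hF to_quot_mem[OF b(1)]] V(2)[OF b(1)] dA b False d by (simp add: v_eq)
    then obtain \<beta> where \<beta>: "V h = Some \<beta>" "nv (a - of_real r * b) = \<beta> \<otimes>\<^bsub>\<Gamma>\<^esub> nv b"
      by (cases "V h") auto
    then have "glt \<one>\<^bsub>\<Gamma>\<^esub> \<beta>" using hV by (auto simp: glt_def)
    from glt_mult_right[OF this, of "nv b"] show ?thesis using \<beta> b by (simp add: vgt_def)
  qed
  then show ?thesis ..
qed

end

context puiseux_valuation
begin

abbreviation "extendable \<equiv> (\<exists>(\<Gamma>' :: gseries skew_poly ore_quot set ogroup) w.
    valuation (skew_polys UNIV) \<Gamma>' w \<and> ore_real_residue_field (skew_polys UNIV) \<Gamma>' w \<and>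
    extends_valuation A \<Gamma> v \<Gamma>' w)"

lemma \<gamma>_pow: "\<gamma> q [^]\<^bsub>\<Gamma>\<^esub> (n::nat) = \<gamma> (of_nat n * q)"
  by (induction n) (simp_all add: \<gamma>_add[symmetric] algebra_simps)

text \<open>Values are parametrized by pairs (q, i), standing for \<open>\<gamma> q\<close> times
  the i-th power of \<omega>. Since \<omega> lies outside the range of \<gamma>, the positive pairs
  form a slope cone, and the model weights are chosen with the same cut.\<close>

lemma extendable_if_new_value:
  assumes p: "p \<in> puiseux" and notin: "nv (svar - sconst p) \<notin> range \<gamma>"
  shows extendable
proof -
  define \<omega> where "\<omega> = nv (svar - sconst p)"
  have \<omega> [simp]: "\<omega> \<in> carrier \<Gamma>" using p svar_diff_mem svar_diff_neq_0 by (simp add: \<omega>_def)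
  define C where "C = {q. glt (\<gamma> q) \<omega>}"
  have "1 \<notin> C" using nv_svar_less[OF p] glt_asym by (auto simp: C_def \<omega>_def)
  moreover have "p \<in> C" if "q \<in> C" "p \<le> q" for p q
    using that \<gamma>_strict[of p q] glt_trans by (cases "p = q") (auto simp: C_def)
  ultimately obtain \<rho> :: "rat \<Rightarrow> real \<times> real" and \<kappa>
    where gw: "generic_weights \<rho> \<kappa>" and cut: "\<And>q. \<rho> q < \<kappa> 1 \<longleftrightarrow> q \<in> C"
    using ex_generic_weights[of C] by blast
  interpret W: generic_weights \<rho> \<kappa> by (rule gw)
  define \<phi> where "\<phi> q i = \<gamma> q \<otimes>\<^bsub>\<Gamma>\<^esub> \<omega> [^]\<^bsub>\<Gamma>\<^esub> (i::int)" for q i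
  have \<phi>_closed [simp]: "\<phi> q i \<in> carrier \<Gamma>" for q i by (simp add: \<phi>_def)
  have \<phi>_add: "\<phi> (q + q') (i + j) = \<phi> q i \<otimes>\<^bsub>\<Gamma>\<^esub> \<phi> q' j" for q q' i j
  proof -
    \<comment> \<open>Additivity of \<phi> is where commutativity in the value group is
      needed.\<close>
    have "\<omega> [^]\<^bsub>\<Gamma>\<^esub> i \<otimes>\<^bsub>\<Gamma>\<^esub> \<gamma> q' = \<gamma> q' \<otimes>\<^bsub>\<Gamma>\<^esub> \<omega> [^]\<^bsub>\<Gamma>\<^esub> i"
      using \<gamma>_commute[OF p, of q'] by (intro G.commutes_int_pow) (simp_all add: \<omega>_def[symmetric])
    then have "\<gamma> q \<otimes>\<^bsub>\<Gamma>\<^esub> (\<omega> [^]\<^bsub>\<Gamma>\<^esub> i \<otimes>\<^bsub>\<Gamma>\<^esub> \<gamma> q') \<otimes>\<^bsub>\<Gamma>\<^esub> \<omega> [^]\<^bsub>\<Gamma>\<^esub> j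
        = \<gamma> q \<otimes>\<^bsub>\<Gamma>\<^esub> (\<gamma> q' \<otimes>\<^bsub>\<Gamma>\<^esub> \<omega> [^]\<^bsub>\<Gamma>\<^esub> i) \<otimes>\<^bsub>\<Gamma>\<^esub> \<omega> [^]\<^bsub>\<Gamma>\<^esub> j" by simp
    then show ?thesis by (simp add: \<phi>_def \<gamma>_add G.int_pow_mult G.m_assoc)
  qed
  have \<phi>_0: "\<phi> q 0 = \<gamma> q" for q by (simp add: \<phi>_def)
  have \<phi>_neg: "\<phi> q i \<otimes>\<^bsub>\<Gamma>\<^esub> \<phi> (- q) (- i) = \<one>\<^bsub>\<Gamma>\<^esub>" for q i
    using \<phi>_add[of q "- q" i "- i"] by (simp add: \<phi>_0)
  have \<phi>_less: "glt (\<phi> q i) (\<phi> q' j) \<longleftrightarrow> glt \<one>\<^bsub>\<Gamma>\<^esub> (\<phi> (q' - q) (j - i))" for q q' i j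
  proof
    assume "glt (\<phi> q i) (\<phi> q' j)"
    from glt_mult_right[OF this \<phi>_closed[of "- q" "- i"]] show "glt \<one>\<^bsub>\<Gamma>\<^esub> (\<phi> (q' - q) (j - i))"
      by (simp add: \<phi>_neg \<phi>_add[symmetric] \<phi>_0)
  next
    assume "glt \<one>\<^bsub>\<Gamma>\<^esub> (\<phi> (q' - q) (j - i))"
    from glt_mult_right[OF this \<phi>_closed[of q i]] show "glt (\<phi> q i) (\<phi> q' j)"
      by (simp add: \<phi>_add[symmetric])
  qed
  have at_1: "glt \<one>\<^bsub>\<Gamma>\<^esub> (\<phi> q 1) \<longleftrightarrow> glt (\<gamma> (- q)) \<omega>" for q
    using \<phi>_less[of "- q" 0 0 1] by (simp add: \<phi>_0) (simp add: \<phi>_def)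
  have "slope_cone (\<lambda>q i. glt \<one>\<^bsub>\<Gamma>\<^esub> (\<phi> q i))"
    unfolding slope_cone_def
  proof (intro conjI allI impI notI)
    fix q q' i j assume "glt \<one>\<^bsub>\<Gamma>\<^esub> (\<phi> q i)" "glt \<one>\<^bsub>\<Gamma>\<^esub> (\<phi> q' j)"
    from glt_mult[OF this] show "glt \<one>\<^bsub>\<Gamma>\<^esub> (\<phi> (q + q') (i + j))" by (simp add: \<phi>_add)
  next
    fix q i assume "glt \<one>\<^bsub>\<Gamma>\<^esub> (\<phi> q i) \<and> glt \<one>\<^bsub>\<Gamma>\<^esub> (\<phi> (- q) (- i))"
    then have "glt (\<one>\<^bsub>\<Gamma>\<^esub> \<otimes>\<^bsub>\<Gamma>\<^esub> \<one>\<^bsub>\<Gamma>\<^esub>) (\<phi> q i \<otimes>\<^bsub>\<Gamma>\<^esub> \<phi> (- q) (- i))" by (intro glt_mult) auto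
    then show False by (simp add: \<phi>_neg glt_irrefl)
  next
    fix q show "glt \<one>\<^bsub>\<Gamma>\<^esub> (\<phi> q 0) \<longleftrightarrow> 0 < q"
      using \<gamma>_less_iff[of 0 q] by (simp add: \<phi>_0)
  next
    fix q
    have "\<gamma> (- q) \<noteq> \<omega>" using notin unfolding \<omega>_def by (metis rangeI)
    then consider "glt (\<gamma> (- q)) \<omega>" | "glt \<omega> (\<gamma> (- q))" using glt_cases[of "\<gamma> (- q)" \<omega>] by auto
    then show "glt \<one>\<^bsub>\<Gamma>\<^esub> (\<phi> q 1) \<or> glt \<one>\<^bsub>\<Gamma>\<^esub> (\<phi> (- q) (- 1))"
    proof cases
      case 2
      then have "glt (\<phi> 0 1) (\<phi> (- q) 0)" by (simp add: \<phi>_0) (simp add: \<phi>_def)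
      then show ?thesis using \<phi>_less[of 0 1 "- q" 0] by simp
    qed (simp add: at_1)
  qed
  moreover have "glt \<one>\<^bsub>\<Gamma>\<^esub> (\<phi> q 1) \<longleftrightarrow> 0 < \<rho> q + \<kappa> 1" for q
  proof -
    have "\<kappa> 1 - \<rho> (- q) = \<rho> q + \<kappa> 1" by (simp add: W.rho_minus add.commute)
    then show ?thesis using cut[of "- q"] unfolding at_1 by (metis C_def diff_gt_0_iff_gt mem_Collect_eq)
  qed
  ultimately have cone: "glt \<one>\<^bsub>\<Gamma>\<^esub> (\<phi> q i) \<longleftrightarrow> 0 < \<rho> q + \<kappa> i" for q i
    by (rule slope_cone_eq[OF _ W.slope_cone_weights])
  have less: "glt (\<phi> q i) (\<phi> q' j) \<longleftrightarrow> \<rho> q + \<kappa> i < \<rho> q' + \<kappa> j" for q q' i j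
  proof -
    have "\<rho> (q' - q) + \<kappa> (j - i) = (\<rho> q' + \<kappa> j) - (\<rho> q + \<kappa> i)"
      by (simp add: W.rho_diff W.kappa_diff algebra_simps)
    then show ?thesis unfolding \<phi>_less cone by simp
  qed
  have vals: "nv f = \<phi> (gord (coeff h i)) (int i)"
    if f: "f \<in> A" and h: "h = left_poly (sshift p f)" and i: "coeff h i \<noteq> 0"
      "W.weight h = \<rho> (gord (coeff h i)) + \<kappa> (int i)" for f h i
  proof -
    have hK: "coeff h j \<in> puiseux" for j
      using skew_sshift[OF p f] by (simp add: h skew_polys_def)
    have \<phi>_eq: "nv (sconst (coeff h j)) \<otimes>\<^bsub>\<Gamma>\<^esub> \<omega> [^]\<^bsub>\<Gamma>\<^esub> j = \<phi> (gord (coeff h j)) (int j)"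
      if "coeff h j \<noteq> 0" for j
      using nv_sconst[OF hK that] by (simp add: \<phi>_def int_pow_int)
    have "nv f = nv (sconst (coeff h i)) \<otimes>\<^bsub>\<Gamma>\<^esub> \<omega> [^]\<^bsub>\<Gamma>\<^esub> i"
      unfolding \<omega>_def h
    proof (rule nv_expansion[OF f p])
      show "coeff (left_poly (sshift p f)) i \<noteq> 0" using i h by simp
      fix j assume j: "j \<noteq> i" "coeff (left_poly (sshift p f)) j \<noteq> 0"
      then have cj: "coeff h j \<noteq> 0" by (simp add: h)
      have "W.weight h \<le> \<rho> (gord (coeff h j)) + \<kappa> (int j)"
        using W.weight_ge_weight[of h] gord(1)[OF cj] unfolding W.weight_ge_def by blast
      \<comment> \<open>Genericity makes the minimum strict, so exactly one monomial of the
        expansion determines the value of f.\<close>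
      moreover have "W.weight h \<noteq> \<rho> (gord (coeff h j)) + \<kappa> (int j)"
        unfolding i(2) W.weights_eq_iff using j by simp
      ultimately have "glt (\<phi> (gord (coeff h i)) (int i)) (\<phi> (gord (coeff h j)) (int j))"
        unfolding less using i(2) by simp
      then show "glt (nv (sconst (coeff (left_poly (sshift p f)) i)) \<otimes>\<^bsub>\<Gamma>\<^esub> nv (svar - sconst p) [^]\<^bsub>\<Gamma>\<^esub> i)
          (nv (sconst (coeff (left_poly (sshift p f)) j)) \<otimes>\<^bsub>\<Gamma>\<^esub> nv (svar - sconst p) [^]\<^bsub>\<Gamma>\<^esub> j)"
        using \<phi>_eq[OF i(1)] \<phi>_eq[OF cj] by (simp add: h \<omega>_def)
    qed
    then show ?thesis using \<phi>_eq[OF i(1)] by simp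
  qed
  have "extends_valuation A \<Gamma> v (copy_group quot_code) (W.shifted_val quot_code p)"
  proof (rule extends_valuationI[where \<phi> = "\<lambda>s. \<phi> (fst s) (snd s)"
        and \<psi> = "\<lambda>s. quot_code (\<rho> (fst s) + \<kappa> (snd s))"])
    show "ordered_group \<Gamma>" by (rule ordered)
    show "ordered_group (copy_group quot_code)" by (rule ordered_group_copy_group[OF inj_quot_code])
    show "(\<phi> (fst s) (snd s), \<phi> (fst t) (snd t)) \<in> le_rel \<Gamma> \<longleftrightarrow>
        (quot_code (\<rho> (fst s) + \<kappa> (snd s)), quot_code (\<rho> (fst t) + \<kappa> (snd t))) \<in> le_rel (copy_group quot_code)" for s t
      by (simp add: gle_iff less not_less copy_group_simps[OF inj_quot_code])
    show "v 0 = None" using v_eq[OF skew_0] by simp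
    show "W.shifted_val quot_code p 0 = None" by (simp add: W.shifted_val_def)
    fix f assume f: "f \<in> A" "f \<noteq> 0"
    define h where "h = left_poly (sshift p f)"
    have "h \<noteq> 0" using f by (simp add: h_def)
    then obtain i where i: "coeff h i \<noteq> 0" "W.weight h = \<rho> (gord (coeff h i)) + \<kappa> (int i)"
      by (rule W.weight_attained)
    have "v f = Some (\<phi> (gord (coeff h i)) (int i))"
      using vals[OF f(1) h_def i] f by (simp add: v_eq)
    moreover have "W.shifted_val quot_code p f = Some (quot_code (\<rho> (gord (coeff h i)) + \<kappa> (int i)))"
      using f i by (simp add: W.shifted_val_def h_def)
    ultimately show "\<exists>s. v f = Some (\<phi> (fst s) (snd s)) \<and>
        W.shifted_val quot_code p f = Some (quot_code (\<rho> (fst s) + \<kappa> (snd s)))"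
      by (intro exI[of _ "(gord (coeff h i), int i)"]) simp
  qed (auto simp: \<phi>_add W.rho_add W.kappa_add copy_group_simps[OF inj_quot_code] algebra_simps)
  then show ?thesis using W.valuation_shifted_val[OF inj_quot_code] by blast
qed

text \<open>Here all values of nonzero elements of \<open>A\<close> turn out to be of the form
  \<open>\<gamma> s\<close>, so the rationals alone serve as the auxiliary group.\<close>

lemma extendable_if_pseudo_limit:
  assumes all: "\<And>p. p \<in> puiseux \<Longrightarrow> nv (svar - sconst p) \<in> range \<gamma>"
  shows extendable
proof -
  have "\<forall>p\<in>puiseux. \<exists>q r. nv (svar - sconst p) = \<gamma> q \<and> r \<noteq> 0 \<and>
      glt (\<gamma> q) (nv (svar - sconst (p + gmonom r q)))"
    using all nv_svar_step by blast
  then obtain Q R where QR: "\<And>p. p \<in> puiseux \<Longrightarrow> nv (svar - sconst p) = \<gamma> (Q p) \<and> R p \<noteq> 0 \<and>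
      glt (\<gamma> (Q p)) (nv (svar - sconst (p + gmonom (R p) (Q p))))"
    by metis
  define P where "P k = ((\<lambda>p. p + gmonom (R p) (Q p)) ^^ k) 0" for k
  define q where "q k = Q (P k)" for k
  define r where "r k = R (P k)" for k
  have P_0: "P 0 = 0" and P_Suc: "P (Suc k) = P k + gmonom (r k) (q k)" for k
    by (simp_all add: P_def q_def r_def)
  have P_mem: "P k \<in> puiseux" for k
    by (induction k) (use puiseux_of_real[of 0] in \<open>auto simp: P_0 P_Suc intro: puiseux_add puiseux_gmonom\<close>)
  have nvP: "nv (svar - sconst (P k)) = \<gamma> (q k)" and r: "r k \<noteq> 0"
    and "glt (\<gamma> (q k)) (nv (svar - sconst (P (Suc k))))" for k
    using QR[OF P_mem[of k]] by (simp_all add: q_def r_def P_Suc)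
  then have mono: "q k < q (Suc k)" for k by (metis \<gamma>_less_iff)
  have less1: "q k < 1" for k
    using nv_svar_less[OF P_mem[of k]] by (simp add: nvP \<gamma>_less_iff)
  have sm: "strict_mono q" using mono by (simp add: strict_mono_Suc_iff)
  \<comment> \<open>The sequence increases strictly, so the cut contains every \<open>q k\<close>,
    and the value of y - \<theta> will exceed them all while staying below every rational upper
    bound.\<close>
  define C where "C = {x. \<exists>k. x < q k}"
  have "1 \<notin> C" using less1 by (auto simp: C_def not_less intro: less_imp_le)
  moreover have "p \<in> C" if "x \<in> C" "p \<le> x" for p x
    using that by (auto simp: C_def intro: le_less_trans)
  ultimately obtain \<rho> :: "rat \<Rightarrow> real \<times> real" and \<kappa>
    where gw: "generic_weights \<rho> \<kappa>" and cut: "\<And>q. \<rho> q < \<kappa> 1 \<longleftrightarrow> q \<in> C"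
    using ex_generic_weights[of C] by blast
  interpret W: generic_weights \<rho> \<kappa> by (rule gw)
  \<comment> \<open>The series with terms r_k x^(-q_k). The exponents are distinct, so each inner
    sum has at most one term.\<close>
  define \<theta> where "\<theta> = Abs_gseries (\<lambda>a. \<Sum>k | q k = a. r k)"
  have wo_q: "wo (range q)"
    unfolding wo_iff
  proof (intro allI impI)
    fix B assume B: "B \<subseteq> range q" "B \<noteq> {}"
    define k where "k = (LEAST k. q k \<in> B)"
    have "\<exists>k. q k \<in> B" using B by blast
    then have k: "q k \<in> B" unfolding k_def by (rule LeastI_ex)
    have "q k \<le> q j" if "q j \<in> B" for j
      using that sm Least_le[of "\<lambda>k. q k \<in> B" j] by (simp add: k_def strict_mono_less_eq)
    then show "\<exists>m\<in>B. \<forall>b\<in>B. m \<le> b" using B k by blast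
  qed
  have "{a. (\<Sum>k | q k = a. r k) \<noteq> 0} \<subseteq> range q"
    by (auto elim!: sum.not_neutral_contains_not_neutral)
  then have gcoeff_\<theta>: "gcoeff \<theta> a = (\<Sum>k | q k = a. r k)" for a
    unfolding \<theta>_def by (subst gcoeff_Abs) (auto intro: wo_subset[OF wo_q])
  have q_eq: "q j = q k \<longleftrightarrow> j = k" for j k using sm by (simp add: strict_mono_eq)
  have gcoeff_\<theta>_q: "gcoeff \<theta> (q k) = r k" for k by (simp add: gcoeff_\<theta> q_eq)
  have gcoeff_\<theta>_0: "gcoeff \<theta> a = 0" if "a \<notin> range q" for a
  proof -
    have "{k. q k = a} = {}" using that by auto
    then show ?thesis unfolding gcoeff_\<theta> by simp
  qed
  have gcoeff_P: "gcoeff (P k) a = (\<Sum>j<k. if a = q j then r j else 0)" for k a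
    by (induction k) (simp_all add: P_0 P_Suc gcoeff_gmonom)
  have gord_diff: "\<theta> - P k \<noteq> 0" "gord (\<theta> - P k) = q k" for k
  proof -
    have "(\<Sum>j<k. if q k = q j then r j else 0) = 0" by (intro sum.neutral) (simp add: q_eq)
    then have nz: "gcoeff (\<theta> - P k) (q k) \<noteq> 0" by (simp add: gcoeff_\<theta>_q gcoeff_P r)
    then show "\<theta> - P k \<noteq> 0" by (metis gcoeff_zero)
    have low: "gcoeff (\<theta> - P k) b = 0" if b: "b < q k" for b
    proof (cases "b \<in> range q")
      case True
      then obtain i where i: "b = q i" by blast
      then have "i < k" using b sm by (simp add: strict_mono_less)
      then show ?thesis by (simp add: i gcoeff_\<theta>_q gcoeff_P q_eq)
    next
      case False
      then have "(\<Sum>j<k. if b = q j then r j else 0) = 0" by (intro sum.neutral) auto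
      then show ?thesis using False by (simp add: gcoeff_\<theta>_0 gcoeff_P)
    qed
    show "gord (\<theta> - P k) = q k" using nz low by (rule gord_eqI)
  qed
  define w where "w = W.shifted_val quot_code \<theta>"
  interpret w: skew_valuation UNIV "copy_group quot_code" w
    using W.valuation_shifted_val(1)[OF inj_quot_code] diff_subring_UNIV
    by (simp add: skew_valuation_def skew_valuation_axioms_def w_def)
  note copy = copy_group_simps[OF inj_quot_code]
  have w_nv: "w.nv f = quot_code (W.weight (left_poly (sshift \<theta> f)))" if "f \<noteq> 0" for f
    using that w.v_eq[of f] by (simp add: w_def W.shifted_val_def)
  have w_sconst: "w.nv (sconst a) = quot_code (\<rho> (gord a))" if "a \<noteq> 0" for a
    using that by (simp add: w_nv W.weight_const)
  \<comment> \<open>In y - P k = (y - \<theta>) + (\<theta> - P k) the series \<theta> - P k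
    dominates. Thus \<open>w\<close> takes on y - P k the value corresponding to that of
    \<open>v\<close>, and both can be evaluated on the same expansion around \<open>P k\<close>
    instead of \<theta>.\<close>
  have w_P: "w.nv (svar - sconst (P k)) = quot_code (\<rho> (q k))" for k
  proof -
    have "q k \<in> C" using mono by (auto simp: C_def)
    then have "\<rho> (gord (\<theta> - P k)) < \<kappa> 1" by (simp add: cut gord_diff)
    then have "W.weight [:\<theta> - P k, 1:] = \<rho> (q k)" using W.weight_linear gord_diff by metis
    moreover have "left_poly (sshift \<theta> (svar - sconst (P k))) = [:\<theta> - P k, 1:]"
      by (simp add: sshift_diff)
    ultimately show ?thesis by (simp add: w_nv)
  qed
  have w_pow: "quot_code (\<rho> x) [^]\<^bsub>copy_group quot_code\<^esub> (n::nat) = quot_code (\<rho> (of_nat n * x))" for x n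
    by (induction n) (simp_all add: copy W.rho_add[symmetric] algebra_simps)
  have w_less: "w.glt (quot_code (\<rho> x)) (quot_code (\<rho> y)) \<longleftrightarrow> x < y" for x y
    using inj_quot_code by (auto simp: w.glt_def copy inj_eq less_le)
  have "extends_valuation A \<Gamma> v (copy_group quot_code) w"
  proof (rule extends_valuationI[where \<phi> = \<gamma> and \<psi> = "\<lambda>x. quot_code (\<rho> x)"])
    show "ordered_group \<Gamma>" by (rule ordered)
    show "ordered_group (copy_group quot_code)" by (rule ordered_group_copy_group[OF inj_quot_code])
    show "(\<gamma> s, \<gamma> t) \<in> le_rel \<Gamma> \<longleftrightarrow> (quot_code (\<rho> s), quot_code (\<rho> t)) \<in> le_rel (copy_group quot_code)" for s t
      by (simp add: gle_iff \<gamma>_less_iff not_less copy)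
    show "v 0 = None" using v_eq[OF skew_0] by simp
    show "w 0 = None" by (simp add: w_def W.shifted_val_def)
    fix f assume f: "f \<in> A" "f \<noteq> 0"
    obtain k where k: "coeff (left_poly (sshift (P k) f)) 0 \<noteq> 0"
      "\<And>j. j > 0 \<Longrightarrow> coeff (left_poly (sshift (P k) f)) j \<noteq> 0 \<Longrightarrow>
        gord (coeff (left_poly (sshift (P k) f)) 0) < gord (coeff (left_poly (sshift (P k) f)) j) + of_nat j * q k"
      using ex_constant_expansion[OF P_0 P_Suc r mono less1 f] by blast
    define c where "c = coeff (left_poly (sshift (P k) f))"
    have cK: "c j \<in> puiseux" for j
      using skew_sshift[OF P_mem f(1)] by (simp add: c_def skew_polys_def)
    have c: "c 0 \<noteq> 0" "\<And>j. j > 0 \<Longrightarrow> c j \<noteq> 0 \<Longrightarrow> gord (c 0) < gord (c j) + of_nat j * q k"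
      using k by (simp_all add: c_def)
    have "nv f = nv (sconst (c 0)) \<otimes>\<^bsub>\<Gamma>\<^esub> nv (svar - sconst (P k)) [^]\<^bsub>\<Gamma>\<^esub> (0::nat)"
      unfolding c_def
      by (rule nv_expansion[OF f(1) P_mem], unfold c_def[symmetric])
        (use c cK in \<open>simp_all add: nv_sconst nvP \<gamma>_pow \<gamma>_add[symmetric] \<gamma>_less_iff\<close>)
    then have 1: "nv f = \<gamma> (gord (c 0))" using nv_sconst[OF cK c(1)] by simp
    have "w.nv f = w.nv (sconst (c 0)) \<otimes>\<^bsub>copy_group quot_code\<^esub>
        w.nv (svar - sconst (P k)) [^]\<^bsub>copy_group quot_code\<^esub> (0::nat)"
      unfolding c_def
      by (rule w.nv_expansion, unfold c_def[symmetric])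
        (use c in \<open>simp_all add: w_sconst w_P w_pow copy W.rho_add[symmetric] w_less\<close>)
    then have 2: "w.nv f = quot_code (\<rho> (gord (c 0)))" using w_sconst[OF c(1)] by (simp add: copy)
    show "\<exists>s. v f = Some (\<gamma> s) \<and> w f = Some (quot_code (\<rho> s))"
      using 1 2 f by (intro exI[of _ "gord (c 0)"]) (simp add: v_eq w.v_eq)
  qed (simp_all add: \<gamma>_add W.rho_add copy)
  then show ?thesis using W.valuation_shifted_val[OF inj_quot_code] unfolding w_def by blast
qed

end

theorem lemma5p1:
  fixes \<Gamma> :: "'g ogroup" and v :: "gseries skew_poly \<Rightarrow> 'g option"
  assumes "valuation (skew_polys puiseux) \<Gamma> v"
    and "ore_real_residue_field (skew_polys puiseux) \<Gamma> v"
  shows "\<exists>(\<Gamma>' :: gseries skew_poly ore_quot set ogroup) w.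
    valuation (skew_polys UNIV) \<Gamma>' w \<and>
    ore_real_residue_field (skew_polys UNIV) \<Gamma>' w \<and>
    extends_valuation (skew_polys puiseux) \<Gamma> v \<Gamma>' w"
proof -
  interpret v: skew_valuation puiseux \<Gamma> v
    using assms(1) diff_subring_puiseux by (simp add: skew_valuation_def skew_valuation_axioms_def)
  interpret v: puiseux_valuation \<Gamma> v
    by unfold_locales (rule v.residue_of_quotient[OF assms(2)])
  show ?thesis
    using v.extendable_if_new_value v.extendable_if_pseudo_limit by blast
qed

end
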